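(* Let $(G,L)$ be a $(G,L)$-pair. The mantle $\Gamma_\infty=L^\Xi\setminus G/L^\Xi$ of the pair $(G,L)$ contains a central subsemigroup canonically isomorphic to the semigroup $L\setminus G_{min}/L$.
   Context: Classical groups. A matrix $g$ over $\mathbb R,\mathbb C$ or $\mathbb H$ with rows and columns indexed by a countable basis is finite if $g-1$ has only finitely many nonzero entries. All groups below consist of finite invertible matrices satisfying the usual identities. The irreducible classical groups and their maximal heavy subgroups are: $\mathrm{GL}(\infty,\mathbb R)\supset \mathrm O(\infty)$; $\mathrm{GL}(\infty,\mathbb C)\supset \mathrm U(\infty)$; $\mathrm{GL}(\infty,\mathbb H)\supset\mathrm{Sp}(\infty)$; $\mathrm U(\infty,\infty)\supset \mathrm U(\infty)\times \mathrm U(\infty)$; $\mathrm{Sp}(2\infty,\mathbb R)\supset \mathrm U(\infty)$; $\mathrm{Sp}(2\infty,\mathbb C)\supset\mathrm{Sp}(\infty)$; $\mathrm{Sp}(\infty,\infty)\supset\mathrm{Sp}(\infty)\times\mathrm{Sp}(\infty)$; $\mathrm O(\infty,\infty)\supset\mathrm O(\infty)\times\mathrm O(\infty)$; $\mathrm O(\infty,\mathbb C)\supset\mathrm O(\infty)$; $\mathrm{SO}^*(2\infty)\supset\mathrm U(\infty)$; $\mathrm U(p,\infty)\supset\mathrm U(\infty)$; $\mathrm O(p,\infty)\supset\mathrm O(\infty)$; $\mathrm{Sp}(p,\infty)\supset\mathrm{Sp}(\infty)$ with $0\le p<\infty$ (for $p=0$: the groups $\mathrm U(\infty),\mathrm O(\infty),\mathrm{Sp}(\infty)$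 themselves). Here $\mathrm{Sp}(\infty)$ is the quaternionic unitary group. A classical group is a finite product of irreducible ones; its maximal heavy subgroup $K$ is the product of the maximal heavy subgroups of the factors. A heavy group is a finite product of groups $\mathrm O(\infty),\mathrm U(\infty),\mathrm{Sp}(\infty)$ (called irreducible heavy groups). Straight homomorphisms. Trivial homomorphisms between irreducible heavy groups are: the identity maps, elementwise complex conjugation of $\mathrm U(\infty)$, and the obvious maps $\mathrm O(\infty)\to\mathrm U(\infty)$, $\mathrm O(\infty)\to\mathrm{Sp}(\infty)$, $\mathrm U(\infty)\to\mathrm{Sp}(\infty)$, $\mathrm U(\infty)\to\mathrm O(2\infty)$, $\mathrm{Sp}(\infty)\to\mathrm O(4\infty)$, $\mathrm{Sp}(\infty)\to\mathrm U(2\infty)$. For $L=L_1\times\dots\times L_p$ heavy and $K$ irreducible heavy, a homomorphism $L\to K$ is straight if it has the block diagonal form $(g_1,\dots,g_p)\mapsto\mathrm{diag}(1_a,\tau_1(g_{m_1}),\dots,\tau_N(g_{m_N}))$ with $\tau_j$ trivial, $0<N<\infty$, $a\in\{0,1,2,\dots,\infty\}$ (not required to be faithful). For $K=K_1\times\dots\times K_q$, a straight homomorphism $L\to K$ is a product of straight homomorphisms $L\to K_i$. A $(G,L)$-pair consists of a classical group $G$ with maximal heavy subgroup $K$ and a heavy group $L$ straightly embedded in $K$. The group $G$ acts in a direct sum $\oplus\ell_2$ whose basis consists of basis vectors of copies of the $\ell_2$'s of the $L_j$ and of basis vectors $e_\mu$ fixed by $L$. $G_{min}\subset G$ is the subgroup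 stabilizing all $e_\mu$, in the sense of block matrices: its elements fix all $e_\mu$ and preserve the span of the other basis vectors (for example, for $(G,L)=(\mathrm{GL}(7+2\infty,\mathbb R),\mathrm O(\infty)\times\mathrm O(\infty))$ one has $G_{min}=\mathrm{GL}(2\infty,\mathbb R)$). It contains $L$. The product of $\mathfrak g,\mathfrak h\in L\setminus G_{min}/L$ is the value of $L\,g\,\Theta_m h\,L$ for all sufficiently large $m=(m_1,\dots,m_p)$, where $g\in\mathfrak g$, $h\in\mathfrak h$ and the $j$-th component of $\Theta_m\in L$ is the permutation matrix swapping the $i$-th and $(m_j+i)$-th basis vectors, $1\le i\le m_j$, and fixing all others. Mantle. Let $L=L_1\times\dots\times L_p$, where $L_j$ acts in $\ell_2(\mathbb N)$. For each $j$ split $\mathbb N=\Xi_j\sqcup\Omega_j$ into two infinite (countable) subsets. Let $L^\Xi\subset L$ be the product of the stabilizers in $L_j$ of all basis vectors with indices in $\Xi_j$. Enumerate $\Omega_j=\{\omega_{j,1},\omega_{j,2},\dots\}$ and let $\Theta^{[\Xi]}_m\in L^\Xi$ be the element whose $j$-th component is the permutation matrix swapping the basis vectors $\omega_{j,i}$ and $\omega_{j,m_j+i}$, $1\le i\le m_j$, and fixing all others. The mantle is the semigroup $\Gamma_\infty=L^\Xi\setminus G/L^\Xi$ with the product $\mathfrak g\circ\mathfrak h:=$ the value of $L^\Xi g\Theta_m^{[\Xi]}hL^\Xi$ for all sufficiently large $m$, $g\in\mathfrak g$, $h\in\mathfrak h$. "Canonically" refers to the map induced by relabelling basis vectors through the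 enumerations $\mathbb N\to\Omega_j$: it identifies $(G_{min},L)$ with $(G^\Xi,L^\Xi)$, where $G^\Xi\subset G$ consists of elements fixing all basis vectors fixed by $L^\Xi$ and preserving the span of the remaining ones. *)

theory Defs
  imports
    Complex_Main
    "HOL-Library.Extended_Nat"
    "HOL-Library.Groups_Big_Fun"
    "HOL-Algebra.Product_Groups"
begin

section \<open>Quaternions\<close>

text \<open>\<open>Quat a b c d\<close> is \<open>a + b i + c j + d k\<close>. All scalars live in this type: the reals and the
  complex numbers are the subsets \<open>{a}\<close> and \<open>{a + b i}\<close>. Quaternionic conjugation restricts to
  complex conjugation and to the identity there.\<close>

datatype quat = Quat (qre: real) (qi: real) (qj: real) (qk: real)

instantiation quat :: ring_1
begin

definition "0 = Quat 0 0 0 0"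
definition "1 = Quat 1 0 0 0"
definition "x + y = Quat (qre x + qre y) (qi x + qi y) (qj x + qj y) (qk x + qk y)"
definition "x - y = Quat (qre x - qre y) (qi x - qi y) (qj x - qj y) (qk x - qk y)"
definition "- x = Quat (- qre x) (- qi x) (- qj x) (- qk x)"
definition "x * y = Quat
  (qre x * qre y - qi x * qi y - qj x * qj y - qk x * qk y)
  (qre x * qi y + qi x * qre y + qj x * qk y - qk x * qj y)
  (qre x * qj y - qi x * qk y + qj x * qre y + qk x * qi y)
  (qre x * qk y + qi x * qj y - qj x * qi y + qk x * qre y)"

instance
  by standard
    (simp_all add: zero_quat_def one_quat_def plus_quat_def minus_quat_def uminus_quat_def
      times_quat_def quat.expand algebra_simps)

end

definition qconj :: "quat \<Rightarrow> quat" where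
  "qconj x = Quat (qre x) (- qi x) (- qj x) (- qk x)"

datatype scalars = RealScalars | ComplexScalars | QuatScalars

fun scalar_set :: "scalars \<Rightarrow> quat set" where
  "scalar_set RealScalars = {x. qi x = 0 \<and> qj x = 0 \<and> qk x = 0}"
| "scalar_set ComplexScalars = {x. qj x = 0 \<and> qk x = 0}"
| "scalar_set QuatScalars = UNIV"


section \<open>Finite matrices\<close>

type_synonym 'i mat = "'i \<Rightarrow> 'i \<Rightarrow> quat"

definition mat_one :: "'i mat" where
  "mat_one i j = (if i = j then 1 else 0)"

definition mat_mult :: "'i mat \<Rightarrow> 'i mat \<Rightarrow> 'i mat" where
  "mat_mult g h i j = Sum_any (\<lambda>k. g i k * h k j)"

definition mat_transpose :: "'i mat \<Rightarrow> 'i mat" where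
  "mat_transpose g i j = g j i"

definition mat_adjoint :: "'i mat \<Rightarrow> 'i mat" where
  "mat_adjoint g i j = qconj (g j i)"

text \<open>A matrix whose rows and columns are indexed by a subset \<open>B\<close> of the index type is extended by
  the identity to the whole type.\<close>

definition finite_mats :: "scalars \<Rightarrow> 'i set \<Rightarrow> 'i mat set" where
  "finite_mats F B = {g. finite {(i, j). g i j \<noteq> mat_one i j}
     \<and> (\<forall>i j. i \<notin> B \<or> j \<notin> B \<longrightarrow> g i j = mat_one i j)
     \<and> (\<forall>i j. g i j \<in> scalar_set F)}"

definition GL_mats :: "scalars \<Rightarrow> 'i set \<Rightarrow> 'i mat set" where
  "GL_mats F B = {g \<in> finite_mats F B.
     \<exists>h \<in> finite_mats F B. mat_mult g h = mat_one \<and> mat_mult h g = mat_one}"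

definition mat_group :: "'i mat set \<Rightarrow> 'i mat monoid" where
  "mat_group A = \<lparr>carrier = A, monoid.mult = mat_mult, one = mat_one\<rparr>"

text \<open>Matrices act on columns: \<open>g e\<^sub>b\<close> is the \<open>b\<close>-th column of \<open>g\<close>.\<close>

definition fixes_vec :: "'i mat \<Rightarrow> 'i \<Rightarrow> bool" where
  "fixes_vec g b \<longleftrightarrow> (\<forall>b'. g b' b = mat_one b' b)"


section \<open>Heavy groups\<close>

datatype heavy = O_inf | U_inf | Sp_inf

fun heavy_scalars :: "heavy \<Rightarrow> scalars" where
  "heavy_scalars O_inf = RealScalars"
| "heavy_scalars U_inf = ComplexScalars"
| "heavy_scalars Sp_inf = QuatScalars"

definition heavy_group :: "heavy \<Rightarrow> nat mat monoid" where
  "heavy_group k = mat_group {g \<in> GL_mats (heavy_scalars k) UNIV. mat_mult (mat_adjoint g) g = mat_one}"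

definition heavy_product :: "heavy list \<Rightarrow> (nat \<Rightarrow> nat mat) monoid" where
  "heavy_product Ls = product_group {..<length Ls} (\<lambda>j. heavy_group (Ls ! j))"


section \<open>Classical groups\<close>

text \<open>The constructors stand for \<open>GL(\<infinity>,R)\<close>, \<open>GL(\<infinity>,C)\<close>, \<open>GL(\<infinity>,H)\<close>, \<open>U(\<infinity>,\<infinity>)\<close>, \<open>O(\<infinity>,\<infinity>)\<close>, \<open>Sp(\<infinity>,\<infinity>)\<close>,
  \<open>Sp(2\<infinity>,R)\<close>, \<open>Sp(2\<infinity>,C)\<close>, \<open>O(\<infinity>,C)\<close>, \<open>SO*(2\<infinity>)\<close>, \<open>U(p,\<infinity>)\<close>, \<open>O(p,\<infinity>)\<close>, \<open>Sp(p,\<infinity>)\<close>.\<close>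

datatype classical =
    GL_R | GL_C | GL_H
  | U_inf_inf | O_inf_inf | Sp_inf_inf
  | Sp_R | Sp_C | O_C | SO_star
  | U_p_inf nat | O_p_inf nat | Sp_p_inf nat

fun classical_scalars :: "classical \<Rightarrow> scalars" where
  "classical_scalars GL_R = RealScalars"
| "classical_scalars GL_C = ComplexScalars"
| "classical_scalars GL_H = QuatScalars"
| "classical_scalars U_inf_inf = ComplexScalars"
| "classical_scalars O_inf_inf = RealScalars"
| "classical_scalars Sp_inf_inf = QuatScalars"
| "classical_scalars Sp_R = RealScalars"
| "classical_scalars Sp_C = ComplexScalars"
| "classical_scalars O_C = ComplexScalars"
| "classical_scalars SO_star = ComplexScalars"
| "classical_scalars (U_p_inf p) = ComplexScalars"
| "classical_scalars (O_p_inf p) = RealScalars"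
| "classical_scalars (Sp_p_inf p) = QuatScalars"

text \<open>The spaces acted upon have a basis indexed by a subset of \<^typ>\<open>nat + nat\<close>: two full copies of
  \<open>nat\<close> for the groups of size \<open>\<infinity> + \<infinity>\<close> or \<open>2\<infinity>\<close>, \<open>p\<close> vectors and a full copy for size \<open>p + \<infinity>\<close>, and
  the right copy alone for size \<open>\<infinity>\<close>.\<close>

fun left_size :: "classical \<Rightarrow> enat" where
  "left_size GL_R = 0"
| "left_size GL_C = 0"
| "left_size GL_H = 0"
| "left_size U_inf_inf = \<infinity>"
| "left_size O_inf_inf = \<infinity>"
| "left_size Sp_inf_inf = \<infinity>"
| "left_size Sp_R = \<infinity>"
| "left_size Sp_C = \<infinity>"
| "left_size O_C = 0"
| "left_size SO_star = \<infinity>"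
| "left_size (U_p_inf p) = enat p"
| "left_size (O_p_inf p) = enat p"
| "left_size (Sp_p_inf p) = enat p"

definition basis :: "classical \<Rightarrow> (nat + nat) set" where
  "basis X = Inl ` {n. enat n < left_size X} \<union> range Inr"

text \<open>\<open>I = diag(1, -1)\<close> and \<open>J = (0 1; -1 0)\<close>.\<close>

fun form_I :: "(nat + nat) mat" where
  "form_I (Inl m) (Inl n) = (if m = n then 1 else 0)"
| "form_I (Inr m) (Inr n) = (if m = n then - 1 else 0)"
| "form_I _ _ = 0"

fun form_J :: "(nat + nat) mat" where
  "form_J (Inl m) (Inr n) = (if m = n then 1 else 0)"
| "form_J (Inr m) (Inl n) = (if m = n then - 1 else 0)"
| "form_J _ _ = 0"

definition preserves_herm :: "(nat + nat) mat \<Rightarrow> (nat + nat) mat \<Rightarrow> bool" where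
  "preserves_herm S g \<longleftrightarrow> mat_mult (mat_adjoint g) (mat_mult S g) = S"

definition preserves_bilin :: "(nat + nat) mat \<Rightarrow> (nat + nat) mat \<Rightarrow> bool" where
  "preserves_bilin S g \<longleftrightarrow> mat_mult (mat_transpose g) (mat_mult S g) = S"

fun classical_identities :: "classical \<Rightarrow> (nat + nat) mat \<Rightarrow> bool" where
  "classical_identities GL_R g \<longleftrightarrow> True"
| "classical_identities GL_C g \<longleftrightarrow> True"
| "classical_identities GL_H g \<longleftrightarrow> True"
| "classical_identities U_inf_inf g \<longleftrightarrow> preserves_herm form_I g"
| "classical_identities O_inf_inf g \<longleftrightarrow> preserves_bilin form_I g"
| "classical_identities Sp_inf_inf g \<longleftrightarrow> preserves_herm form_I g"
| "classical_identities Sp_R g \<longleftrightarrow> preserves_bilin form_J g"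
| "classical_identities Sp_C g \<longleftrightarrow> preserves_bilin form_J g"
| "classical_identities O_C g \<longleftrightarrow> preserves_bilin mat_one g"
| "classical_identities SO_star g \<longleftrightarrow> preserves_bilin mat_one g \<and> preserves_herm form_J g"
| "classical_identities (U_p_inf p) g \<longleftrightarrow> preserves_herm form_I g"
| "classical_identities (O_p_inf p) g \<longleftrightarrow> preserves_bilin form_I g"
| "classical_identities (Sp_p_inf p) g \<longleftrightarrow> preserves_herm form_I g"

definition classical_group :: "classical \<Rightarrow> (nat + nat) mat monoid" where
  "classical_group X =
     mat_group {g \<in> GL_mats (classical_scalars X) (basis X). classical_identities X g}"

definition classical_product :: "classical list \<Rightarrow> (nat \<Rightarrow> (nat + nat) mat) monoid" where
  "classical_product Gs = product_group {..<length Gs} (\<lambda>r. classical_group (Gs ! r))"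


section \<open>Trivial homomorphisms\<close>

datatype trivial =
    Ident heavy | Conj
  | O_to_U | O_to_Sp | U_to_Sp
  | U_to_O | Sp_to_O | Sp_to_U

fun triv_source :: "trivial \<Rightarrow> heavy" where
  "triv_source (Ident k) = k"
| "triv_source Conj = U_inf"
| "triv_source O_to_U = O_inf"
| "triv_source O_to_Sp = O_inf"
| "triv_source U_to_Sp = U_inf"
| "triv_source U_to_O = U_inf"
| "triv_source Sp_to_O = Sp_inf"
| "triv_source Sp_to_U = Sp_inf"

fun triv_target :: "trivial \<Rightarrow> heavy" where
  "triv_target (Ident k) = k"
| "triv_target Conj = U_inf"
| "triv_target O_to_U = U_inf"
| "triv_target O_to_Sp = Sp_inf"
| "triv_target U_to_Sp = Sp_inf"
| "triv_target U_to_O = O_inf"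
| "triv_target Sp_to_O = O_inf"
| "triv_target Sp_to_U = U_inf"

text \<open>A trivial homomorphism replaces every matrix entry by a square block of size \<open>triv_size\<close>.
  For \<open>U_to_O\<close>, \<open>Sp_to_O\<close>, \<open>Sp_to_U\<close> the block of \<open>x\<close> is the matrix of left multiplication by \<open>x\<close>
  on \<open>C = R + iR\<close>, on \<open>H = R + iR + jR + kR\<close>, and on \<open>H = C + jC\<close> (a right vector space over \<open>C\<close>).\<close>

fun triv_size :: "trivial \<Rightarrow> nat" where
  "triv_size U_to_O = 2"
| "triv_size Sp_to_O = 4"
| "triv_size Sp_to_U = 2"
| "triv_size _ = 1"

definition qunit :: "nat \<Rightarrow> quat" where
  "qunit s = [Quat 1 0 0 0, Quat 0 1 0 0, Quat 0 0 1 0, Quat 0 0 0 1] ! s"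

definition real_coord :: "nat \<Rightarrow> quat \<Rightarrow> quat" where
  "real_coord s x = Quat ([qre x, qi x, qj x, qk x] ! s) 0 0 0"

definition complex_coord :: "nat \<Rightarrow> quat \<Rightarrow> quat" where
  "complex_coord s x = [Quat (qre x) (qi x) 0 0, Quat (qj x) (- qk x) 0 0] ! s"

fun triv_entry :: "trivial \<Rightarrow> quat \<Rightarrow> nat \<Rightarrow> nat \<Rightarrow> quat" where
  "triv_entry U_to_O x s t = real_coord s (x * qunit t)"
| "triv_entry Sp_to_O x s t = real_coord s (x * qunit t)"
| "triv_entry Sp_to_U x s t = complex_coord s (x * [qunit 0, qunit 2] ! t)"
| "triv_entry Conj x s t = qconj x"
| "triv_entry _ x s t = x"


section \<open>Straight homomorphisms\<close>

text \<open>A basis of the space on which \<open>diag(1\<^sub>a, \<tau>\<^sub>1(g\<^bsub>m 1\<^esub>), \<dots>, \<tau>\<^sub>N(g\<^bsub>m N\<^esub>))\<close> acts: \<open>Fixed n\<close> for the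
  unit block, and \<open>Copy c s n\<close> for the \<open>s\<close>-th of the basis vectors that the block \<open>\<tau>\<^sub>c\<close> makes out of
  the \<open>n\<close>-th basis vector of the source. The component \<open>slot_of\<close> records how these are numbered
  by the basis vectors of the target group.\<close>

datatype slot = Fixed nat | Copy nat nat nat

record straight_data =
  fixed_size :: enat
  blocks :: "(nat \<times> trivial) list"
  slot_of :: "nat \<Rightarrow> slot"

definition slots :: "straight_data \<Rightarrow> slot set" where
  "slots d = {Fixed n |n. enat n < fixed_size d}
     \<union> {Copy c s n |c s n. c < length (blocks d) \<and> s < triv_size (snd (blocks d ! c))}"

definition straight :: "heavy list \<Rightarrow> heavy \<Rightarrow> straight_data \<Rightarrow> bool" where
  "straight Ls k d \<longleftrightarrow> blocks d \<noteq> []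
     \<and> (\<forall>(m, \<tau>) \<in> set (blocks d). m < length Ls \<and> triv_source \<tau> = Ls ! m \<and> triv_target \<tau> = k)
     \<and> bij_betw (slot_of d) UNIV (slots d)"

fun block_diag :: "(nat \<times> trivial) list \<Rightarrow> (nat \<Rightarrow> nat mat) \<Rightarrow> slot mat" where
  "block_diag bs g (Copy c s n) (Copy c' s' n') =
     (if c = c' then triv_entry (snd (bs ! c)) (g (fst (bs ! c)) n n') s s' else 0)"
| "block_diag bs g (Fixed n) (Fixed n') = (if n = n' then 1 else 0)"
| "block_diag bs g _ _ = 0"

definition straight_hom :: "straight_data \<Rightarrow> (nat \<Rightarrow> nat mat) \<Rightarrow> nat mat" where
  "straight_hom d g u v = block_diag (blocks d) g (slot_of d u) (slot_of d v)"


section \<open>Maximal heavy subgroups\<close>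

fun max_heavy :: "classical \<Rightarrow> heavy list" where
  "max_heavy GL_R = [O_inf]"
| "max_heavy GL_C = [U_inf]"
| "max_heavy GL_H = [Sp_inf]"
| "max_heavy U_inf_inf = [U_inf, U_inf]"
| "max_heavy O_inf_inf = [O_inf, O_inf]"
| "max_heavy Sp_inf_inf = [Sp_inf, Sp_inf]"
| "max_heavy Sp_R = [U_inf]"
| "max_heavy Sp_C = [Sp_inf]"
| "max_heavy O_C = [O_inf]"
| "max_heavy SO_star = [U_inf]"
| "max_heavy (U_p_inf p) = [U_inf]"
| "max_heavy (O_p_inf p) = [O_inf]"
| "max_heavy (Sp_p_inf p) = [Sp_inf]"

definition embed_right :: "nat mat \<Rightarrow> (nat + nat) mat" where
  "embed_right k b b' = (case (b, b') of (Inr u, Inr v) \<Rightarrow> k u v | _ \<Rightarrow> mat_one b b')"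

definition embed_pair :: "nat mat \<Rightarrow> nat mat \<Rightarrow> (nat + nat) mat" where
  "embed_pair k k' b b' =
     (case (b, b') of (Inl u, Inl v) \<Rightarrow> k u v | (Inr u, Inr v) \<Rightarrow> k' u v | _ \<Rightarrow> 0)"

fun side :: "nat + nat \<Rightarrow> nat" where
  "side (Inl u) = 0"
| "side (Inr u) = 1"

fun position :: "nat + nat \<Rightarrow> nat" where
  "position (Inl u) = u"
| "position (Inr u) = u"

definition embed_doubled :: "trivial \<Rightarrow> nat mat \<Rightarrow> (nat + nat) mat" where
  "embed_doubled \<tau> k b b' = triv_entry \<tau> (k (position b) (position b')) (side b) (side b')"

text \<open>The inclusion of the maximal heavy subgroup, with components \<open>k 0\<close> and (if there are two
  factors) \<open>k 1\<close>. In \<open>Sp(2\<infinity>,R)\<close> and \<open>SO*(2\<infinity>)\<close> the subgroup \<open>U(\<infinity>)\<close> consists of the matrices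
  \<open>(A -B; B A)\<close> with \<open>A + iB\<close> unitary; in \<open>Sp(2\<infinity>,C)\<close> the subgroup \<open>Sp(\<infinity>)\<close> consists of the unitary
  matrices \<open>(A -B; cnj B cnj A)\<close>.\<close>

fun heavy_embed :: "classical \<Rightarrow> (nat \<Rightarrow> nat mat) \<Rightarrow> (nat + nat) mat" where
  "heavy_embed U_inf_inf k = embed_pair (k 0) (k 1)"
| "heavy_embed O_inf_inf k = embed_pair (k 0) (k 1)"
| "heavy_embed Sp_inf_inf k = embed_pair (k 0) (k 1)"
| "heavy_embed Sp_R k = embed_doubled U_to_O (k 0)"
| "heavy_embed SO_star k = embed_doubled U_to_O (k 0)"
| "heavy_embed Sp_C k = embed_doubled Sp_to_U (k 0)"
| "heavy_embed _ k = embed_right (k 0)"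

text \<open>The number of the factor of the maximal heavy subgroup that acts at a basis vector.\<close>

definition heavy_factor :: "classical \<Rightarrow> nat + nat \<Rightarrow> nat" where
  "heavy_factor X b = (if length (max_heavy X) = 2 then side b else 0)"


section \<open>Pairs\<close>

text \<open>\<open>sd r i\<close> describes the component \<open>L \<rightarrow> K\<close> for the \<open>i\<close>-th factor \<open>K\<close> of the maximal heavy
  subgroup of the \<open>r\<close>-th factor of the classical group.\<close>

definition pair_embed ::
  "classical list \<Rightarrow> (nat \<Rightarrow> nat \<Rightarrow> straight_data) \<Rightarrow> (nat \<Rightarrow> nat mat) \<Rightarrow> nat \<Rightarrow> (nat + nat) mat" where
  "pair_embed Gs sd l =
     (\<lambda>r\<in>{..<length Gs}. heavy_embed (Gs ! r) (\<lambda>i. straight_hom (sd r i) l))"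

definition GL_pair :: "classical list \<Rightarrow> heavy list \<Rightarrow> (nat \<Rightarrow> nat \<Rightarrow> straight_data) \<Rightarrow> bool" where
  "GL_pair Gs Ls sd \<longleftrightarrow>
     (\<forall>r < length Gs. \<forall>i < length (max_heavy (Gs ! r)). straight Ls (max_heavy (Gs ! r) ! i) (sd r i))
     \<and> inj_on (pair_embed Gs sd) (carrier (heavy_product Ls))"

definition fixed_basis ::
  "classical list \<Rightarrow> (nat \<Rightarrow> (nat + nat) mat) set \<Rightarrow> nat \<Rightarrow> (nat + nat) set" where
  "fixed_basis Gs H r = {b \<in> basis (Gs ! r). \<forall>h \<in> H. fixes_vec (h r) b}"

definition moved_basis ::
  "classical list \<Rightarrow> (nat \<Rightarrow> (nat + nat) mat) set \<Rightarrow> nat \<Rightarrow> (nat + nat) set" where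
  "moved_basis Gs H r = basis (Gs ! r) - fixed_basis Gs H r"

text \<open>The elements that fix all basis vectors fixed by \<open>H\<close> and preserve the span of the others:
  this is \<open>G\<^sub>m\<^sub>i\<^sub>n\<close> for \<open>H = L\<close> and \<open>G\<^sup>\<Xi>\<close> for \<open>H = L\<^sup>\<Xi>\<close>.\<close>

definition min_subgroup ::
  "classical list \<Rightarrow> (nat \<Rightarrow> (nat + nat) mat) set \<Rightarrow> (nat \<Rightarrow> (nat + nat) mat) set" where
  "min_subgroup Gs H = {g \<in> carrier (classical_product Gs). \<forall>r < length Gs.
     (\<forall>b \<in> fixed_basis Gs H r. fixes_vec (g r) b)
     \<and> (\<forall>b \<in> moved_basis Gs H r. \<forall>b' \<in> fixed_basis Gs H r. g r b' b = 0)}"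


section \<open>Products of double cosets\<close>

definition double_coset :: "('a, 'm) monoid_scheme \<Rightarrow> 'a set \<Rightarrow> 'a \<Rightarrow> 'a set" where
  "double_coset G H g = (H #>\<^bsub>G\<^esub> g) <#>\<^bsub>G\<^esub> H"

definition double_cosets :: "('a, 'm) monoid_scheme \<Rightarrow> 'a set \<Rightarrow> 'a set \<Rightarrow> 'a set set" where
  "double_cosets G H A = double_coset G H ` A"

text \<open>\<open>c\<close> is the value of \<open>H g \<theta>\<^sub>m h H\<close> for all sufficiently large \<open>m = (m\<^sub>0, \<dots>, m\<^bsub>p-1\<^esub>)\<close>,
  for all representatives \<open>g\<close> of \<open>a\<close> and \<open>h\<close> of \<open>b\<close>.\<close>

definition is_coset_product ::
  "('a, 'm) monoid_scheme \<Rightarrow> 'a set \<Rightarrow> nat \<Rightarrow> ((nat \<Rightarrow> nat) \<Rightarrow> 'a) \<Rightarrow> 'a set \<Rightarrow> 'a set \<Rightarrow> 'a set \<Rightarrow> bool"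
where
  "is_coset_product G H p \<theta> a b c \<longleftrightarrow>
     (\<forall>g\<in>a. \<forall>h\<in>b. \<exists>M. \<forall>m. (\<forall>j<p. M \<le> m j) \<longrightarrow> double_coset G H (g \<otimes>\<^bsub>G\<^esub> \<theta> m \<otimes>\<^bsub>G\<^esub> h) = c)"

text \<open>The set \<open>H \ A / H\<close> of double cosets with this product (\<open>A\<close> a subset of \<open>G\<close> containing \<open>H\<close>).\<close>

definition coset_semigroup ::
  "('a, 'm) monoid_scheme \<Rightarrow> 'a set \<Rightarrow> 'a set \<Rightarrow> nat \<Rightarrow> ((nat \<Rightarrow> nat) \<Rightarrow> 'a) \<Rightarrow> 'a set monoid" where
  "coset_semigroup G A H p \<theta> =
     \<lparr>carrier = double_cosets G H A,
      monoid.mult = (\<lambda>a b. THE c. is_coset_product G H p \<theta> a b c),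
      one = double_coset G H \<one>\<^bsub>G\<^esub>\<rparr>"

definition coset_product_well_defined ::
  "('a, 'm) monoid_scheme \<Rightarrow> 'a set \<Rightarrow> 'a set \<Rightarrow> nat \<Rightarrow> ((nat \<Rightarrow> nat) \<Rightarrow> 'a) \<Rightarrow> bool" where
  "coset_product_well_defined G A H p \<theta> \<longleftrightarrow>
     (\<forall>a \<in> double_cosets G H A. \<forall>b \<in> double_cosets G H A. \<exists>!c. is_coset_product G H p \<theta> a b c)"

definition is_semigroup :: "('a, 'm) monoid_scheme \<Rightarrow> bool" where
  "is_semigroup S \<longleftrightarrow>
     (\<forall>x \<in> carrier S. \<forall>y \<in> carrier S. x \<otimes>\<^bsub>S\<^esub> y \<in> carrier S)
     \<and> (\<forall>x \<in> carrier S. \<forall>y \<in> carrier S. \<forall>z \<in> carrier S.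
          (x \<otimes>\<^bsub>S\<^esub> y) \<otimes>\<^bsub>S\<^esub> z = x \<otimes>\<^bsub>S\<^esub> (y \<otimes>\<^bsub>S\<^esub> z))"

definition central_subsemigroup :: "'a set \<Rightarrow> ('a, 'm) monoid_scheme \<Rightarrow> bool" where
  "central_subsemigroup T S \<longleftrightarrow> T \<subseteq> carrier S
     \<and> (\<forall>x \<in> T. \<forall>y \<in> T. x \<otimes>\<^bsub>S\<^esub> y \<in> T)
     \<and> (\<forall>x \<in> T. \<forall>y \<in> carrier S. x \<otimes>\<^bsub>S\<^esub> y = y \<otimes>\<^bsub>S\<^esub> x)"


section \<open>The two semigroups\<close>

text \<open>For an enumeration \<open>\<omega>\<close> of a set of basis vectors: the permutation matrix swapping \<open>\<omega> i\<close> and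
  \<open>\<omega> (m + i)\<close> for \<open>i < m\<close> (indices start at 0).\<close>

definition half_swap :: "nat \<Rightarrow> nat \<Rightarrow> nat" where
  "half_swap m i = (if i < m then m + i else if i < 2 * m then i - m else i)"

definition theta_mat :: "(nat \<Rightarrow> nat) \<Rightarrow> nat \<Rightarrow> nat mat" where
  "theta_mat \<omega> m x y =
     (if (\<exists>i. y = \<omega> i \<and> x = \<omega> (half_swap m i)) \<or> (y \<notin> range \<omega> \<and> x = y) then 1 else 0)"

definition theta :: "nat \<Rightarrow> (nat \<Rightarrow> nat \<Rightarrow> nat) \<Rightarrow> (nat \<Rightarrow> nat) \<Rightarrow> nat \<Rightarrow> nat mat" where
  "theta p \<omega> m = (\<lambda>j\<in>{..<p}. theta_mat (\<omega> j) (m j))"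

definition heavy_stabilizer :: "heavy list \<Rightarrow> (nat \<Rightarrow> nat set) \<Rightarrow> (nat \<Rightarrow> nat mat) set" where
  "heavy_stabilizer Ls \<Xi> =
     {l \<in> carrier (heavy_product Ls). \<forall>j < length Ls. \<forall>x \<in> \<Xi> j. fixes_vec (l j) x}"

text \<open>The relabelling sends the \<open>n\<close>-th vector of each copy of the space of \<open>L\<^sub>j\<close> to the \<open>\<omega>\<^sub>j(n)\<close>-th
  vector of the same copy. It is meaningful on the basis vectors not fixed by \<open>L\<close>.\<close>

fun relabel_slot :: "(nat \<Rightarrow> nat \<Rightarrow> nat) \<Rightarrow> (nat \<times> trivial) list \<Rightarrow> slot \<Rightarrow> slot" where
  "relabel_slot \<omega> bs (Copy c s n) = Copy c s (\<omega> (fst (bs ! c)) n)"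
| "relabel_slot \<omega> bs (Fixed n) = Fixed n"

definition relabel_index :: "(nat \<Rightarrow> nat \<Rightarrow> nat) \<Rightarrow> straight_data \<Rightarrow> nat \<Rightarrow> nat" where
  "relabel_index \<omega> d u = inv_into UNIV (slot_of d) (relabel_slot \<omega> (blocks d) (slot_of d u))"

context
  fixes Gs :: "classical list" and Ls :: "heavy list" and sd :: "nat \<Rightarrow> nat \<Rightarrow> straight_data"
begin

definition L_image :: "(nat \<Rightarrow> (nat + nat) mat) set" where
  "L_image = pair_embed Gs sd ` carrier (heavy_product Ls)"

definition L_Xi_image :: "(nat \<Rightarrow> nat set) \<Rightarrow> (nat \<Rightarrow> (nat + nat) mat) set" where
  "L_Xi_image \<Xi> = pair_embed Gs sd ` heavy_stabilizer Ls \<Xi>"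

definition G_min :: "(nat \<Rightarrow> (nat + nat) mat) set" where
  "G_min = min_subgroup Gs L_image"

definition theta_image ::
  "(nat \<Rightarrow> nat \<Rightarrow> nat) \<Rightarrow> (nat \<Rightarrow> nat) \<Rightarrow> nat \<Rightarrow> (nat + nat) mat" where
  "theta_image \<omega> m = pair_embed Gs sd (theta (length Ls) \<omega> m)"

text \<open>\<open>L \ G\<^sub>m\<^sub>i\<^sub>n / L\<close>; here \<open>\<Theta>\<^sub>m\<close> belongs to the tautological enumeration of \<open>nat\<close>.\<close>

definition min_semigroup :: "(nat \<Rightarrow> (nat + nat) mat) set monoid" where
  "min_semigroup =
     coset_semigroup (classical_product Gs) G_min L_image (length Ls) (theta_image (\<lambda>j i. i))"

definition min_product_well_defined :: bool where
  "min_product_well_defined \<longleftrightarrow> coset_product_well_defined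
     (classical_product Gs) G_min L_image (length Ls) (theta_image (\<lambda>j i. i))"

text \<open>\<open>L\<^sup>\<Xi> \ G / L\<^sup>\<Xi>\<close>, where \<open>\<omega>\<^sub>j\<close> enumerates the complement of \<open>\<Xi>\<^sub>j\<close>.\<close>

definition mantle ::
  "(nat \<Rightarrow> nat set) \<Rightarrow> (nat \<Rightarrow> nat \<Rightarrow> nat) \<Rightarrow> (nat \<Rightarrow> (nat + nat) mat) set monoid" where
  "mantle \<Xi> \<omega> = coset_semigroup (classical_product Gs) (carrier (classical_product Gs))
     (L_Xi_image \<Xi>) (length Ls) (theta_image \<omega>)"

definition mantle_product_well_defined ::
  "(nat \<Rightarrow> nat set) \<Rightarrow> (nat \<Rightarrow> nat \<Rightarrow> nat) \<Rightarrow> bool" where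
  "mantle_product_well_defined \<Xi> \<omega> \<longleftrightarrow> coset_product_well_defined
     (classical_product Gs) (carrier (classical_product Gs))
     (L_Xi_image \<Xi>) (length Ls) (theta_image \<omega>)"

definition relabel :: "(nat \<Rightarrow> nat \<Rightarrow> nat) \<Rightarrow> nat \<Rightarrow> nat + nat \<Rightarrow> nat + nat" where
  "relabel \<omega> r b = map_sum
     (relabel_index \<omega> (sd r (heavy_factor (Gs ! r) b)))
     (relabel_index \<omega> (sd r (heavy_factor (Gs ! r) b))) b"

definition relabel_element ::
  "(nat \<Rightarrow> nat \<Rightarrow> nat) \<Rightarrow> (nat \<Rightarrow> (nat + nat) mat) \<Rightarrow> nat \<Rightarrow> (nat + nat) mat" where
  "relabel_element \<omega> g = (\<lambda>r\<in>{..<length Gs}. \<lambda>b b'.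
     let M = moved_basis Gs L_image r; \<rho> = relabel \<omega> r in
     if b \<in> \<rho> ` M \<and> b' \<in> \<rho> ` M then g r (inv_into M \<rho> b) (inv_into M \<rho> b') else mat_one b b')"

definition canonical_map ::
  "(nat \<Rightarrow> nat \<Rightarrow> nat) \<Rightarrow> (nat \<Rightarrow> (nat + nat) mat) set \<Rightarrow> (nat \<Rightarrow> (nat + nat) mat) set" where
  "canonical_map \<omega> a = relabel_element \<omega> ` a"

end

end

theory Submission
  imports Defs
begin

text \<open>Every element \<open>g\<close> of \<open>G\<close> differs from the identity only at finitely many basis vectors. Hence it
commutes with all elements of \<open>L\<^sup>\<Xi>\<close> that fix the first \<open>n\<close> vectors of each enumeration \<open>\<omega>\<^sub>j\<close>, as soon
as \<open>n\<close> is large; call the group of the latter \<open>K n\<close>. The involution \<open>\<Theta>\<^sub>m\<close> moves the first \<open>m\<^sub>j\<close> vectors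
out of the way: for \<open>k\<close> in \<open>L\<^sup>\<Xi>\<close> the conjugate \<open>\<Theta>\<^sub>m k \<Theta>\<^sub>m\<close> lies in \<open>K n\<close> for all large \<open>m\<close>, and any two
\<open>\<Theta>\<^sub>m\<close>, \<open>\<Theta>\<^bsub>m'\<^esub>\<close> with indices at least \<open>n\<close> lie in the same double coset of \<open>K n\<close>, since both carry the
first \<open>n\<close> vectors off themselves. These facts, the last one in a slightly refined form, give the
existence of the product (\<open>spreading_pair.product_stabilizes\<close>), its independence of representatives,
its associativity (\<open>spreading_pair.mult_S_assoc\<close>), and a criterion for two double cosets to commute:
the conjugates \<open>\<Theta>\<^sub>m z \<Theta>\<^sub>m\<close> eventually commute with \<open>g\<close> (\<open>spreading_pair.mult_S_commute\<close>). The semigroup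
\<open>L \ G\<^sub>m\<^sub>i\<^sub>n / L\<close> and the mantle are instances of this pattern, the former with \<open>\<Xi>\<^sub>j\<close> empty and \<open>\<omega>\<^sub>j\<close> the
identity.

The relabelling is treated as a conjugation. On a given \<open>g\<close> of \<open>G\<^sub>m\<^sub>i\<^sub>n\<close> only the values of \<open>\<omega>\<^sub>j\<close> at
finitely many indices matter, and there \<open>\<omega>\<^sub>j\<close> agrees with a finite permutation \<open>\<sigma>\<^sub>j\<close>, whose
permutation matrix belongs to \<open>L\<^sub>j\<close>. So the relabelled element is \<open>\<sigma> g \<sigma>\<^sup>-\<^sup>1\<close> with \<open>\<sigma>\<close> in \<open>L\<close>
(\<open>relabel_element_eq_conj_perms\<close>), for one \<open>\<sigma>\<close> that serves any finite number of elements. It follows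
at once that relabelling preserves \<open>G\<close> whatever the identities that define it, is multiplicative
and injective, and maps \<open>L\<close> onto \<open>L\<^sup>\<Xi>\<close> and \<open>\<Theta>\<^sub>m\<close> to its counterpart in \<open>L\<^sup>\<Xi>\<close>; so it induces an injective
homomorphism of semigroups. The image is central because a relabelled element acts only at
vectors \<open>\<omega>\<^sub>j(i)\<close> with \<open>i < N\<close>: conjugation by \<open>\<Theta>\<^sub>m\<close> shifts these to \<open>\<omega>\<^sub>j(m\<^sub>j + i)\<close>, away from the
finitely many vectors where a given \<open>g\<close> of \<open>G\<close> acts (\<open>relabelled_element_escapes\<close>).

What remains is to see that \<open>L\<close> acts as it should: straight homomorphisms and the inclusions of
maximal heavy subgroups are homomorphisms into the classical groups, send permutation matrices
to permutation matrices, and send a matrix that is trivial at an index to one that is trivial at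
all copies of that index. Both kinds of maps replace the entries of matrices by blocks, and these
properties are proved once for such block matrices.\<close>


section \<open>Products of double cosets along a spreading sequence\<close>

text \<open>As a filter, ``for all sufficiently large \<open>m\<close>'' combines with the calculus of \<^const>\<open>eventually\<close>;
iterated limits in several indices become nested quantifiers over this filter.\<close>

definition indices_at_top :: "nat \<Rightarrow> (nat \<Rightarrow> nat) filter" where
  "indices_at_top p = (INF M. principal {m. \<forall>j<p. M \<le> m j})"

lemma eventually_indices_at_top:
  "eventually P (indices_at_top p) \<longleftrightarrow> (\<exists>M. \<forall>m. (\<forall>j<p. M \<le> m j) \<longrightarrow> P m)"
proof -
  have "eventually P (indices_at_top p) \<longleftrightarrow>
      (\<exists>M\<in>UNIV. eventually P (principal {m. \<forall>j<p. M \<le> m j}))"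
    unfolding indices_at_top_def
  proof (rule eventually_INF_base)
    fix a b :: nat
    show "\<exists>x\<in>UNIV. principal {m. \<forall>j<p. x \<le> m j}
        \<le> inf (principal {m. \<forall>j<p. a \<le> m j}) (principal {m. \<forall>j<p. b \<le> m j})"
      by (rule bexI[of _ "max a b"]) auto
  qed simp
  then show ?thesis
    by (simp add: eventually_principal)
qed

lemma indices_at_top_neq_bot: "indices_at_top p \<noteq> bot"
  unfolding trivial_limit_def eventually_indices_at_top by auto

lemma eventually_indices_ge: "\<forall>\<^sub>F m in indices_at_top p. \<forall>j<p. n \<le> m j"
  unfolding eventually_indices_at_top by blast

lemma (in group) double_coset_iff:
  assumes "H \<subseteq> carrier G" "g \<in> carrier G"
  shows "x \<in> double_coset G H g \<longleftrightarrow> (\<exists>k\<in>H. \<exists>l\<in>H. x = k \<otimes> g \<otimes> l)"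
  unfolding double_coset_def r_coset_def set_mult_def by auto

lemma (in group) double_coset_absorb:
  assumes H: "subgroup H G" and k: "k \<in> H" "l \<in> H" and g: "g \<in> carrier G"
  shows "double_coset G H (k \<otimes> g \<otimes> l) = double_coset G H g"
proof -
  interpret H: subgroup H G by fact
  have HG: "H \<subseteq> carrier G" by (rule H.subset)
  have *: "double_coset G H (a \<otimes> x \<otimes> b) \<subseteq> double_coset G H x"
    if abx: "a \<in> H" "b \<in> H" "x \<in> carrier G" for a b x
  proof
    fix y assume "y \<in> double_coset G H (a \<otimes> x \<otimes> b)"
    then obtain c d where cd: "c \<in> H" "d \<in> H" "y = c \<otimes> (a \<otimes> x \<otimes> b) \<otimes> d"
      using iffD1[OF double_coset_iff[OF HG, of "a \<otimes> x \<otimes> b" y]] abx by auto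
    then have "y = (c \<otimes> a) \<otimes> x \<otimes> (b \<otimes> d)"
      using that by (simp add: m_assoc)
    then show "y \<in> double_coset G H x"
      using that cd HG by (subst double_coset_iff) blast+
  qed
  have "g = inv k \<otimes> (k \<otimes> g \<otimes> l) \<otimes> inv l"
    using k g by (simp add: m_assoc) (simp add: m_assoc[symmetric])
  then have "double_coset G H g \<subseteq> double_coset G H (k \<otimes> g \<otimes> l)"
    using *[of "inv k" "inv l" "k \<otimes> g \<otimes> l"] k g by simp
  with *[OF k g] show ?thesis by blast
qed

lemma (in group) double_coset_self:
  assumes "subgroup H G" "g \<in> carrier G"
  shows "g \<in> double_coset G H g"
proof -
  interpret H: subgroup H G by fact
  show ?thesis
    using assms H.subset by (subst double_coset_iff) (auto intro!: bexI[of _ \<one>])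
qed

text \<open>The pattern behind both semigroups. The model to have in mind is a group of finite matrices in
which \<open>K n\<close> is the part of \<open>H\<close> that fixes the first \<open>n\<close> basis vectors and \<open>\<theta> m\<close> interchanges the
first \<open>m\<close> basis vectors with the next \<open>m\<close>. In \<open>theta_factor\<close>, the last condition says that
\<open>v\<close> stays in \<open>K n\<close> when it is moved across \<open>\<theta> m'\<close>, where \<open>m'\<close> is chosen between \<open>m\<close> and \<open>m''\<close>; it is
what makes the product associative.\<close>

locale spreading_pair = group G for G (structure) +
  fixes A H :: "'a set" and p :: nat and \<theta> :: "(nat \<Rightarrow> nat) \<Rightarrow> 'a" and K :: "nat \<Rightarrow> 'a set"
  assumes subgroup_H: "subgroup H G"
    and H_sub_A: "H \<subseteq> A"
    and A_sub: "A \<subseteq> carrier G"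
    and A_mult: "\<And>g h. g \<in> A \<Longrightarrow> h \<in> A \<Longrightarrow> g \<otimes> h \<in> A"
    and theta_in_H: "\<And>m. \<theta> m \<in> H"
    and theta_square: "\<And>m. \<theta> m \<otimes> \<theta> m = \<one>"
    and K_sub_H: "\<And>n. K n \<subseteq> H"
    and K_antimono: "\<And>n n'. n \<le> n' \<Longrightarrow> K n' \<subseteq> K n"
    and K_commutes: "\<And>g. g \<in> A \<Longrightarrow> \<exists>n. \<forall>k\<in>K n. g \<otimes> k = k \<otimes> g"
    and theta_conj: "\<And>k n. k \<in> H \<Longrightarrow> \<forall>\<^sub>F m in indices_at_top p. \<theta> m \<otimes> k \<otimes> \<theta> m \<in> K n"
    and theta_factor: "\<And>n m. \<forall>j<p. n \<le> m j \<Longrightarrow>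
      \<forall>\<^sub>F m' in indices_at_top p. \<forall>\<^sub>F m'' in indices_at_top p.
        \<exists>u\<in>K n. \<exists>v\<in>K n. \<theta> m = u \<otimes> \<theta> m'' \<otimes> v \<and> \<theta> m' \<otimes> v \<otimes> \<theta> m' \<in> K n"
begin

abbreviation "DC \<equiv> double_coset G H"

abbreviation "S \<equiv> coset_semigroup G A H p \<theta>"

lemma membership_simps [simp]: "g \<in> A \<Longrightarrow> g \<in> carrier G" "h \<in> H \<Longrightarrow> h \<in> carrier G" "k \<in> K n \<Longrightarrow> k \<in> carrier G"
    "\<theta> m \<in> carrier G" "k \<in> K n \<Longrightarrow> k \<in> H" "h \<in> H \<Longrightarrow> h \<in> A" "\<theta> m \<in> A"
  using A_sub H_sub_A K_sub_H theta_in_H by blast+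

lemma theta_cancel: "x \<in> carrier G \<Longrightarrow> \<theta> m \<otimes> (\<theta> m \<otimes> x) = x"
  by (simp add: m_assoc[symmetric] theta_square)

lemma DC_left: "k \<in> H \<Longrightarrow> g \<in> carrier G \<Longrightarrow> DC (k \<otimes> g) = DC g"
  using double_coset_absorb[OF subgroup_H, of k \<one> g] subgroup.one_closed[OF subgroup_H] by simp

lemma DC_right: "k \<in> H \<Longrightarrow> g \<in> carrier G \<Longrightarrow> DC (g \<otimes> k) = DC g"
  using double_coset_absorb[OF subgroup_H, of \<one> k g] subgroup.one_closed[OF subgroup_H] by simp

lemma in_DC_iff: "g \<in> carrier G \<Longrightarrow> x \<in> DC g \<longleftrightarrow> (\<exists>k\<in>H. \<exists>l\<in>H. x = k \<otimes> g \<otimes> l)"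
  by (rule double_coset_iff) auto

lemma commuting_index:
  assumes "finite B" "B \<subseteq> A"
  shows "\<exists>n. \<forall>g\<in>B. \<forall>k\<in>K n. g \<otimes> k = k \<otimes> g"
proof -
  obtain n where n: "\<And>g. g \<in> B \<Longrightarrow> \<forall>k\<in>K (n g). g \<otimes> k = k \<otimes> g"
    using K_commutes assms(2) by (metis subsetD)
  have "n g \<le> Max (n ` B)" if "g \<in> B" for g
    using that assms(1) by simp
  then show ?thesis
    using n K_antimono by (intro exI[of _ "Max (n ` B)"]) blast
qed

text \<open>Different large \<open>m\<close> give the same double coset, because the two outer factors of a factorisation
  of \<open>\<theta> m\<close> through \<open>\<theta> m''\<close> commute with \<open>g\<close> and \<open>h\<close> and so are absorbed by \<open>H\<close>.\<close>

lemma product_stabilizes: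
  assumes g: "g \<in> A" and h: "h \<in> A"
  shows "\<exists>c. \<forall>\<^sub>F m in indices_at_top p. DC (g \<otimes> \<theta> m \<otimes> h) = c"
proof -
  obtain n where n: "\<And>x k. x \<in> {g, h} \<Longrightarrow> k \<in> K n \<Longrightarrow> x \<otimes> k = k \<otimes> x"
    using commuting_index[of "{g, h}"] g h by auto
  have factor: "DC (g \<otimes> \<theta> m \<otimes> h) = DC (g \<otimes> \<theta> m'' \<otimes> h)"
    if "u \<in> K n" "v \<in> K n" "\<theta> m = u \<otimes> \<theta> m'' \<otimes> v" for u v m m''
  proof -
    have "g \<otimes> \<theta> m \<otimes> h = (g \<otimes> u) \<otimes> \<theta> m'' \<otimes> (v \<otimes> h)"
      using that g h by (simp add: m_assoc)
    also have "\<dots> = u \<otimes> (g \<otimes> \<theta> m'' \<otimes> h) \<otimes> v"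
      using that g h n[of g u] n[of h v, symmetric] by (simp add: m_assoc)
    finally show ?thesis
      using that g h by (simp add: double_coset_absorb[OF subgroup_H])
  qed
  have eq: "DC (g \<otimes> \<theta> m \<otimes> h) = DC (g \<otimes> \<theta> m' \<otimes> h)"
    if m: "\<forall>j<p. n \<le> m j" "\<forall>j<p. n \<le> m' j" for m m'
  proof -
    obtain i where i: "\<forall>\<^sub>F m'' in indices_at_top p. \<exists>u\<in>K n. \<exists>v\<in>K n. \<theta> m = u \<otimes> \<theta> m'' \<otimes> v"
      "\<forall>\<^sub>F m'' in indices_at_top p. \<exists>u\<in>K n. \<exists>v\<in>K n. \<theta> m' = u \<otimes> \<theta> m'' \<otimes> v"
      using eventually_happens'[OF indices_at_top_neq_bot
          eventually_conj[OF theta_factor[OF m(1)] theta_factor[OF m(2)]]]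
      by (blast intro: eventually_mono)
    then obtain m'' where "\<exists>u\<in>K n. \<exists>v\<in>K n. \<theta> m = u \<otimes> \<theta> m'' \<otimes> v"
      "\<exists>u\<in>K n. \<exists>v\<in>K n. \<theta> m' = u \<otimes> \<theta> m'' \<otimes> v"
      using eventually_happens'[OF indices_at_top_neq_bot eventually_conj[OF i]] by auto
    then show ?thesis
      using factor by (metis (full_types))
  qed
  show ?thesis
    by (rule exI[of _ "DC (g \<otimes> \<theta> (\<lambda>_. n) \<otimes> h)"], rule eventually_mono[OF eventually_indices_ge[of p n]])
      (rule eq, auto)
qed

text \<open>\<open>k \<theta>\<^sub>m = \<theta>\<^sub>m (\<theta>\<^sub>m k \<theta>\<^sub>m)\<close>, and for large \<open>m\<close> the factor in parentheses commutes with \<open>h\<close>, so that it can be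
absorbed on the right.\<close>

lemma product_absorbs_left:
  assumes g: "g \<in> A" and h: "h \<in> A" and k: "k \<in> H"
  shows "\<forall>\<^sub>F m in indices_at_top p. DC (g \<otimes> k \<otimes> \<theta> m \<otimes> h) = DC (g \<otimes> \<theta> m \<otimes> h)"
proof -
  obtain n where n: "\<And>k. k \<in> K n \<Longrightarrow> h \<otimes> k = k \<otimes> h"
    using K_commutes[OF h] by blast
  show ?thesis
  proof (rule eventually_mono[OF theta_conj[OF k, of n]])
    fix m assume m: "\<theta> m \<otimes> k \<otimes> \<theta> m \<in> K n"
    have "g \<otimes> k \<otimes> \<theta> m \<otimes> h = g \<otimes> \<theta> m \<otimes> ((\<theta> m \<otimes> k \<otimes> \<theta> m) \<otimes> h)"
      using g h k by (simp add: m_assoc theta_cancel)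
    also have "\<dots> = g \<otimes> \<theta> m \<otimes> h \<otimes> (\<theta> m \<otimes> k \<otimes> \<theta> m)"
      using g h k n[OF m, symmetric] by (simp add: m_assoc)
    finally show "DC (g \<otimes> k \<otimes> \<theta> m \<otimes> h) = DC (g \<otimes> \<theta> m \<otimes> h)"
      using DC_right[of "\<theta> m \<otimes> k \<otimes> \<theta> m" "g \<otimes> \<theta> m \<otimes> h"] m g h by auto
  qed
qed

lemma product_absorbs_right:
  assumes g: "g \<in> A" and h: "h \<in> A" and k: "k \<in> H"
  shows "\<forall>\<^sub>F m in indices_at_top p. DC (g \<otimes> \<theta> m \<otimes> (k \<otimes> h)) = DC (g \<otimes> \<theta> m \<otimes> h)"
proof -
  obtain n where n: "\<And>k. k \<in> K n \<Longrightarrow> g \<otimes> k = k \<otimes> g"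
    using K_commutes[OF g] by blast
  show ?thesis
  proof (rule eventually_mono[OF theta_conj[OF k, of n]])
    fix m assume m: "\<theta> m \<otimes> k \<otimes> \<theta> m \<in> K n"
    have "g \<otimes> \<theta> m \<otimes> (k \<otimes> h) = g \<otimes> (\<theta> m \<otimes> k \<otimes> \<theta> m) \<otimes> (\<theta> m \<otimes> h)"
      using g h k by (simp add: m_assoc theta_cancel)
    also have "\<dots> = (\<theta> m \<otimes> k \<otimes> \<theta> m) \<otimes> (g \<otimes> \<theta> m \<otimes> h)"
      using g h k n[OF m] by (simp add: m_assoc)
    finally show "DC (g \<otimes> \<theta> m \<otimes> (k \<otimes> h)) = DC (g \<otimes> \<theta> m \<otimes> h)"
      using DC_left[of "\<theta> m \<otimes> k \<otimes> \<theta> m" "g \<otimes> \<theta> m \<otimes> h"] m g h by auto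
  qed
qed

lemma coset_product_iff:
  assumes g: "g \<in> A" and h: "h \<in> A"
  shows "is_coset_product G H p \<theta> (DC g) (DC h) c \<longleftrightarrow>
    (\<forall>\<^sub>F m in indices_at_top p. DC (g \<otimes> \<theta> m \<otimes> h) = c)"
proof
  assume "is_coset_product G H p \<theta> (DC g) (DC h) c"
  then show "\<forall>\<^sub>F m in indices_at_top p. DC (g \<otimes> \<theta> m \<otimes> h) = c"
    using g h double_coset_self[OF subgroup_H]
    by (simp add: is_coset_product_def eventually_indices_at_top)
next
  assume c: "\<forall>\<^sub>F m in indices_at_top p. DC (g \<otimes> \<theta> m \<otimes> h) = c"
  have "\<forall>\<^sub>F m in indices_at_top p. DC (g' \<otimes> \<theta> m \<otimes> h') = c" if "g' \<in> DC g" "h' \<in> DC h" for g' h'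
  proof -
    obtain k1 k2 where k: "k1 \<in> H" "k2 \<in> H" and g': "g' = k1 \<otimes> g \<otimes> k2"
      using \<open>g' \<in> DC g\<close> g in_DC_iff by auto
    obtain k3 k4 where l: "k3 \<in> H" "k4 \<in> H" and h': "h' = k3 \<otimes> h \<otimes> k4"
      using \<open>h' \<in> DC h\<close> h in_DC_iff by auto
    \<comment> \<open>The factors \<open>k2\<close> and \<open>k3\<close> next to \<open>\<theta> m\<close> are absorbed one after the other.\<close>
    have k3h: "k3 \<otimes> h \<in> A"
      using l h by (auto intro: A_mult)
    show ?thesis
      using product_absorbs_left[OF g k3h k(2)] product_absorbs_right[OF g h l(1)] c
    proof eventually_elim
      fix m
      assume eqs: "DC (g \<otimes> k2 \<otimes> \<theta> m \<otimes> (k3 \<otimes> h)) = DC (g \<otimes> \<theta> m \<otimes> (k3 \<otimes> h))"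
        "DC (g \<otimes> \<theta> m \<otimes> (k3 \<otimes> h)) = DC (g \<otimes> \<theta> m \<otimes> h)" "DC (g \<otimes> \<theta> m \<otimes> h) = c"
      have "g' \<otimes> \<theta> m \<otimes> h' = k1 \<otimes> (g \<otimes> k2 \<otimes> \<theta> m \<otimes> (k3 \<otimes> h)) \<otimes> k4"
        using g h k l by (simp add: m_assoc g' h')
      then show "DC (g' \<otimes> \<theta> m \<otimes> h') = c"
        using eqs g h k l by (simp add: double_coset_absorb[OF subgroup_H])
    qed
  qed
  then show "is_coset_product G H p \<theta> (DC g) (DC h) c"
    by (simp add: is_coset_product_def eventually_indices_at_top)
qed

lemma ex1_coset_product:
  assumes "g \<in> A" "h \<in> A"
  shows "\<exists>!c. is_coset_product G H p \<theta> (DC g) (DC h) c"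
proof (rule ex_ex1I)
  show "\<exists>c. is_coset_product G H p \<theta> (DC g) (DC h) c"
    using product_stabilizes[OF assms] by (simp add: coset_product_iff[OF assms])
next
  fix c d
  assume "is_coset_product G H p \<theta> (DC g) (DC h) c" "is_coset_product G H p \<theta> (DC g) (DC h) d"
  then have "\<forall>\<^sub>F m in indices_at_top p. DC (g \<otimes> \<theta> m \<otimes> h) = c \<and> DC (g \<otimes> \<theta> m \<otimes> h) = d"
    by (simp add: coset_product_iff[OF assms] eventually_conj)
  then show "c = d"
    using eventually_happens'[OF indices_at_top_neq_bot] by blast
qed

theorem product_well_defined: "coset_product_well_defined G A H p \<theta>"
  unfolding coset_product_well_defined_def double_cosets_def using ex1_coset_product by blast

lemma carrier_S: "carrier S = DC ` A"
  by (simp add: coset_semigroup_def double_cosets_def)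

lemma eventually_mult_S:
  assumes "g \<in> A" "h \<in> A"
  shows "\<forall>\<^sub>F m in indices_at_top p. DC g \<otimes>\<^bsub>S\<^esub> DC h = DC (g \<otimes> \<theta> m \<otimes> h)"
proof -
  have "is_coset_product G H p \<theta> (DC g) (DC h) (DC g \<otimes>\<^bsub>S\<^esub> DC h)"
    unfolding coset_semigroup_def using theI'[OF ex1_coset_product[OF assms]] by simp
  then show ?thesis
    unfolding coset_product_iff[OF assms] by (rule eventually_mono) simp
qed

text \<open>Both bracketings are iterated limits of \<open>g \<theta>\<^sub>m h \<theta>\<^bsub>m'\<^esub> f\<close>, one with \<open>m'\<close> far beyond \<open>m\<close>, the
  other with the inner index \<open>m'\<close> fixed first. Replacing \<open>\<theta> m\<close> by \<open>\<theta> m''\<close> with \<open>m''\<close> far beyond \<open>m'\<close>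
  passes from one to the other: the factor \<open>v\<close> commutes with \<open>h\<close>, stays in \<open>K n\<close> when it is moved
  across \<open>\<theta> m'\<close>, and then commutes with \<open>f\<close>.\<close>

lemma mult_S_assoc:
  assumes g: "g \<in> A" and h: "h \<in> A" and f: "f \<in> A"
  shows "(DC g \<otimes>\<^bsub>S\<^esub> DC h) \<otimes>\<^bsub>S\<^esub> DC f = DC g \<otimes>\<^bsub>S\<^esub> (DC h \<otimes>\<^bsub>S\<^esub> DC f)"
    (is "?l = ?r")
proof -
  obtain n where n: "\<And>x k. x \<in> {g, h, f} \<Longrightarrow> k \<in> K n \<Longrightarrow> x \<otimes> k = k \<otimes> x"
    using commuting_index[of "{g, h, f}"] g h f by (auto; blast)
  have l: "\<forall>\<^sub>F m in indices_at_top p. \<forall>\<^sub>F m' in indices_at_top p. ?l = DC (g \<otimes> \<theta> m \<otimes> h \<otimes> \<theta> m' \<otimes> f)"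
    using eventually_mult_S[OF g h]
  proof eventually_elim
    fix m assume "DC g \<otimes>\<^bsub>S\<^esub> DC h = DC (g \<otimes> \<theta> m \<otimes> h)"
    then show "\<forall>\<^sub>F m' in indices_at_top p. ?l = DC (g \<otimes> \<theta> m \<otimes> h \<otimes> \<theta> m' \<otimes> f)"
      using eventually_mult_S[of "g \<otimes> \<theta> m \<otimes> h" f] g h f by (simp add: A_mult)
  qed
  have r: "\<forall>\<^sub>F m' in indices_at_top p. \<forall>\<^sub>F m'' in indices_at_top p. ?r = DC (g \<otimes> \<theta> m'' \<otimes> (h \<otimes> \<theta> m' \<otimes> f))"
    using eventually_mult_S[OF h f]
  proof eventually_elim
    fix m' assume "DC h \<otimes>\<^bsub>S\<^esub> DC f = DC (h \<otimes> \<theta> m' \<otimes> f)"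
    then show "\<forall>\<^sub>F m'' in indices_at_top p. ?r = DC (g \<otimes> \<theta> m'' \<otimes> (h \<otimes> \<theta> m' \<otimes> f))"
      using eventually_mult_S[of g "h \<otimes> \<theta> m' \<otimes> f"] g h f by (simp add: A_mult)
  qed
  obtain m where m: "\<forall>j<p. n \<le> m j"
    and lm: "\<forall>\<^sub>F m' in indices_at_top p. ?l = DC (g \<otimes> \<theta> m \<otimes> h \<otimes> \<theta> m' \<otimes> f)"
    using eventually_happens'[OF indices_at_top_neq_bot eventually_conj[OF eventually_indices_ge l]]
    by blast
  obtain m' where lm': "?l = DC (g \<otimes> \<theta> m \<otimes> h \<otimes> \<theta> m' \<otimes> f)"
    and rm': "\<forall>\<^sub>F m'' in indices_at_top p. ?r = DC (g \<otimes> \<theta> m'' \<otimes> (h \<otimes> \<theta> m' \<otimes> f))"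
    and tm': "\<forall>\<^sub>F m'' in indices_at_top p.
        \<exists>u\<in>K n. \<exists>v\<in>K n. \<theta> m = u \<otimes> \<theta> m'' \<otimes> v \<and> \<theta> m' \<otimes> v \<otimes> \<theta> m' \<in> K n"
    using eventually_happens'[OF indices_at_top_neq_bot
        eventually_conj[OF lm eventually_conj[OF r theta_factor[OF m]]]]
    by blast
  obtain m'' u v where rm: "?r = DC (g \<otimes> \<theta> m'' \<otimes> (h \<otimes> \<theta> m' \<otimes> f))"
    and uv: "u \<in> K n" "v \<in> K n" "\<theta> m = u \<otimes> \<theta> m'' \<otimes> v" "\<theta> m' \<otimes> v \<otimes> \<theta> m' \<in> K n"
    using eventually_happens'[OF indices_at_top_neq_bot eventually_conj[OF rm' tm']] by blast
  define w where "w = \<theta> m' \<otimes> v \<otimes> \<theta> m'"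
  have w: "w \<in> K n" and vw: "v \<otimes> \<theta> m' = \<theta> m' \<otimes> w"
    using uv by (auto simp: w_def m_assoc theta_cancel)
  have "g \<otimes> \<theta> m \<otimes> h \<otimes> \<theta> m' \<otimes> f = (g \<otimes> u) \<otimes> \<theta> m'' \<otimes> (v \<otimes> h) \<otimes> \<theta> m' \<otimes> f"
    using g h f uv by (simp add: m_assoc)
  also have "\<dots> = u \<otimes> g \<otimes> \<theta> m'' \<otimes> h \<otimes> (v \<otimes> \<theta> m') \<otimes> f"
    using g h f uv n[of g u] n[of h v, symmetric] by (simp add: m_assoc)
  also have "\<dots> = u \<otimes> g \<otimes> \<theta> m'' \<otimes> h \<otimes> \<theta> m' \<otimes> (w \<otimes> f)"
    using g h f uv w by (simp add: m_assoc vw)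
  also have "\<dots> = u \<otimes> (g \<otimes> \<theta> m'' \<otimes> (h \<otimes> \<theta> m' \<otimes> f)) \<otimes> w"
    using g h f uv w n[of f w, symmetric] by (simp add: m_assoc)
  finally have "DC (g \<otimes> \<theta> m \<otimes> h \<otimes> \<theta> m' \<otimes> f) = DC (g \<otimes> \<theta> m'' \<otimes> (h \<otimes> \<theta> m' \<otimes> f))"
    using g h f uv w by (simp add: double_coset_absorb[OF subgroup_H])
  then show ?thesis
    using lm' rm by simp
qed

lemma mult_S_closed:
  assumes "g \<in> A" "h \<in> A"
  shows "DC g \<otimes>\<^bsub>S\<^esub> DC h \<in> carrier S"
proof -
  obtain m where "DC g \<otimes>\<^bsub>S\<^esub> DC h = DC (g \<otimes> \<theta> m \<otimes> h)"
    using eventually_happens'[OF indices_at_top_neq_bot eventually_mult_S[OF assms]] by blast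
  then show ?thesis
    using assms by (auto simp: carrier_S intro!: A_mult)
qed

theorem semigroup_S: "is_semigroup S"
  unfolding is_semigroup_def using mult_S_closed mult_S_assoc by (auto simp: carrier_S)

text \<open>If \<open>\<theta>\<^sub>m z \<theta>\<^sub>m\<close> escapes to where \<open>g\<close> acts trivially, then
  \<open>z \<theta>\<^sub>m g = \<theta>\<^sub>m (\<theta>\<^sub>m z \<theta>\<^sub>m) g = \<theta>\<^sub>m g (\<theta>\<^sub>m z \<theta>\<^sub>m)\<close> lies in the double coset of \<open>g \<theta>\<^sub>m z\<close>.\<close>

lemma mult_S_commute:
  assumes z: "z \<in> A" and g: "g \<in> A"
    and comm: "\<forall>\<^sub>F m in indices_at_top p. (\<theta> m \<otimes> z \<otimes> \<theta> m) \<otimes> g = g \<otimes> (\<theta> m \<otimes> z \<otimes> \<theta> m)"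
  shows "DC z \<otimes>\<^bsub>S\<^esub> DC g = DC g \<otimes>\<^bsub>S\<^esub> DC z"
proof -
  obtain m where m: "(\<theta> m \<otimes> z \<otimes> \<theta> m) \<otimes> g = g \<otimes> (\<theta> m \<otimes> z \<otimes> \<theta> m)"
    "DC z \<otimes>\<^bsub>S\<^esub> DC g = DC (z \<otimes> \<theta> m \<otimes> g)" "DC g \<otimes>\<^bsub>S\<^esub> DC z = DC (g \<otimes> \<theta> m \<otimes> z)"
    using eventually_happens'[OF indices_at_top_neq_bot eventually_conj[OF comm
        eventually_conj[OF eventually_mult_S[OF z g] eventually_mult_S[OF g z]]]]
    by blast
  have "z \<otimes> \<theta> m \<otimes> g = \<theta> m \<otimes> ((\<theta> m \<otimes> z \<otimes> \<theta> m) \<otimes> g)"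
    using z g by (simp add: m_assoc theta_cancel)
  also have "\<dots> = \<theta> m \<otimes> (g \<otimes> \<theta> m \<otimes> z) \<otimes> \<theta> m"
    using z g by (simp only: m(1)) (simp add: m_assoc)
  finally show ?thesis
    using z g theta_in_H by (simp add: m double_coset_absorb[OF subgroup_H])
qed

end


section \<open>Transport into the centre of another semigroup of double cosets\<close>

text \<open>Since \<open>R\<close> carries \<open>H1\<close> onto \<open>H2\<close>, it carries double cosets onto double cosets, and it is injective on
them as it is on \<open>A1\<close>. It respects the products because both are attained at a common large \<open>m\<close>.\<close>

lemma central_subsemigroup_by_transport:
  fixes G (structure)
  assumes P1: "spreading_pair G A1 H1 p \<theta>1 K1" and P2: "spreading_pair G A2 H2 p \<theta>2 K2"
    and R_in: "\<And>g. g \<in> A1 \<Longrightarrow> R g \<in> A2"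
    and R_mult: "\<And>g h. g \<in> A1 \<Longrightarrow> h \<in> A1 \<Longrightarrow> R (g \<otimes> h) = R g \<otimes> R h"
    and R_inj: "inj_on R A1"
    and R_H: "R ` H1 = H2" and R_theta: "\<And>m. R (\<theta>1 m) = \<theta>2 m"
    and central: "\<And>z g. z \<in> A1 \<Longrightarrow> g \<in> A2 \<Longrightarrow>
      \<forall>\<^sub>F m in indices_at_top p. (\<theta>2 m \<otimes> R z \<otimes> \<theta>2 m) \<otimes> g = g \<otimes> (\<theta>2 m \<otimes> R z \<otimes> \<theta>2 m)"
  shows "\<exists>S. central_subsemigroup S (coset_semigroup G A2 H2 p \<theta>2)
    \<and> (\<lambda>a. R ` a) \<in> iso (coset_semigroup G A1 H1 p \<theta>1) ((coset_semigroup G A2 H2 p \<theta>2)\<lparr>carrier := S\<rparr>)"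
proof -
  interpret P1: spreading_pair G A1 H1 p \<theta>1 K1 by (rule P1)
  interpret P2: spreading_pair G A2 H2 p \<theta>2 K2 by (rule P2)
  let ?f = "\<lambda>a. R ` a"
  have DC_sub: "P1.DC g \<subseteq> A1" if "g \<in> A1" for g
    using that by (auto simp: P1.in_DC_iff intro!: P1.A_mult)
  have f_DC: "?f (P1.DC g) = P2.DC (R g)" if g: "g \<in> A1" for g
  proof -
    have "x \<in> ?f (P1.DC g) \<longleftrightarrow> (\<exists>k\<in>H1. \<exists>l\<in>H1. x = R (k \<otimes> g \<otimes> l))" for x
      using g P1.in_DC_iff[of g] by (auto simp: image_iff Bex_def)
    also have "(\<exists>k\<in>H1. \<exists>l\<in>H1. x = R (k \<otimes> g \<otimes> l)) \<longleftrightarrow> (\<exists>k\<in>H1. \<exists>l\<in>H1. x = R k \<otimes> R g \<otimes> R l)" for x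
      using g by (simp add: R_mult P1.A_mult)
    also have "(\<exists>k\<in>H1. \<exists>l\<in>H1. x = R k \<otimes> R g \<otimes> R l) \<longleftrightarrow> x \<in> P2.DC (R g)" for x
      using R_in[OF g] P2.in_DC_iff[of "R g" x] unfolding R_H[symmetric] by auto
    finally show ?thesis by blast
  qed
  have f_mult: "?f (P1.DC g \<otimes>\<^bsub>P1.S\<^esub> P1.DC h) = ?f (P1.DC g) \<otimes>\<^bsub>P2.S\<^esub> ?f (P1.DC h)"
    if g: "g \<in> A1" and h: "h \<in> A1" for g h
  proof -
    obtain m where m: "P1.DC g \<otimes>\<^bsub>P1.S\<^esub> P1.DC h = P1.DC (g \<otimes> \<theta>1 m \<otimes> h)"
      "P2.DC (R g) \<otimes>\<^bsub>P2.S\<^esub> P2.DC (R h) = P2.DC (R g \<otimes> \<theta>2 m \<otimes> R h)"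
      using eventually_happens'[OF indices_at_top_neq_bot
          eventually_conj[OF P1.eventually_mult_S[OF g h] P2.eventually_mult_S[OF R_in[OF g] R_in[OF h]]]]
      by blast
    have "?f (P1.DC (g \<otimes> \<theta>1 m \<otimes> h)) = P2.DC (R (g \<otimes> \<theta>1 m \<otimes> h))"
      using g h by (intro f_DC P1.A_mult) auto
    also have "R (g \<otimes> \<theta>1 m \<otimes> h) = R g \<otimes> \<theta>2 m \<otimes> R h"
      using g h by (simp add: R_mult P1.A_mult R_theta)
    finally show ?thesis
      using m by (simp add: f_DC g h)
  qed
  define S where "S = ?f ` carrier P1.S"
  have S_eq: "S = (\<lambda>g. P2.DC (R g)) ` A1"
    unfolding S_def P1.carrier_S by (auto simp: f_DC image_image)
  have "inj_on ?f (carrier P1.S)"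
  proof (rule inj_onI)
    fix X Y assume "X \<in> carrier P1.S" "Y \<in> carrier P1.S" "?f X = ?f Y"
    then show "X = Y"
      using DC_sub inj_on_image_eq_iff[OF R_inj, of X Y] by (auto simp: P1.carrier_S)
  qed
  then have "bij_betw ?f (carrier P1.S) S"
    by (simp add: bij_betw_def S_def)
  moreover have "?f (x \<otimes>\<^bsub>P1.S\<^esub> y) = ?f x \<otimes>\<^bsub>P2.S\<^esub> ?f y" if "x \<in> carrier P1.S" "y \<in> carrier P1.S" for x y
    using that f_mult unfolding P1.carrier_S by blast
  ultimately have "?f \<in> iso P1.S (P2.S\<lparr>carrier := S\<rparr>)"
    by (auto simp: iso_def hom_def S_def)
  moreover have "central_subsemigroup S P2.S"
    unfolding central_subsemigroup_def
  proof (intro conjI ballI)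
    show "S \<subseteq> carrier P2.S"
      using R_in by (auto simp: S_eq P2.carrier_S)
    fix x assume "x \<in> S"
    then obtain g where x: "g \<in> A1" "x = P2.DC (R g)"
      by (auto simp: S_eq)
    show "x \<otimes>\<^bsub>P2.S\<^esub> y \<in> S" if "y \<in> S" for y
    proof -
      obtain h where y: "h \<in> A1" "y = P2.DC (R h)"
        using \<open>y \<in> S\<close> by (auto simp: S_eq)
      have "x \<otimes>\<^bsub>P2.S\<^esub> y = ?f (P1.DC g \<otimes>\<^bsub>P1.S\<^esub> P1.DC h)"
        using x y by (simp add: f_mult f_DC)
      then show ?thesis
        using P1.mult_S_closed[OF x(1) y(1)] by (simp add: S_def)
    qed
    show "x \<otimes>\<^bsub>P2.S\<^esub> y = y \<otimes>\<^bsub>P2.S\<^esub> x" if "y \<in> carrier P2.S" for y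
    proof -
      obtain h where y: "h \<in> A2" "y = P2.DC h"
        using \<open>y \<in> carrier P2.S\<close> by (auto simp: P2.carrier_S)
      show ?thesis
        using P2.mult_S_commute[OF R_in[OF x(1)] y(1) central[OF x(1) y(1)]] x y by simp
    qed
  qed
  ultimately show ?thesis by blast
qed


section \<open>Quaternions and scalar sets\<close>

lemma quat_eq_iff: "x = y \<longleftrightarrow> qre x = qre y \<and> qi x = qi y \<and> qj x = qj y \<and> qk x = qk y"
  by (cases x; cases y) simp

lemma quat_sel_simps [simp]:
  "qre 0 = 0" "qi 0 = 0" "qj 0 = 0" "qk 0 = 0"
  "qre 1 = 1" "qi 1 = 0" "qj 1 = 0" "qk 1 = 0"
  "qre (x + y) = qre x + qre y" "qi (x + y) = qi x + qi y"
  "qj (x + y) = qj x + qj y" "qk (x + y) = qk x + qk y"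
  "qre (- x) = - qre x" "qi (- x) = - qi x" "qj (- x) = - qj x" "qk (- x) = - qk x"
  "qre (qconj x) = qre x" "qi (qconj x) = - qi x" "qj (qconj x) = - qj x" "qk (qconj x) = - qk x"
  by (simp_all add: zero_quat_def one_quat_def plus_quat_def uminus_quat_def qconj_def)

lemma quat_mult_sel:
  "qre (x * y) = qre x * qre y - qi x * qi y - qj x * qj y - qk x * qk y"
  "qi (x * y) = qre x * qi y + qi x * qre y + qj x * qk y - qk x * qj y"
  "qj (x * y) = qre x * qj y - qi x * qk y + qj x * qre y + qk x * qi y"
  "qk (x * y) = qre x * qk y + qi x * qj y - qj x * qi y + qk x * qre y"
  by (simp_all add: times_quat_def)

lemma qconj_simps [simp]:
  "qconj 0 = 0" "qconj 1 = 1" "qconj (- x) = - qconj x" "qconj (qconj x) = x"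
  "qconj (x + y) = qconj x + qconj y" "qconj x = 0 \<longleftrightarrow> x = 0"
  by (auto simp: quat_eq_iff)

lemma qconj_mult: "qconj (x * y) = qconj y * qconj x"
  by (simp add: quat_eq_iff quat_mult_sel algebra_simps)

lemma qconj_sum: "qconj (sum f A) = (\<Sum>a\<in>A. qconj (f a))"
  by (induction A rule: infinite_finite_induct) auto

lemma qconj_Sum_any: "qconj (Sum_any f) = Sum_any (\<lambda>a. qconj (f a))"
  by (simp add: Sum_any.expand_set qconj_sum)

lemma complex_scalars_commute:
  "x \<in> scalar_set ComplexScalars \<Longrightarrow> y \<in> scalar_set ComplexScalars \<Longrightarrow> x * y = y * x"
  by (simp add: quat_eq_iff quat_mult_sel algebra_simps)

lemma scalar_set_closed:
  "0 \<in> scalar_set F" "1 \<in> scalar_set F"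
  "x \<in> scalar_set F \<Longrightarrow> y \<in> scalar_set F \<Longrightarrow> x + y \<in> scalar_set F"
  "x \<in> scalar_set F \<Longrightarrow> y \<in> scalar_set F \<Longrightarrow> x * y \<in> scalar_set F"
  "x \<in> scalar_set F \<Longrightarrow> qconj x \<in> scalar_set F"
  by (cases F; simp add: quat_mult_sel)+

lemma sum_in_scalar_set: "(\<And>a. a \<in> A \<Longrightarrow> f a \<in> scalar_set F) \<Longrightarrow> sum f A \<in> scalar_set F"
  by (induction A rule: infinite_finite_induct) (auto simp: scalar_set_closed)


section \<open>Matrices with finite rows and columns\<close>

text \<open>The matrices of the forms \<open>I\<close> and \<open>J\<close> differ from the identity at infinitely many places. This larger
class contains them and still admits associative products.\<close>

definition row_column_finite :: "'i mat \<Rightarrow> bool" where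
  "row_column_finite g \<longleftrightarrow> (\<forall>i. finite {j. g i j \<noteq> 0}) \<and> (\<forall>j. finite {i. g i j \<noteq> 0})"

lemma mat_mult_eq_sum:
  assumes "finite T" "\<And>k. g i k \<noteq> 0 \<Longrightarrow> h k j \<noteq> 0 \<Longrightarrow> k \<in> T"
  shows "mat_mult g h i j = (\<Sum>k\<in>T. g i k * h k j)"
proof -
  have "{k. g i k * h k j \<noteq> 0} \<subseteq> T"
  proof
    fix k assume "k \<in> {k. g i k * h k j \<noteq> 0}"
    then have "g i k \<noteq> 0" "h k j \<noteq> 0"
      by auto
    then show "k \<in> T" by (rule assms(2))
  qed
  then show ?thesis
    unfolding mat_mult_def by (rule Sum_any.expand_superset[OF assms(1)])
qed

lemma mat_mult_assoc:
  assumes "row_column_finite f" "row_column_finite h"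
  shows "mat_mult (mat_mult f g) h = mat_mult f (mat_mult g h)"
proof (intro ext)
  fix i j
  let ?A = "{k. f i k \<noteq> 0}" and ?B = "{l. h l j \<noteq> 0}"
  have fin: "finite ?A" "finite ?B"
    using assms by (auto simp: row_column_finite_def)
  have "mat_mult (mat_mult f g) h i j = (\<Sum>l\<in>?B. mat_mult f g i l * h l j)"
    by (rule mat_mult_eq_sum) (use fin in auto)
  also have "\<dots> = (\<Sum>l\<in>?B. (\<Sum>k\<in>?A. f i k * g k l) * h l j)"
    using fin by (intro sum.cong refl arg_cong2[where f = "(*)"] mat_mult_eq_sum) auto
  also have "\<dots> = (\<Sum>l\<in>?B. \<Sum>k\<in>?A. f i k * (g k l * h l j))"
    by (simp add: sum_distrib_right mult.assoc)
  also have "\<dots> = (\<Sum>k\<in>?A. \<Sum>l\<in>?B. f i k * (g k l * h l j))"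
    by (rule sum.swap)
  also have "\<dots> = (\<Sum>k\<in>?A. f i k * (\<Sum>l\<in>?B. g k l * h l j))"
    by (simp add: sum_distrib_left)
  also have "\<dots> = (\<Sum>k\<in>?A. f i k * mat_mult g h k j)"
    using fin by (intro sum.cong refl arg_cong2[where f = "(*)"] mat_mult_eq_sum[symmetric]) auto
  also have "\<dots> = mat_mult f (mat_mult g h) i j"
    by (rule mat_mult_eq_sum[symmetric]) (use fin in auto)
  finally show "mat_mult (mat_mult f g) h i j = mat_mult f (mat_mult g h) i j" .
qed

lemma mat_mult_trivial_row:
  assumes "\<And>k. g i k = mat_one i k"
  shows "mat_mult g h i j = h i j"
  by (subst mat_mult_eq_sum[of "{i}"]) (auto simp: assms mat_one_def split: if_splits)

lemma mat_mult_trivial_column: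
  assumes "\<And>k. h k j = mat_one k j"
  shows "mat_mult g h i j = g i j"
  by (subst mat_mult_eq_sum[of "{j}"]) (auto simp: assms mat_one_def split: if_splits)

lemma mat_mult_one [simp]: "mat_mult mat_one g = g" "mat_mult g mat_one = g"
  by (intro ext mat_mult_trivial_row mat_mult_trivial_column refl)+

lemma row_column_finite_mult:
  assumes "row_column_finite f" "row_column_finite g"
  shows "row_column_finite (mat_mult f g)"
proof -
  have nz: "\<exists>k. f i k \<noteq> 0 \<and> g k j \<noteq> 0" if "mat_mult f g i j \<noteq> 0" for i j
  proof (rule ccontr)
    assume *: "\<nexists>k. f i k \<noteq> 0 \<and> g k j \<noteq> 0"
    then have "mat_mult f g i j = 0"
      by (subst mat_mult_eq_sum[of "{}"]) auto
    with that show False by simp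
  qed
  have "{j. mat_mult f g i j \<noteq> 0} \<subseteq> (\<Union>k\<in>{k. f i k \<noteq> 0}. {j. g k j \<noteq> 0})" for i
    using nz by blast
  moreover have "{i. mat_mult f g i j \<noteq> 0} \<subseteq> (\<Union>k\<in>{k. g k j \<noteq> 0}. {i. f i k \<noteq> 0})" for j
    using nz by blast
  moreover have "finite (\<Union>k\<in>{k. f i k \<noteq> 0}. {j. g k j \<noteq> 0})"
    "finite (\<Union>k\<in>{k. g k j \<noteq> 0}. {i. f i k \<noteq> 0})" for i j
    using assms by (auto simp: row_column_finite_def)
  ultimately show ?thesis
    unfolding row_column_finite_def by (meson finite_subset)
qed

lemma mat_adjoint_mult: "mat_adjoint (mat_mult g h) = mat_mult (mat_adjoint h) (mat_adjoint g)"
  by (intro ext) (simp add: mat_adjoint_def mat_mult_def qconj_Sum_any qconj_mult)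

lemma mat_adjoint_simps [simp]: "mat_adjoint mat_one = mat_one" "mat_adjoint (mat_adjoint g) = g"
  by (intro ext, simp add: mat_adjoint_def mat_one_def)+

lemma mat_transpose_one: "mat_transpose mat_one = mat_one"
  by (intro ext) (simp add: mat_transpose_def mat_one_def)

lemma mat_transpose_mult:
  assumes "\<And>i j. g i j \<in> scalar_set ComplexScalars" "\<And>i j. h i j \<in> scalar_set ComplexScalars"
  shows "mat_transpose (mat_mult g h) = mat_mult (mat_transpose h) (mat_transpose g)"
  using complex_scalars_commute[OF assms]
  by (intro ext) (simp add: mat_transpose_def mat_mult_def)

lemma row_column_finite_adjoint: "row_column_finite g \<Longrightarrow> row_column_finite (mat_adjoint g)"
  by (simp add: row_column_finite_def mat_adjoint_def)

lemma row_column_finite_transpose: "row_column_finite g \<Longrightarrow> row_column_finite (mat_transpose g)"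
  by (simp add: row_column_finite_def mat_transpose_def)


section \<open>Support of a matrix\<close>

definition supported_on :: "'i set \<Rightarrow> 'i mat \<Rightarrow> bool" where
  "supported_on F g \<longleftrightarrow> (\<forall>i j. i \<notin> F \<or> j \<notin> F \<longrightarrow> g i j = mat_one i j)"

lemma supported_on_mono: "supported_on F g \<Longrightarrow> F \<subseteq> F' \<Longrightarrow> supported_on F' g"
  by (auto simp: supported_on_def)

lemma supported_on_mult:
  assumes "supported_on F g" "supported_on F h"
  shows "supported_on F (mat_mult g h)"
  unfolding supported_on_def
proof (intro allI impI)
  fix i j assume "i \<notin> F \<or> j \<notin> F"
  then show "mat_mult g h i j = mat_one i j"
  proof
    assume "i \<notin> F"
    then show ?thesis
      using assms by (subst mat_mult_trivial_row) (auto simp: supported_on_def)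
  next
    assume "j \<notin> F"
    then show ?thesis
      using assms by (subst mat_mult_trivial_column) (auto simp: supported_on_def)
  qed
qed

text \<open>In a common block decomposition the two matrices are \<open>diag(a, 1)\<close> and \<open>diag(1, b)\<close>.\<close>

lemma disjoint_supports_commute:
  fixes g :: "'i mat"
  assumes g: "supported_on F g" and k: "supported_on F' k" and FF': "F \<inter> F' = {}"
  shows "mat_mult g k = mat_mult k g"
proof (intro ext)
  fix i j :: 'i
  \<comment> \<open>The entries outside the two diagonal blocks vanish, for either order of the factors.\<close>
  have z: "mat_mult a b i j = 0"
    if "supported_on E a" "supported_on E' b" "E \<inter> E' = {}" "i \<notin> E" "j \<notin> E'" "i \<noteq> j" for a b :: "'i mat" and E E'
  proof -
    have "b i j = 0"
      using that by (simp add: supported_on_def mat_one_def)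
    then show ?thesis
      using that by (subst mat_mult_trivial_row) (auto simp: supported_on_def)
  qed
  have z': "mat_mult a b i j = 0"
    if "supported_on E a" "supported_on E' b" "E \<inter> E' = {}" "i \<in> E" "j \<in> E'" for a b :: "'i mat" and E E'
  proof -
    have "a i x = 0 \<or> b x j = 0" for x
    proof (cases "x \<in> E")
      case True
      with that have "x \<notin> E'" "x \<noteq> j" by auto
      with that show ?thesis by (simp add: supported_on_def mat_one_def)
    next
      case False
      with that have "x \<noteq> i" by auto
      with False that show ?thesis by (simp add: supported_on_def mat_one_def)
    qed
    then show ?thesis
      by (subst mat_mult_eq_sum[of "{}"]) auto
  qed
  have k': "supported_on (- F) k"
    using supported_on_mono[OF k] FF' by blast
  consider "i \<in> F" "j \<in> F" | "i \<notin> F" "j \<notin> F" | "i \<in> F" "j \<notin> F" | "i \<notin> F" "j \<in> F"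
    by blast
  then show "mat_mult g k i j = mat_mult k g i j"
  proof cases
    case 1
    then show ?thesis
      using k' by (subst mat_mult_trivial_column, simp add: supported_on_def)
        (subst mat_mult_trivial_row, auto simp: supported_on_def)
  next
    case 2
    then show ?thesis
      using g by (subst mat_mult_trivial_row, simp add: supported_on_def)
        (subst mat_mult_trivial_column, auto simp: supported_on_def)
  next
    case 3
    then show ?thesis
      using z'[OF g k'] z[OF k' g] by auto
  next
    case 4
    then show ?thesis
      using z'[OF k' g] z[OF g k'] by auto
  qed
qed

text \<open>One finite set of indices can serve for rows and columns; this is the form in which finiteness of
matrices is used.\<close>

lemma finite_mats_iff:
  "g \<in> finite_mats F B \<longleftrightarrow>
    (\<exists>T. finite T \<and> supported_on T g) \<and> supported_on B g \<and> (\<forall>i j. g i j \<in> scalar_set F)"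
proof -
  have "finite {(i, j). g i j \<noteq> mat_one i j} \<longleftrightarrow> (\<exists>T. finite T \<and> supported_on T g)"
  proof
    assume fin: "finite {(i, j). g i j \<noteq> mat_one i j}" (is "finite ?D")
    have "supported_on (fst ` ?D \<union> snd ` ?D) g"
      unfolding supported_on_def by force
    then show "\<exists>T. finite T \<and> supported_on T g"
      using fin by (intro exI[of _ "fst ` ?D \<union> snd ` ?D"]) simp
  next
    assume "\<exists>T. finite T \<and> supported_on T g"
    then obtain T where T: "finite T" "supported_on T g" by blast
    then have "{(i, j). g i j \<noteq> mat_one i j} \<subseteq> T \<times> T"
      by (auto simp: supported_on_def)
    then show "finite {(i, j). g i j \<noteq> mat_one i j}"
      using T by (meson finite_SigmaI finite_subset)
  qed
  then show ?thesis
    by (auto simp: finite_mats_def supported_on_def)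
qed

lemma row_column_finite_finite_mats:
  assumes "g \<in> finite_mats F B"
  shows "row_column_finite g"
proof -
  obtain T where T: "finite T" "supported_on T g"
    using assms by (auto simp: finite_mats_iff)
  then have "{j. g i j \<noteq> 0} \<subseteq> insert i T" "{j. g j i \<noteq> 0} \<subseteq> insert i T" for i
    by (auto simp: supported_on_def mat_one_def split: if_splits)
  then show ?thesis
    unfolding row_column_finite_def using T by (meson finite_insert finite_subset)
qed

lemma finite_mats_one: "mat_one \<in> finite_mats F B"
  by (auto simp: finite_mats_def mat_one_def scalar_set_closed)

lemma finite_mats_mult:
  assumes g: "g \<in> finite_mats F B" and h: "h \<in> finite_mats F B"
  shows "mat_mult g h \<in> finite_mats F B"
proof -
  obtain T T' where T: "finite T" "supported_on T g" "finite T'" "supported_on T' h"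
    using assms by (auto simp: finite_mats_iff)
  then have "supported_on (T \<union> T') (mat_mult g h)"
    by (intro supported_on_mult) (auto elim: supported_on_mono)
  moreover have "mat_mult g h i j \<in> scalar_set F" for i j
  proof -
    have "finite {k. g i k \<noteq> 0}"
      using row_column_finite_finite_mats[OF g] by (simp add: row_column_finite_def)
    then have "mat_mult g h i j = (\<Sum>k\<in>{k. g i k \<noteq> 0}. g i k * h k j)"
      by (rule mat_mult_eq_sum) auto
    also have "\<dots> \<in> scalar_set F"
      using assms by (intro sum_in_scalar_set scalar_set_closed) (auto simp: finite_mats_iff)
    finally show ?thesis .
  qed
  ultimately show ?thesis
    using assms T supported_on_mult[of B g h]
    by (auto simp: finite_mats_iff intro!: exI[of _ "T \<union> T'"])
qed

lemma finite_mats_adjoint: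
  assumes "g \<in> finite_mats F B"
  shows "mat_adjoint g \<in> finite_mats F B"
proof -
  have "supported_on T (mat_adjoint g)" if "supported_on T g" for T
    using that by (auto simp: supported_on_def mat_adjoint_def mat_one_def)
  then show ?thesis
    using assms by (auto simp: finite_mats_iff mat_adjoint_def scalar_set_closed)
qed


section \<open>Matrix groups\<close>

lemma mat_group_simps [simp]:
  "carrier (mat_group A) = A" "x \<otimes>\<^bsub>mat_group A\<^esub> y = mat_mult x y" "\<one>\<^bsub>mat_group A\<^esub> = mat_one"
  by (simp_all add: mat_group_def)

lemma finite_mats_assoc:
  assumes "f \<in> finite_mats F B" "h \<in> finite_mats F' B'"
  shows "mat_mult (mat_mult f g) h = mat_mult f (mat_mult g h)"
  using assms by (intro mat_mult_assoc) (auto intro: row_column_finite_finite_mats)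

lemma GL_mats_one: "mat_one \<in> GL_mats F B"
  by (auto simp: GL_mats_def finite_mats_one intro!: bexI[of _ mat_one])

lemma GL_mats_mult:
  assumes "g \<in> GL_mats F B" "h \<in> GL_mats F B"
  shows "mat_mult g h \<in> GL_mats F B"
proof -
  obtain g' where g: "g \<in> finite_mats F B" "g' \<in> finite_mats F B"
    "mat_mult g g' = mat_one" "mat_mult g' g = mat_one"
    using assms by (auto simp: GL_mats_def)
  obtain h' where h: "h \<in> finite_mats F B" "h' \<in> finite_mats F B"
    "mat_mult h h' = mat_one" "mat_mult h' h = mat_one"
    using assms by (auto simp: GL_mats_def)
  have cancel: "mat_mult (mat_mult a b) (mat_mult b' a') = mat_one"
    if "a \<in> finite_mats F B" "b \<in> finite_mats F B" "a' \<in> finite_mats F B" "b' \<in> finite_mats F B"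
      "mat_mult b b' = mat_one" "mat_mult a a' = mat_one" for a b a' b'
  proof -
    have "mat_mult (mat_mult a b) (mat_mult b' a') = mat_mult a (mat_mult b (mat_mult b' a'))"
      using that by (intro finite_mats_assoc[of a F B _ F B] finite_mats_mult)
    also have "mat_mult b (mat_mult b' a') = a'"
      using that finite_mats_assoc[of b F B a' F B b'] by simp
    finally show ?thesis using that by simp
  qed
  have "mat_mult (mat_mult g h) (mat_mult h' g') = mat_one"
    "mat_mult (mat_mult h' g') (mat_mult g h) = mat_one"
    using cancel[of g h g' h'] cancel[of h' g' h g] g h by simp_all
  then show ?thesis
    unfolding GL_mats_def using g h finite_mats_mult by blast
qed

text \<open>The hypothesis on inverses is stated for any inverse \<open>h\<close> of \<open>g\<close> in the general linear group, where
existence is part of the definition.\<close>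

lemma group_mat_group:
  assumes "A \<subseteq> GL_mats F B" "mat_one \<in> A"
    and "\<And>g h. g \<in> A \<Longrightarrow> h \<in> A \<Longrightarrow> mat_mult g h \<in> A"
    and inv: "\<And>g h. g \<in> A \<Longrightarrow> h \<in> GL_mats F B \<Longrightarrow> mat_mult g h = mat_one \<Longrightarrow> h \<in> A"
  shows "group (mat_group A)"
proof (rule groupI)
  fix x y z assume "x \<in> carrier (mat_group A)" "y \<in> carrier (mat_group A)" "z \<in> carrier (mat_group A)"
  then show "x \<otimes>\<^bsub>mat_group A\<^esub> y \<otimes>\<^bsub>mat_group A\<^esub> z = x \<otimes>\<^bsub>mat_group A\<^esub> (y \<otimes>\<^bsub>mat_group A\<^esub> z)"
    using assms(1) finite_mats_assoc[of x F B z F B y] by (auto simp: GL_mats_def)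
next
  fix x assume "x \<in> carrier (mat_group A)"
  then have "x \<in> A" "x \<in> GL_mats F B"
    using assms(1) by auto
  then obtain h where "x \<in> A" "h \<in> GL_mats F B" "mat_mult x h = mat_one" "mat_mult h x = mat_one"
    unfolding GL_mats_def by blast
  then show "\<exists>y\<in>carrier (mat_group A). y \<otimes>\<^bsub>mat_group A\<^esub> x = \<one>\<^bsub>mat_group A\<^esub>"
    using inv by auto
qed (use assms in auto)

text \<open>Sesquilinear and bilinear forms, according to whether \<open>t\<close> is the adjoint or the transpose.\<close>

definition preserves_form :: "('i mat \<Rightarrow> 'i mat) \<Rightarrow> 'i mat \<Rightarrow> 'i mat \<Rightarrow> bool" where
  "preserves_form t S g \<longleftrightarrow> mat_mult (t g) (mat_mult S g) = S"

lemma preserves_form_mult_inverse: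
  assumes t: "\<And>g h. g \<in> finite_mats F B \<Longrightarrow> h \<in> finite_mats F B \<Longrightarrow> t (mat_mult g h) = mat_mult (t h) (t g)"
    and fin: "\<And>g. g \<in> finite_mats F B \<Longrightarrow> row_column_finite (t g)"
    and S: "row_column_finite S" and one: "t mat_one = mat_one"
    and gh: "g \<in> finite_mats F B" "h \<in> finite_mats F B" and g: "preserves_form t S g"
  shows "preserves_form t S h \<Longrightarrow> preserves_form t S (mat_mult g h)"
    and "mat_mult g h = mat_one \<Longrightarrow> preserves_form t S h"
proof -
  have fg: "row_column_finite g" "row_column_finite h"
    using gh row_column_finite_finite_mats by blast+
  have "mat_mult (t (mat_mult g h)) (mat_mult S (mat_mult g h)) =
      mat_mult (mat_mult (t h) (t g)) (mat_mult (mat_mult S g) h)"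
    by (simp add: t gh mat_mult_assoc S fg)
  also have "\<dots> = mat_mult (t h) (mat_mult (mat_mult (t g) (mat_mult S g)) h)"
    by (simp add: mat_mult_assoc S fg fin gh row_column_finite_mult)
  also have "\<dots> = mat_mult (t h) (mat_mult S h)"
    using g by (simp add: preserves_form_def)
  finally have eq: "mat_mult (t (mat_mult g h)) (mat_mult S (mat_mult g h)) = mat_mult (t h) (mat_mult S h)" .
  show "preserves_form t S h \<Longrightarrow> preserves_form t S (mat_mult g h)"
    using eq by (simp add: preserves_form_def)
  show "mat_mult g h = mat_one \<Longrightarrow> preserves_form t S h"
    using eq one by (simp add: preserves_form_def)
qed

lemma row_column_finite_forms:
  "row_column_finite mat_one" "row_column_finite form_I" "row_column_finite form_J"
proof -
  have fin: "row_column_finite S" if "\<And>i j. S i j \<noteq> 0 \<Longrightarrow> i \<in> P j \<and> j \<in> P i" "\<And>i. finite (P i)"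
    for S :: "'b mat" and P
    unfolding row_column_finite_def using that
    by (auto intro: finite_subset[of "{j. S i j \<noteq> 0}" "P i" for i]
        finite_subset[of "{i. S i j \<noteq> 0}" "P j" for j])
  have 2: "i \<in> {j} \<and> j \<in> {i}" if "form_I i j \<noteq> 0" for i j
    using that by (cases i; cases j) (auto split: if_splits)
  have 3: "i \<in> {Inl (position j), Inr (position j)} \<and> j \<in> {Inl (position i), Inr (position i)}"
    if "form_J i j \<noteq> 0" for i j
    using that by (cases i; cases j) (auto split: if_splits)
  show "row_column_finite mat_one"
    by (rule fin[of _ "\<lambda>i. {i}"]) (auto simp: mat_one_def split: if_splits)
  show "row_column_finite form_I"
    by (rule fin[of _ "\<lambda>i. {i}"], erule 2) simp
  show "row_column_finite form_J"
    by (rule fin[of _ "\<lambda>i. {Inl (position i), Inr (position i)}"], erule 3) simp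
qed

lemma preserves_form_adjoint:
  assumes "row_column_finite S" "g \<in> finite_mats F B" "h \<in> finite_mats F B" "preserves_form mat_adjoint S g"
  shows "preserves_form mat_adjoint S h \<Longrightarrow> preserves_form mat_adjoint S (mat_mult g h)"
    and "mat_mult g h = mat_one \<Longrightarrow> preserves_form mat_adjoint S h"
  using preserves_form_mult_inverse[of F B mat_adjoint S g h] assms
  by (auto simp: mat_adjoint_mult intro: row_column_finite_adjoint row_column_finite_finite_mats)

lemma preserves_form_herm:
  assumes "row_column_finite S" "g \<in> finite_mats F B" "h \<in> finite_mats F B" "preserves_herm S g"
  shows "preserves_herm S h \<Longrightarrow> preserves_herm S (mat_mult g h)"
    and "mat_mult g h = mat_one \<Longrightarrow> preserves_herm S h"
  using preserves_form_adjoint[of S g F B h] assms by (auto simp: preserves_form_def preserves_herm_def)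

lemma preserves_form_bilin:
  assumes "scalar_set F \<subseteq> scalar_set ComplexScalars"
    and "row_column_finite S" "g \<in> finite_mats F B" "h \<in> finite_mats F B" "preserves_bilin S g"
  shows "preserves_bilin S h \<Longrightarrow> preserves_bilin S (mat_mult g h)"
    and "mat_mult g h = mat_one \<Longrightarrow> preserves_bilin S h"
proof -
  have t: "mat_transpose (mat_mult g h) = mat_mult (mat_transpose h) (mat_transpose g)"
    if "g \<in> finite_mats F B" "h \<in> finite_mats F B" for g h
    using that assms(1) unfolding finite_mats_iff by (intro mat_transpose_mult) blast+
  have fin: "row_column_finite (mat_transpose g)" if "g \<in> finite_mats F B" for g
    using that by (intro row_column_finite_transpose row_column_finite_finite_mats)
  show "preserves_bilin S h \<Longrightarrow> preserves_bilin S (mat_mult g h)"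
    "mat_mult g h = mat_one \<Longrightarrow> preserves_bilin S h"
    using preserves_form_mult_inverse[of F B mat_transpose S g h, OF t fin] assms
    by (auto simp: preserves_form_def preserves_bilin_def mat_transpose_one)
qed

lemma preserves_forms_one: "preserves_herm S mat_one" "preserves_bilin S mat_one"
  by (simp_all add: preserves_herm_def preserves_bilin_def mat_transpose_one)

lemma classical_identities_closed:
  assumes "g \<in> finite_mats (classical_scalars X) B" "h \<in> finite_mats (classical_scalars X) B"
    "classical_identities X g"
  shows "classical_identities X h \<Longrightarrow> classical_identities X (mat_mult g h)"
    and "mat_mult g h = mat_one \<Longrightarrow> classical_identities X h"
proof -
  let ?F = "classical_scalars X"
  have herm: "preserves_herm S g \<Longrightarrow> preserves_herm S h \<Longrightarrow> preserves_herm S (mat_mult g h)"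
    "preserves_herm S g \<Longrightarrow> mat_mult g h = mat_one \<Longrightarrow> preserves_herm S h"
    if "row_column_finite S" for S
    using preserves_form_herm[OF that assms(1,2)] by blast+
  have bilin: "preserves_bilin S g \<Longrightarrow> preserves_bilin S h \<Longrightarrow> preserves_bilin S (mat_mult g h)"
    "preserves_bilin S g \<Longrightarrow> mat_mult g h = mat_one \<Longrightarrow> preserves_bilin S h"
    if "row_column_finite S" "scalar_set ?F \<subseteq> scalar_set ComplexScalars" for S
    using preserves_form_bilin[OF that(2,1) assms(1,2)] by blast+
  have R: "scalar_set RealScalars \<subseteq> scalar_set ComplexScalars" by auto
  note forms = row_column_finite_forms[THEN herm(1)] row_column_finite_forms[THEN herm(2)]
    row_column_finite_forms[THEN bilin(1)] row_column_finite_forms[THEN bilin(2)]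
  show "classical_identities X h \<Longrightarrow> classical_identities X (mat_mult g h)"
    using assms(3) forms R by (cases X) simp_all
  show "mat_mult g h = mat_one \<Longrightarrow> classical_identities X h"
    using assms(3) forms R by (cases X) simp_all
qed

lemma classical_identities_one: "classical_identities X mat_one"
  by (cases X) (auto simp: preserves_forms_one)

lemma group_classical_group: "group (classical_group X)"
  unfolding classical_group_def
proof (rule group_mat_group[of _ "classical_scalars X" "basis X"])
  have fin: "g \<in> finite_mats F B" if "g \<in> GL_mats F B" for g :: "(nat + nat) mat" and F B
    using that by (simp add: GL_mats_def)
  fix g h
  assume g: "g \<in> {g \<in> GL_mats (classical_scalars X) (basis X). classical_identities X g}"
  show "mat_mult g h \<in> {g \<in> GL_mats (classical_scalars X) (basis X). classical_identities X g}"
    if "h \<in> {g \<in> GL_mats (classical_scalars X) (basis X). classical_identities X g}"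
    using g that by (blast intro: GL_mats_mult classical_identities_closed(1)[OF fin fin])
  show "h \<in> {g \<in> GL_mats (classical_scalars X) (basis X). classical_identities X g}"
    if "h \<in> GL_mats (classical_scalars X) (basis X)" "mat_mult g h = mat_one"
    using g that classical_identities_closed(2)[OF fin fin] by blast
qed (auto simp: GL_mats_one classical_identities_one)

lemma group_classical_product: "group (classical_product Gs)"
  unfolding classical_product_def by (simp add: group_classical_group)

text \<open>An invertible matrix with \<open>g\<^sup>* g = 1\<close> has \<open>g\<^sup>*\<close> as its inverse, so also \<open>g g\<^sup>* = 1\<close>; conversely the two
equations provide the inverse that the general linear group asks for.\<close>

lemma heavy_carrier_iff:
  "g \<in> carrier (heavy_group k) \<longleftrightarrow> g \<in> finite_mats (heavy_scalars k) UNIV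
    \<and> mat_mult (mat_adjoint g) g = mat_one \<and> mat_mult g (mat_adjoint g) = mat_one"
proof
  assume "g \<in> carrier (heavy_group k)"
  then obtain h where g: "g \<in> finite_mats (heavy_scalars k) UNIV" "mat_mult (mat_adjoint g) g = mat_one"
    "h \<in> finite_mats (heavy_scalars k) UNIV" "mat_mult g h = mat_one"
    by (auto simp: heavy_group_def GL_mats_def)
  then have "mat_adjoint g = h"
    using finite_mats_assoc[OF finite_mats_adjoint[OF g(1)] g(3), of g] by simp
  then show "g \<in> finite_mats (heavy_scalars k) UNIV
    \<and> mat_mult (mat_adjoint g) g = mat_one \<and> mat_mult g (mat_adjoint g) = mat_one"
    using g by simp
qed (auto simp: heavy_group_def GL_mats_def intro!: bexI[of _ "mat_adjoint g"] finite_mats_adjoint)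

lemma heavy_group_mult [simp]: "x \<otimes>\<^bsub>heavy_group k\<^esub> y = mat_mult x y" "\<one>\<^bsub>heavy_group k\<^esub> = mat_one"
  by (simp_all add: heavy_group_def)

lemma group_heavy_group: "group (heavy_group k)"
proof -
  have 1: "mat_mult (mat_adjoint (mat_mult g h)) (mat_mult g h) = mat_one"
    if "g \<in> finite_mats F UNIV" "h \<in> finite_mats F UNIV" "mat_mult (mat_adjoint g) g = mat_one"
      "mat_mult (mat_adjoint h) h = mat_one" for g h :: "nat mat" and F
    using preserves_form_adjoint(1)[of mat_one g F UNIV h] that
    by (simp add: preserves_form_def row_column_finite_forms)
  have 2: "mat_mult (mat_adjoint h) h = mat_one"
    if "g \<in> finite_mats F UNIV" "h \<in> finite_mats F UNIV" "mat_mult (mat_adjoint g) g = mat_one"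
      "mat_mult g h = mat_one" for g h :: "nat mat" and F
    using preserves_form_adjoint(2)[of mat_one g F UNIV h] that
    by (simp add: preserves_form_def row_column_finite_forms)
  show ?thesis
    unfolding heavy_group_def
  proof (rule group_mat_group[of _ "heavy_scalars k" UNIV])
    have fin: "g \<in> finite_mats F B" if "g \<in> GL_mats F B" for g :: "nat mat" and F B
      using that by (simp add: GL_mats_def)
    fix g h :: "nat mat"
    assume g: "g \<in> {g \<in> GL_mats (heavy_scalars k) UNIV. mat_mult (mat_adjoint g) g = mat_one}"
    show "mat_mult g h \<in> {g \<in> GL_mats (heavy_scalars k) UNIV. mat_mult (mat_adjoint g) g = mat_one}"
      if "h \<in> {g \<in> GL_mats (heavy_scalars k) UNIV. mat_mult (mat_adjoint g) g = mat_one}"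
      using g that 1[OF fin fin] GL_mats_mult by blast
    show "h \<in> {g \<in> GL_mats (heavy_scalars k) UNIV. mat_mult (mat_adjoint g) g = mat_one}"
      if "h \<in> GL_mats (heavy_scalars k) UNIV" "mat_mult g h = mat_one"
      using g that 2[OF fin fin] by blast
  qed (auto simp: GL_mats_one)
qed

lemma group_heavy_product: "group (heavy_product Ls)"
  unfolding heavy_product_def by (simp add: group_heavy_group)

lemma inv_heavy_group: "g \<in> carrier (heavy_group k) \<Longrightarrow> inv\<^bsub>heavy_group k\<^esub> g = mat_adjoint g"
  by (rule group.inv_equality[OF group_heavy_group]) (auto simp: heavy_carrier_iff finite_mats_adjoint)


section \<open>Permutation matrices\<close>

definition perm_mat :: "('i \<Rightarrow> 'i) \<Rightarrow> 'i mat" where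
  "perm_mat \<sigma> x y = (if x = \<sigma> y then 1 else 0)"

definition finite_perm :: "('i \<Rightarrow> 'i) \<Rightarrow> bool" where
  "finite_perm \<sigma> \<longleftrightarrow> bij \<sigma> \<and> finite {x. \<sigma> x \<noteq> x}"

lemma finite_perm_comp: "finite_perm \<sigma> \<Longrightarrow> finite_perm \<tau> \<Longrightarrow> finite_perm (\<sigma> \<circ> \<tau>)"
  unfolding finite_perm_def
  by (auto intro: bij_comp finite_subset[of _ "{x. \<sigma> x \<noteq> x} \<union> {x. \<tau> x \<noteq> x}"])

lemma finite_perm_inv:
  assumes "finite_perm \<sigma>"
  shows "finite_perm (inv_into UNIV \<sigma>)"
proof -
  have "inv_into UNIV \<sigma> x = x \<longleftrightarrow> \<sigma> x = x" for x
    using assms by (subst eq_commute, intro bij_inv_eq_iff) (simp add: finite_perm_def)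
  then have "{x. inv_into UNIV \<sigma> x \<noteq> x} = {x. \<sigma> x \<noteq> x}"
    by simp
  then show ?thesis
    using assms by (simp add: finite_perm_def bij_imp_bij_inv)
qed

lemma mult_perm_mat: "mat_mult g (perm_mat \<sigma>) x y = g x (\<sigma> y)"
  by (subst mat_mult_eq_sum[of "{\<sigma> y}"]) (auto simp: perm_mat_def split: if_splits)

lemma perm_mat_mult:
  assumes "bij \<sigma>"
  shows "mat_mult (perm_mat \<sigma>) g x y = g (inv_into UNIV \<sigma> x) y"
proof -
  have "\<sigma> (inv_into UNIV \<sigma> x) = x"
    using assms by (simp add: bij_is_surj surj_f_inv_f)
  then show ?thesis
    using assms
    by (subst mat_mult_eq_sum[of "{inv_into UNIV \<sigma> x}"])
      (auto simp: perm_mat_def bij_is_inj split: if_splits)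
qed

lemma perm_mat_comp: "mat_mult (perm_mat \<sigma>) (perm_mat \<tau>) = perm_mat (\<sigma> \<circ> \<tau>)"
  by (intro ext) (simp add: mult_perm_mat, simp add: perm_mat_def)

lemma perm_mat_id: "perm_mat id = mat_one" "perm_mat (\<lambda>x. x) = mat_one"
  by (intro ext, simp add: perm_mat_def mat_one_def)+

lemma perm_mat_adjoint:
  assumes "bij \<sigma>"
  shows "mat_adjoint (perm_mat \<sigma>) = perm_mat (inv_into UNIV \<sigma>)"
  using assms by (intro ext) (auto simp: mat_adjoint_def perm_mat_def bij_inv_eq_iff)

lemma perm_mat_heavy:
  assumes "finite_perm \<sigma>"
  shows "perm_mat \<sigma> \<in> carrier (heavy_group k)"
proof -
  have bij: "bij \<sigma>" using assms by (simp add: finite_perm_def)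
  have "x = \<sigma> y \<longleftrightarrow> x = y" if "\<sigma> x = x \<or> \<sigma> y = y" for x y
    using that bij_is_inj[OF bij] by (metis injD)
  then have "perm_mat \<sigma> x y = mat_one x y" if "\<sigma> x = x \<or> \<sigma> y = y" for x y
    using that by (simp add: perm_mat_def mat_one_def)
  then have "supported_on {x. \<sigma> x \<noteq> x} (perm_mat \<sigma>)"
    by (simp add: supported_on_def)
  moreover have "finite {x. \<sigma> x \<noteq> x}"
    using assms by (simp add: finite_perm_def)
  moreover have "supported_on UNIV (perm_mat \<sigma>)" "perm_mat \<sigma> i j \<in> scalar_set (heavy_scalars k)" for i j
    by (simp_all add: supported_on_def perm_mat_def scalar_set_closed)
  ultimately have "perm_mat \<sigma> \<in> finite_mats (heavy_scalars k) UNIV"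
    unfolding finite_mats_iff by blast
  moreover have "inv_into UNIV \<sigma> \<circ> \<sigma> = id" "\<sigma> \<circ> inv_into UNIV \<sigma> = id"
    using bij_is_inj[OF bij] bij_is_surj[OF bij] by (simp_all add: surj_iff)
  ultimately show ?thesis
    using bij by (simp add: heavy_carrier_iff perm_mat_adjoint perm_mat_comp perm_mat_id)
qed


section \<open>Entries of trivial homomorphisms\<close>

lemma less_numeral_cases: "s < (2::nat) \<longleftrightarrow> s = 0 \<or> s = 1" "s < (4::nat) \<longleftrightarrow> s = 0 \<or> s = 1 \<or> s = 2 \<or> s = 3"
  by auto

lemma qunit_simps: "qunit 0 = Quat 1 0 0 0" "qunit (Suc 0) = Quat 0 1 0 0" "qunit 2 = Quat 0 0 1 0" "qunit 3 = Quat 0 0 0 1"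
  by (simp_all add: qunit_def numeral_2_eq_2 numeral_3_eq_3)

lemma coord_simps:
  "real_coord 0 x = Quat (qre x) 0 0 0" "real_coord (Suc 0) x = Quat (qi x) 0 0 0"
  "real_coord 2 x = Quat (qj x) 0 0 0" "real_coord 3 x = Quat (qk x) 0 0 0"
  "complex_coord 0 x = Quat (qre x) (qi x) 0 0" "complex_coord (Suc 0) x = Quat (qj x) (- qk x) 0 0"
  by (simp_all add: real_coord_def complex_coord_def numeral_2_eq_2 numeral_3_eq_3)

lemma sum_lessThan_numeral: "sum f {..<Suc 0} = f 0" "sum f {..<2} = f 0 + f (Suc 0)" "sum f {..<4} = f 0 + f (Suc 0) + f 2 + f 3"
  for f :: "nat \<Rightarrow> 'a::comm_monoid_add"
  by (simp_all add: numeral_2_eq_2 numeral_3_eq_3 eval_nat_numeral)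

lemmas triv_entry_simps = qunit_simps coord_simps quat_mult_sel quat_eq_iff

lemma triv_entry_zero: "s < triv_size \<tau> \<Longrightarrow> triv_entry \<tau> 0 s t = 0"
  by (cases \<tau>) (auto simp: less_numeral_cases triv_entry_simps)

lemma triv_entry_one:
  assumes "s < triv_size \<tau>" "t < triv_size \<tau>"
  shows "triv_entry \<tau> 1 s t = (if s = t then 1 else 0)"
  using assms by (cases \<tau>) (auto simp: less_numeral_cases triv_entry_simps)

lemma triv_entry_add:
  assumes "s < triv_size \<tau>" "t < triv_size \<tau>"
  shows "triv_entry \<tau> (x + y) s t = triv_entry \<tau> x s t + triv_entry \<tau> y s t"
  using assms by (cases \<tau>) (auto simp: less_numeral_cases triv_entry_simps)

lemma triv_entry_sum:
  assumes "s < triv_size \<tau>" "t < triv_size \<tau>"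
  shows "triv_entry \<tau> (sum f A) s t = (\<Sum>a\<in>A. triv_entry \<tau> (f a) s t)"
  using assms by (induction A rule: infinite_finite_induct) (auto simp: triv_entry_zero triv_entry_add)

text \<open>The blocks of size greater than \<open>1\<close> are matrices of left multiplications, so products of scalars
become products of blocks. For elementwise conjugation it is essential that the source consists of complex
numbers, which commute.\<close>

lemma triv_entry_mult:
  assumes "x \<in> scalar_set (heavy_scalars (triv_source \<tau>))" "y \<in> scalar_set (heavy_scalars (triv_source \<tau>))"
    "s < triv_size \<tau>" "t < triv_size \<tau>"
  shows "triv_entry \<tau> (x * y) s t = (\<Sum>u<triv_size \<tau>. triv_entry \<tau> x s u * triv_entry \<tau> y u t)"
  using assms
  by (cases \<tau>; simp add: less_numeral_cases sum_lessThan_numeral; (elim disjE)?;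
      simp add: triv_entry_simps algebra_simps)

lemma triv_entry_conj:
  assumes "x \<in> scalar_set (heavy_scalars (triv_source \<tau>))" "s < triv_size \<tau>" "t < triv_size \<tau>"
  shows "triv_entry \<tau> (qconj x) s t = qconj (triv_entry \<tau> x t s)"
  using assms
  by (cases \<tau>; simp add: less_numeral_cases; (elim disjE)?; simp add: triv_entry_simps)

lemma triv_entry_scalars:
  assumes "x \<in> scalar_set (heavy_scalars (triv_source \<tau>))" "s < triv_size \<tau>" "t < triv_size \<tau>"
  shows "triv_entry \<tau> x s t \<in> scalar_set (heavy_scalars (triv_target \<tau>))"
  using assms
  by (cases \<tau>; simp add: less_numeral_cases; (elim disjE)?; simp add: triv_entry_simps)

text \<open>The left multiplications commute with the structure map of the plane: multiplication by \<open>i\<close> on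
\<open>C = R + iR\<close>, right multiplication by \<open>j\<close> on \<open>H = C + jC\<close>. The latter is antilinear over \<open>C\<close>, whence
the conjugations.\<close>

lemma triv_entry_quaternionic:
  assumes "\<tau> = U_to_O \<and> x \<in> scalar_set ComplexScalars \<or> \<tau> = Sp_to_U"
  shows "triv_entry \<tau> x (Suc 0) 0 = - qconj (triv_entry \<tau> x 0 (Suc 0))"
    and "triv_entry \<tau> x (Suc 0) (Suc 0) = qconj (triv_entry \<tau> x 0 0)"
  using assms by (auto simp: triv_entry_simps)


section \<open>Block matrices\<close>

text \<open>A common shape for straight homomorphisms and for the inclusions of maximal heavy subgroups. The
label \<open>(c, s, n)\<close> of an index says that it is the \<open>s\<close>-th vector in the block that replaces the
\<open>n\<close>-th index of the matrix \<open>g c\<close>; unlabelled indices carry a unit block.\<close>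

definition block_mat ::
  "('i \<Rightarrow> (nat \<times> nat \<times> nat) option) \<Rightarrow> (nat \<Rightarrow> trivial) \<Rightarrow> (nat \<Rightarrow> nat mat) \<Rightarrow> 'i mat" where
  "block_mat lab \<tau> g i i' = (case (lab i, lab i') of
     (Some (c, s, n), Some (c', s', n')) \<Rightarrow> if c = c' then triv_entry (\<tau> c) (g c n n') s s' else 0
   | _ \<Rightarrow> mat_one i i')"

lemma block_mat_None: "lab i = None \<or> lab i' = None \<Longrightarrow> block_mat lab \<tau> g i i' = mat_one i i'"
  by (auto simp: block_mat_def split: option.splits)

lemma block_mat_Some:
  "lab i = Some (c, s, n) \<Longrightarrow> lab i' = Some (c', s', n') \<Longrightarrow>
    block_mat lab \<tau> g i i' = (if c = c' then triv_entry (\<tau> c) (g c n n') s s' else 0)"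
  by (simp add: block_mat_def)

locale block_structure =
  fixes lab :: "'i \<Rightarrow> (nat \<times> nat \<times> nat) option" and \<tau> :: "nat \<Rightarrow> trivial" and N :: nat
  assumes lab_inj: "\<And>i i' x. lab i = Some x \<Longrightarrow> lab i' = Some x \<Longrightarrow> i = i'"
    and lab_bounds: "\<And>i c s n. lab i = Some (c, s, n) \<Longrightarrow> c < N \<and> s < triv_size (\<tau> c)"
    and lab_surj: "\<And>c s n. c < N \<Longrightarrow> s < triv_size (\<tau> c) \<Longrightarrow> \<exists>i. lab i = Some (c, s, n)"
begin

definition index_at :: "nat \<Rightarrow> nat \<Rightarrow> nat \<Rightarrow> 'i" where
  "index_at c s n = (SOME i. lab i = Some (c, s, n))"

lemma lab_at: "c < N \<Longrightarrow> s < triv_size (\<tau> c) \<Longrightarrow> lab (index_at c s n) = Some (c, s, n)"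
  unfolding index_at_def by (rule someI_ex) (rule lab_surj)

lemma at_lab: "lab i = Some (c, s, n) \<Longrightarrow> index_at c s n = i"
  using lab_bounds lab_at lab_inj by metis

definition matrix_family :: "(nat \<Rightarrow> nat mat) \<Rightarrow> bool" where
  "matrix_family g \<longleftrightarrow> (\<forall>c<N. g c \<in> finite_mats (heavy_scalars (triv_source (\<tau> c))) UNIV)"

abbreviation "B \<equiv> block_mat lab \<tau>"

lemma B_None: "lab i = None \<or> lab i' = None \<Longrightarrow> B g i i' = mat_one i i'"
  by (rule block_mat_None)

lemma B_Some:
  "lab i = Some (c, s, n) \<Longrightarrow> lab i' = Some (c', s', n') \<Longrightarrow>
    B g i i' = (if c = c' then triv_entry (\<tau> c) (g c n n') s s' else 0)"
  by (rule block_mat_Some)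

text \<open>A block vanishes or is a unit matrix whenever the entry that it replaces is \<open>0\<close> or \<open>1\<close>, so entries
of the block matrix are trivial where those of the argument are.\<close>

lemma block_mat_local:
  assumes "\<And>c s n s' n'. lab i = Some (c, s, n) \<Longrightarrow> lab i' = Some (c, s', n') \<Longrightarrow> g c n n' = mat_one n n'"
  shows "B g i i' = mat_one i i'"
proof (cases "lab i = None \<or> lab i' = None")
  case False
  then obtain c s n c' s' n' where l: "lab i = Some (c, s, n)" "lab i' = Some (c', s', n')"
    by (metis not_None_eq prod_cases3)
  have ii': "i = i' \<longleftrightarrow> (c, s, n) = (c', s', n')"
    using l lab_inj by auto
  show ?thesis
    using assms[of c s n s' n'] l lab_bounds[OF l(1)] lab_bounds[OF l(2)]
    by (auto simp: B_Some[OF l] ii' mat_one_def triv_entry_one triv_entry_zero)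
qed (simp add: B_None)

lemma block_mat_mult:
  assumes g: "matrix_family g" and h: "matrix_family h"
    and f: "\<And>c. c < N \<Longrightarrow> f c = mat_mult (g c) (h c)"
  shows "B f = mat_mult (B g) (B h)"
proof (intro ext)
  fix i j
  consider "lab i = None" | "lab j = None"
    | c s n c' s' n' where "lab i = Some (c, s, n)" "lab j = Some (c', s', n')"
    by (metis not_None_eq prod_cases3)
  then show "B f i j = mat_mult (B g) (B h) i j"
  proof cases
    case 1
    then show ?thesis
      by (subst mat_mult_trivial_row) (auto simp: B_None)
  next
    case 2
    then show ?thesis
      by (subst mat_mult_trivial_column) (auto simp: B_None)
  next
    case 3
    have c: "c < N" "s < triv_size (\<tau> c)" "c' < N" "s' < triv_size (\<tau> c')"
      using 3 lab_bounds by blast+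
    have sc: "g c x y \<in> scalar_set (heavy_scalars (triv_source (\<tau> c)))"
      "h c x y \<in> scalar_set (heavy_scalars (triv_source (\<tau> c)))" for x y
      using g h c unfolding matrix_family_def finite_mats_iff by blast+
    \<comment> \<open>The summation index runs over the vectors \<open>(c, u, m)\<close> of the same block with \<open>m\<close> in the
      finite support of the \<open>n\<close>-th row of \<open>g c\<close>.\<close>
    define T where "T = {m. g c n m \<noteq> 0}"
    have T: "finite T"
      using g c row_column_finite_finite_mats unfolding matrix_family_def T_def row_column_finite_def
      by blast
    let ?I = "(\<lambda>(u, m). index_at c u m) ` ({..<triv_size (\<tau> c)} \<times> T)"
    have inj: "inj_on (\<lambda>(u, m). index_at c u m) ({..<triv_size (\<tau> c)} \<times> T)"
      using lab_at[OF c(1)] by (auto simp: inj_on_def) (metis Pair_inject option.inject)+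
    have "mat_mult (B g) (B h) i j = (\<Sum>k\<in>?I. B g i k * B h k j)"
    proof (rule mat_mult_eq_sum)
      fix k assume k: "B g i k \<noteq> 0"
      have "lab k \<noteq> None"
        using k 3(1) B_None[of i k g] by (metis mat_one_def option.distinct(1))
      then obtain c'' u m where lk: "lab k = Some (c'', u, m)"
        by (metis not_None_eq prod_cases3)
      have "c'' = c" "m \<in> T"
        using k c by (auto simp: B_Some[OF 3(1) lk] T_def triv_entry_zero split: if_splits)
      then show "k \<in> ?I"
        using at_lab[OF lk] lab_bounds[OF lk] by force
    qed (use T in simp)
    also have "\<dots> = (\<Sum>(u, m)\<in>{..<triv_size (\<tau> c)} \<times> T. B g i (index_at c u m) * B h (index_at c u m) j)"
      using inj by (simp add: sum.reindex case_prod_unfold)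
    also have "\<dots> = (\<Sum>(u, m)\<in>{..<triv_size (\<tau> c)} \<times> T. triv_entry (\<tau> c) (g c n m) s u *
        (if c = c' then triv_entry (\<tau> c) (h c m n') u s' else 0))"
      using c by (intro sum.cong refl) (auto simp: B_Some[OF 3(1) lab_at] B_Some[OF lab_at 3(2)])
    also have "\<dots> = B f i j"
    proof (cases "c = c'")
      case True
      have "(\<Sum>(u, m)\<in>{..<triv_size (\<tau> c)} \<times> T. triv_entry (\<tau> c) (g c n m) s u * triv_entry (\<tau> c) (h c m n') u s')
          = (\<Sum>m\<in>T. \<Sum>u<triv_size (\<tau> c). triv_entry (\<tau> c) (g c n m) s u * triv_entry (\<tau> c) (h c m n') u s')"
        by (subst sum.swap) (simp add: sum.cartesian_product)
      also have "\<dots> = (\<Sum>m\<in>T. triv_entry (\<tau> c) (g c n m * h c m n') s s')"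
        using c sc True by (simp add: triv_entry_mult)
      also have "\<dots> = triv_entry (\<tau> c) (\<Sum>m\<in>T. g c n m * h c m n') s s'"
        using c True by (simp add: triv_entry_sum)
      also have "(\<Sum>m\<in>T. g c n m * h c m n') = f c n n'"
        using T c by (subst f) (auto simp: T_def intro!: mat_mult_eq_sum[symmetric])
      finally show ?thesis
        using True by (simp add: B_Some[OF 3])
    qed (simp add: B_Some[OF 3])
    finally show ?thesis by simp
  qed
qed

lemma block_mat_adjoint:
  assumes g: "matrix_family g" and f: "\<And>c. c < N \<Longrightarrow> f c = mat_adjoint (g c)"
  shows "B f = mat_adjoint (B g)"
proof (intro ext)
  fix i j
  show "B f i j = mat_adjoint (B g) i j"
  proof (cases "lab i = None \<or> lab j = None")
    case True
    then show ?thesis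
      by (auto simp: B_None mat_adjoint_def mat_one_def)
  next
    case False
    then obtain c s n c' s' n' where l: "lab i = Some (c, s, n)" "lab j = Some (c', s', n')"
      by (metis not_None_eq prod_cases3)
    have c: "c < N" "s < triv_size (\<tau> c)" "c' < N" "s' < triv_size (\<tau> c')"
      using l lab_bounds by blast+
    have "g c x y \<in> scalar_set (heavy_scalars (triv_source (\<tau> c)))" for x y
      using g c unfolding matrix_family_def finite_mats_iff by blast
    then show ?thesis
      using c by (auto simp: B_Some[OF l] B_Some[OF l(2,1)] f mat_adjoint_def triv_entry_conj)
  qed
qed

lemma block_mat_one:
  assumes "\<And>c. c < N \<Longrightarrow> f c = mat_one"
  shows "B f = mat_one"
  by (intro ext block_mat_local) (use assms lab_bounds in metis)

text \<open>Permutation matrices are made of zeros and ones, which every trivial homomorphism replaces by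
zero and unit blocks.\<close>

lemma block_mat_perm:
  assumes f: "\<And>c. c < N \<Longrightarrow> f c = perm_mat (\<sigma> c)"
    and \<pi>: "\<And>i. lab i = None \<Longrightarrow> \<pi> i = i"
      "\<And>i c s n. lab i = Some (c, s, n) \<Longrightarrow> lab (\<pi> i) = Some (c, s, \<sigma> c n)"
  shows "B f = perm_mat \<pi>"
proof (intro ext)
  fix i j
  consider "lab j = None" | c s n where "lab i = None" "lab j = Some (c, s, n)"
    | c s n c' s' n' where "lab i = Some (c, s, n)" "lab j = Some (c', s', n')"
    by (metis not_None_eq prod_cases3)
  then show "B f i j = perm_mat \<pi> i j"
  proof cases
    case 1
    then show ?thesis
      by (simp add: B_None perm_mat_def mat_one_def \<pi>)
  next
    case 2
    then have "i \<noteq> j" "i \<noteq> \<pi> j"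
      using \<pi>(2)[OF 2(2)] by auto
    with 2 show ?thesis
      by (simp add: B_None perm_mat_def mat_one_def)
  next
    case 3
    have "i = \<pi> j \<longleftrightarrow> (c, s, n) = (c', s', \<sigma> c' n')"
      using 3 \<pi>(2)[OF 3(2)] lab_inj by auto
    then show ?thesis
      using lab_bounds[OF 3(1)] lab_bounds[OF 3(2)]
      by (auto simp: B_Some[OF 3] perm_mat_def f triv_entry_one triv_entry_zero)
  qed
qed

lemma block_mat_finite:
  assumes g: "matrix_family g"
    and target: "\<And>c. c < N \<Longrightarrow> scalar_set (heavy_scalars (triv_target (\<tau> c))) \<subseteq> scalar_set F"
    and D: "\<And>i. lab i \<noteq> None \<Longrightarrow> i \<in> D"
  shows "B g \<in> finite_mats F D"
proof -
  have "\<forall>c\<in>{..<N}. \<exists>T. finite T \<and> supported_on T (g c)"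
    using g unfolding matrix_family_def finite_mats_iff by blast
  then obtain T where T: "\<And>c. c < N \<Longrightarrow> finite (T c)" "\<And>c. c < N \<Longrightarrow> supported_on (T c) (g c)"
    by (metis lessThan_iff)
  let ?F = "\<Union>c<N. \<Union>s<triv_size (\<tau> c). \<Union>n\<in>T c. {index_at c s n}"
  have "supported_on ?F (B g)"
    unfolding supported_on_def
  proof (intro allI impI block_mat_local)
    fix i j c s n s' n'
    assume ij: "i \<notin> ?F \<or> j \<notin> ?F" and l: "lab i = Some (c, s, n)" "lab j = Some (c, s', n')"
    have b: "c < N" "s < triv_size (\<tau> c)" "s' < triv_size (\<tau> c)"
      using lab_bounds l by blast+
    have "n \<notin> T c \<or> n' \<notin> T c"
      using ij b at_lab[OF l(1)] at_lab[OF l(2)] by blast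
    then show "g c n n' = mat_one n n'"
      using T b by (auto simp: supported_on_def)
  qed
  moreover have "finite ?F"
    using T by auto
  moreover have "supported_on D (B g)"
    using D B_None by (fastforce simp: supported_on_def)
  moreover have "B g i j \<in> scalar_set F" for i j
  proof (cases "lab i = None \<or> lab j = None")
    case True
    then show ?thesis
      by (simp add: B_None mat_one_def scalar_set_closed)
  next
    case False
    then obtain c s n c' s' n' where l: "lab i = Some (c, s, n)" "lab j = Some (c', s', n')"
      by (metis not_None_eq prod_cases3)
    have c: "c < N" "s < triv_size (\<tau> c)" "s' < triv_size (\<tau> c')"
      using l lab_bounds by blast+
    have "g c n n' \<in> scalar_set (heavy_scalars (triv_source (\<tau> c)))"
      using g c unfolding matrix_family_def finite_mats_iff by blast
    then show ?thesis
      using c triv_entry_scalars[of "g c n n'" "\<tau> c" s s'] target[OF c(1)]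
      by (auto simp: B_Some[OF l] scalar_set_closed)
  qed
  ultimately show ?thesis
    unfolding finite_mats_iff by blast
qed

lemma block_mat_unitary:
  assumes g: "\<And>c. c < N \<Longrightarrow> g c \<in> carrier (heavy_group (triv_source (\<tau> c)))"
  shows "mat_mult (mat_adjoint (B g)) (B g) = mat_one" "mat_mult (B g) (mat_adjoint (B g)) = mat_one"
proof -
  let ?h = "\<lambda>c. mat_adjoint (g c)"
  have fam: "matrix_family g" "matrix_family ?h"
    using g by (auto simp: matrix_family_def heavy_carrier_iff finite_mats_adjoint)
  have adj: "B ?h = mat_adjoint (B g)"
    using fam by (intro block_mat_adjoint) auto
  have "B (\<lambda>_. mat_one) = mat_mult (B ?h) (B g)" "B (\<lambda>_. mat_one) = mat_mult (B g) (B ?h)"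
    using fam g by (auto intro!: block_mat_mult simp: heavy_carrier_iff)
  then show "mat_mult (mat_adjoint (B g)) (B g) = mat_one" "mat_mult (B g) (mat_adjoint (B g)) = mat_one"
    by (simp_all add: adj block_mat_one)
qed

end


section \<open>Straight homomorphisms as block matrices\<close>

definition straight_label :: "straight_data \<Rightarrow> nat \<Rightarrow> (nat \<times> nat \<times> nat) option" where
  "straight_label d u = (case slot_of d u of Fixed n \<Rightarrow> None | Copy c s n \<Rightarrow> Some (c, s, n))"

lemma straight_label_Some: "straight_label d u = Some (c, s, n) \<longleftrightarrow> slot_of d u = Copy c s n"
  by (auto simp: straight_label_def split: slot.splits)

lemma straight_inj:
  assumes "straight Ls k d" "slot_of d u = slot_of d v"
  shows "u = v"
  using assms by (auto simp: straight_def bij_betw_def inj_on_def)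

lemma slot_in_slots: "straight Ls k d \<Longrightarrow> slot_of d u \<in> slots d"
  by (auto simp: straight_def bij_betw_def)

lemma slots_surj: "straight Ls k d \<Longrightarrow> x \<in> slots d \<Longrightarrow> \<exists>u. slot_of d u = x"
  unfolding straight_def bij_betw_def by (metis imageE)

lemma straight_block:
  assumes "straight Ls k d" "c < length (blocks d)"
  shows "fst (blocks d ! c) < length Ls" "triv_source (snd (blocks d ! c)) = Ls ! fst (blocks d ! c)"
    "triv_target (snd (blocks d ! c)) = k"
  using assms(1) nth_mem[OF assms(2)] unfolding straight_def by fastforce+

lemma block_structure_straight:
  assumes "straight Ls k d"
  shows "block_structure (straight_label d) (\<lambda>c. snd (blocks d ! c)) (length (blocks d))"
proof
  fix i i' x assume "straight_label d i = Some x" "straight_label d i' = Some x"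
  then show "i = i'"
    using straight_inj[OF assms] by (cases x) (auto simp: straight_label_Some)
next
  fix i c s n assume "straight_label d i = Some (c, s, n)"
  then show "c < length (blocks d) \<and> s < triv_size (snd (blocks d ! c))"
    using slot_in_slots[OF assms, of i] by (auto simp: straight_label_Some slots_def)
next
  fix c s n assume "c < length (blocks d)" "s < triv_size (snd (blocks d ! c))"
  then show "\<exists>i. straight_label d i = Some (c, s, n)"
    using slots_surj[OF assms, of "Copy c s n"] by (auto simp: straight_label_Some slots_def)
qed

lemma straight_hom_eq_block_mat:
  assumes "straight Ls k d"
  shows "straight_hom d l =
    block_mat (straight_label d) (\<lambda>c. snd (blocks d ! c)) (\<lambda>c. l (fst (blocks d ! c)))"
proof (intro ext)
  fix u v
  show "straight_hom d l u v =
      block_mat (straight_label d) (\<lambda>c. snd (blocks d ! c)) (\<lambda>c. l (fst (blocks d ! c))) u v"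
    using straight_inj[OF assms, of u v]
    by (cases "slot_of d u"; cases "slot_of d v")
      (auto simp: straight_hom_def straight_label_def block_mat_def mat_one_def)
qed

lemma heavy_product_component:
  "l \<in> carrier (heavy_product Ls) \<Longrightarrow> j < length Ls \<Longrightarrow> l j \<in> carrier (heavy_group (Ls ! j))"
  by (auto simp: heavy_product_def PiE_def)

lemma straight_family:
  assumes "straight Ls k d" "l \<in> carrier (heavy_product Ls)" "c < length (blocks d)"
  shows "l (fst (blocks d ! c)) \<in> carrier (heavy_group (triv_source (snd (blocks d ! c))))"
  using straight_block[OF assms(1,3)] heavy_product_component[OF assms(2)] by simp

lemma straight_matrix_family:
  assumes "straight Ls k d" "l \<in> carrier (heavy_product Ls)"
  shows "block_structure.matrix_family (\<lambda>c. snd (blocks d ! c)) (length (blocks d)) (\<lambda>c. l (fst (blocks d ! c)))"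
  using straight_family[OF assms]
  by (simp add: block_structure.matrix_family_def[OF block_structure_straight[OF assms(1)]] heavy_carrier_iff)

lemma straight_hom_carrier:
  assumes "straight Ls k d" "l \<in> carrier (heavy_product Ls)"
  shows "straight_hom d l \<in> carrier (heavy_group k)"
proof -
  interpret block_structure "straight_label d" "\<lambda>c. snd (blocks d ! c)" "length (blocks d)"
    by (rule block_structure_straight[OF assms(1)])
  show ?thesis
    unfolding heavy_carrier_iff straight_hom_eq_block_mat[OF assms(1)]
    using straight_family[OF assms] straight_matrix_family[OF assms] straight_block(3)[OF assms(1)]
    by (intro conjI block_mat_unitary block_mat_finite) auto
qed

lemma straight_hom_mult:
  assumes "straight Ls k d" "l \<in> carrier (heavy_product Ls)" "l' \<in> carrier (heavy_product Ls)"
  shows "straight_hom d (l \<otimes>\<^bsub>heavy_product Ls\<^esub> l') = mat_mult (straight_hom d l) (straight_hom d l')"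
proof -
  interpret block_structure "straight_label d" "\<lambda>c. snd (blocks d ! c)" "length (blocks d)"
    by (rule block_structure_straight[OF assms(1)])
  show ?thesis
    unfolding straight_hom_eq_block_mat[OF assms(1)]
    using straight_matrix_family[OF assms(1)] assms(2,3) straight_block(1)[OF assms(1)]
    by (intro block_mat_mult) (auto simp: heavy_product_def)
qed

lemma slot_relabel_index:
  assumes "straight Ls k d"
  shows "slot_of d (relabel_index \<omega> d u) = relabel_slot \<omega> (blocks d) (slot_of d u)"
proof -
  have "relabel_slot \<omega> (blocks d) (slot_of d u) \<in> slots d"
    using slot_in_slots[OF assms, of u] by (cases "slot_of d u") (auto simp: slots_def)
  then have "relabel_slot \<omega> (blocks d) (slot_of d u) \<in> range (slot_of d)"
    using slots_surj[OF assms] by (metis rangeI)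
  then show ?thesis
    unfolding relabel_index_def by (rule f_inv_into_f)
qed

lemma straight_hom_perm:
  assumes "straight Ls k d" and l: "\<And>j. j < length Ls \<Longrightarrow> l j = perm_mat (\<sigma> j)"
  shows "straight_hom d l = perm_mat (relabel_index \<sigma> d)"
proof -
  interpret block_structure "straight_label d" "\<lambda>c. snd (blocks d ! c)" "length (blocks d)"
    by (rule block_structure_straight[OF assms(1)])
  have "relabel_index \<sigma> d u = u" if "straight_label d u = None" for u
    using that slot_relabel_index[OF assms(1), of \<sigma> u]
    by (intro straight_inj[OF assms(1)]) (auto simp: straight_label_def split: slot.splits)
  then show ?thesis
    unfolding straight_hom_eq_block_mat[OF assms(1)]
    using straight_block(1)[OF assms(1)] slot_relabel_index[OF assms(1)] l
    by (intro block_mat_perm[of _ "\<lambda>c. \<sigma> (fst (blocks d ! c))"]) (auto simp: straight_label_Some)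
qed


section \<open>Maximal heavy subgroups as block matrices\<close>

fun heavy_block :: "classical \<Rightarrow> trivial" where
  "heavy_block Sp_R = U_to_O"
| "heavy_block SO_star = U_to_O"
| "heavy_block Sp_C = Sp_to_U"
| "heavy_block X = Ident (max_heavy X ! 0)"

definition heavy_label :: "classical \<Rightarrow> nat + nat \<Rightarrow> (nat \<times> nat \<times> nat) option" where
  "heavy_label X b =
    (if length (max_heavy X) = 1 \<and> triv_size (heavy_block X) = 1 \<and> side b = 0 then None
     else Some (heavy_factor X b, if triv_size (heavy_block X) = 2 then side b else 0, position b))"

lemma side_position_inj: "side b = side b' \<Longrightarrow> position b = position b' \<Longrightarrow> b = b'"
  by (cases b; cases b') auto

lemma block_structure_heavy:
  "block_structure (heavy_label X) (\<lambda>_. heavy_block X) (length (max_heavy X))"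
proof
  fix i i' x assume "heavy_label X i = Some x" "heavy_label X i' = Some x"
  then show "i = i'"
    by (intro side_position_inj)
      (cases X; cases i; cases i'; auto simp: heavy_label_def heavy_factor_def split: if_splits)+
next
  fix i c s n assume "heavy_label X i = Some (c, s, n)"
  then show "c < length (max_heavy X) \<and> s < triv_size (heavy_block X)"
    by (cases X; cases i; auto simp: heavy_label_def heavy_factor_def split: if_splits)
next
  fix c s n assume "c < length (max_heavy X)" "s < triv_size (heavy_block X)"
  then have "heavy_label X (Inl n) = Some (c, s, n) \<or> heavy_label X (Inr n) = Some (c, s, n)"
    by (cases X) (auto simp: heavy_label_def heavy_factor_def less_numeral_cases)
  then show "\<exists>i. heavy_label X i = Some (c, s, n)" by blast
qed

text \<open>For the groups whose maximal heavy subgroup has two factors the blocks belong to the two sides;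
for \<open>Sp(2\<infinity>,R)\<close>, \<open>SO*(2\<infinity>)\<close> and \<open>Sp(2\<infinity>,C)\<close> the two sides are the two vectors of each block; in the
remaining cases the left side is fixed.\<close>

lemma heavy_embed_eq_block_mat: "heavy_embed X k = block_mat (heavy_label X) (\<lambda>_. heavy_block X) k"
proof (intro ext)
  fix b b'
  show "heavy_embed X k b b' = block_mat (heavy_label X) (\<lambda>_. heavy_block X) k b b'"
    by (cases X; cases b; cases b')
      (auto simp: heavy_label_def heavy_factor_def block_mat_def embed_right_def embed_pair_def
        embed_doubled_def mat_one_def)
qed

lemma heavy_block_source:
  "c < length (max_heavy X) \<Longrightarrow> triv_source (heavy_block X) = max_heavy X ! c"
  "scalar_set (heavy_scalars (triv_target (heavy_block X))) \<subseteq> scalar_set (classical_scalars X)"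
  by (cases X; auto simp: less_Suc_eq nth_Cons')+

lemma heavy_label_basis: "heavy_label X b \<noteq> None \<Longrightarrow> b \<in> basis X"
  by (cases X; cases b) (auto simp: heavy_label_def basis_def)

lemma mat_mult_scale_columns:
  assumes "row_column_finite g"
  shows "mat_mult g (\<lambda>k j. h k j * c j) i j = mat_mult g h i j * c j"
proof -
  have fin: "finite {k. g i k \<noteq> 0}"
    using assms by (simp add: row_column_finite_def)
  have "mat_mult g (\<lambda>k j. h k j * c j) i j = (\<Sum>k\<in>{k. g i k \<noteq> 0}. g i k * (h k j * c j))"
    by (rule mat_mult_eq_sum) (use fin in auto)
  also have "\<dots> = (\<Sum>k\<in>{k. g i k \<noteq> 0}. g i k * h k j) * c j"
    by (simp add: sum_distrib_right mult.assoc)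
  also have "(\<Sum>k\<in>{k. g i k \<noteq> 0}. g i k * h k j) = mat_mult g h i j"
    by (rule mat_mult_eq_sum[symmetric]) (use fin in auto)
  finally show ?thesis .
qed

text \<open>A matrix that does not mix the two sides commutes with \<open>I\<close>, so \<open>g\<^sup>* I g = g\<^sup>* g I = I\<close>.\<close>

lemma preserves_herm_form_I:
  assumes side: "\<And>i j. g i j \<noteq> 0 \<Longrightarrow> side i = side j" and g: "row_column_finite g"
    and unitary: "mat_mult (mat_adjoint g) g = mat_one"
  shows "preserves_herm form_I g"
proof -
  define \<epsilon> :: "nat + nat \<Rightarrow> quat" where "\<epsilon> b = (if side b = 0 then 1 else - 1)" for b
  have I: "form_I i j = (if i = j then \<epsilon> j else 0)" for i j
    by (cases i; cases j) (auto simp: \<epsilon>_def)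
  have "mat_mult form_I g i j = g i j * \<epsilon> j" for i j
  proof -
    have "side i = side j \<or> g i j = 0"
      using side by blast
    then show ?thesis
      by (subst mat_mult_eq_sum[of "{i}"]) (auto simp: I \<epsilon>_def split: if_splits)
  qed
  then have "mat_mult form_I g = (\<lambda>i j. g i j * \<epsilon> j)"
    by (intro ext)
  then have "mat_mult (mat_adjoint g) (mat_mult form_I g) i j = form_I i j" for i j
    by (simp add: mat_mult_scale_columns[OF row_column_finite_adjoint[OF g]] unitary)
      (simp add: I mat_one_def)
  then show ?thesis
    unfolding preserves_herm_def by (intro ext)
qed

lemma transpose_eq_adjoint:
  assumes "\<And>i j. g i j \<in> scalar_set RealScalars"
  shows "mat_transpose g = mat_adjoint g"
  using assms by (intro ext) (simp add: mat_transpose_def mat_adjoint_def quat_eq_iff)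

text \<open>The relations between the entries say that \<open>J g = cnj g J\<close>; unitarity says that
  \<open>transpose g\<close> is inverse to \<open>cnj g\<close>.\<close>

lemma preserves_bilin_form_J:
  assumes cplx: "\<And>i j. g i j \<in> scalar_set ComplexScalars" and g: "row_column_finite g"
    and unitary: "mat_mult (mat_adjoint g) g = mat_one"
    and quat: "\<And>m n. g (Inr m) (Inl n) = - qconj (g (Inl m) (Inr n))"
      "\<And>m n. g (Inr m) (Inr n) = qconj (g (Inl m) (Inl n))"
  shows "preserves_bilin form_J g"
proof -
  define g' where "g' i j = qconj (g i j)" for i j
  have g': "row_column_finite g'"
    using g by (simp add: row_column_finite_def g'_def)
  have "mat_mult form_J g = mat_mult g' form_J"
  proof (intro ext)
    fix i j
    have J: "form_J (Inl m) k = (if k = Inr m then 1 else 0)" "form_J (Inr m) k = (if k = Inl m then - 1 else 0)"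
      "form_J k (Inl m) = (if k = Inr m then - 1 else 0)" "form_J k (Inr m) = (if k = Inl m then 1 else 0)" for m k
      by (cases k; simp; fail)+
    have 1: "mat_mult form_J g (Inl m) j = g (Inr m) j" for m j
      by (subst mat_mult_eq_sum[of "{Inr m}"]) (simp_all add: J split: if_splits)
    have 2: "mat_mult form_J g (Inr m) j = - g (Inl m) j" for m j
      by (subst mat_mult_eq_sum[of "{Inl m}"]) (simp_all add: J split: if_splits)
    have 3: "mat_mult g' form_J i (Inl n) = - g' i (Inr n)" for i n
      by (subst mat_mult_eq_sum[of "{Inr n}"]) (simp_all add: J split: if_splits)
    have 4: "mat_mult g' form_J i (Inr n) = g' i (Inl n)" for i n
      by (subst mat_mult_eq_sum[of "{Inl n}"]) (simp_all add: J split: if_splits)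
    show "mat_mult form_J g i j = mat_mult g' form_J i j"
      by (cases i; cases j) (simp_all add: 1 2 3 4 g'_def quat)
  qed
  moreover have "mat_mult (mat_transpose g) g' = mat_one"
  proof (intro ext)
    fix i j
    have "mat_mult (mat_transpose g) g' i j = mat_mult (mat_adjoint g) g j i"
      unfolding mat_mult_def mat_transpose_def mat_adjoint_def g'_def
      using complex_scalars_commute[OF cplx scalar_set_closed(5)[OF cplx]] by simp
    then show "mat_mult (mat_transpose g) g' i j = mat_one i j"
      by (auto simp: unitary mat_one_def)
  qed
  ultimately show ?thesis
    unfolding preserves_bilin_def
    by (simp add: mat_mult_assoc[symmetric] row_column_finite_transpose g row_column_finite_forms)
qed

text \<open>Block matrices built from unitary matrices are unitary. The forms are then preserved because the
matrices respect \<open>I\<close> or intertwine \<open>J\<close>; over the reals the transpose is the adjoint, which reduces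
bilinear forms to Hermitian ones.\<close>

lemma heavy_embed_carrier:
  assumes k: "\<And>i. i < length (max_heavy X) \<Longrightarrow> k i \<in> carrier (heavy_group (max_heavy X ! i))"
  shows "heavy_embed X k \<in> carrier (classical_group X)"
proof -
  interpret block_structure "heavy_label X" "\<lambda>_. heavy_block X" "length (max_heavy X)"
    by (rule block_structure_heavy)
  let ?g = "heavy_embed X k"
  have k': "k c \<in> carrier (heavy_group (triv_source (heavy_block X)))" if "c < length (max_heavy X)" for c
    using k[OF that] heavy_block_source(1)[OF that] by simp
  then have fam: "matrix_family k"
    by (auto simp: matrix_family_def heavy_carrier_iff)
  have fin: "?g \<in> finite_mats (classical_scalars X) (basis X)"
    unfolding heavy_embed_eq_block_mat
    using fam heavy_block_source(2) heavy_label_basis by (intro block_mat_finite) auto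
  have fin': "?g \<in> finite_mats (heavy_scalars (triv_target (heavy_block X))) UNIV"
    unfolding heavy_embed_eq_block_mat using fam by (intro block_mat_finite) auto
  have unitary: "mat_mult (mat_adjoint ?g) ?g = mat_one" "mat_mult ?g (mat_adjoint ?g) = mat_one"
    unfolding heavy_embed_eq_block_mat using block_mat_unitary[of k] k' by blast+
  have rc: "row_column_finite ?g"
    using fin by (rule row_column_finite_finite_mats)
  have real: "mat_transpose ?g = mat_adjoint ?g" if "heavy_scalars (triv_target (heavy_block X)) = RealScalars"
    using fin' that unfolding finite_mats_iff by (intro transpose_eq_adjoint) metis
  have bilin: "preserves_bilin S ?g = preserves_herm S ?g"
    if "heavy_scalars (triv_target (heavy_block X)) = RealScalars" for S
    by (simp add: preserves_bilin_def preserves_herm_def real[OF that])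
  have I: "preserves_herm form_I ?g" if "triv_size (heavy_block X) = 1"
  proof (rule preserves_herm_form_I[OF _ rc unitary(1)])
    fix i j assume "?g i j \<noteq> 0"
    then show "side i = side j"
      using that unfolding heavy_embed_eq_block_mat
      by (cases X; cases i; cases j)
        (auto simp: block_mat_def heavy_label_def heavy_factor_def mat_one_def split: if_splits)
  qed
  have one: "preserves_herm mat_one ?g"
    by (simp add: preserves_herm_def unitary)
  have J: "preserves_bilin form_J ?g" if "triv_size (heavy_block X) = 2"
  proof (rule preserves_bilin_form_J[OF _ rc unitary(1)])
    have \<tau>: "heavy_block X = U_to_O \<and> heavy_scalars (max_heavy X ! 0) = ComplexScalars \<or> heavy_block X = Sp_to_U"
      "heavy_factor X b = 0" "0 < length (max_heavy X)" for b
      using that by (cases X; simp add: heavy_factor_def)+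
    have k0: "k 0 m n \<in> scalar_set (heavy_scalars (max_heavy X ! 0))" for m n
      using k[OF \<tau>(3)] unfolding heavy_carrier_iff finite_mats_iff by blast
    have "scalar_set (heavy_scalars (triv_target (heavy_block X))) \<subseteq> scalar_set ComplexScalars"
      using that by (cases X) auto
    then show "?g i j \<in> scalar_set ComplexScalars" for i j
      using fin' unfolding finite_mats_iff by blast
    have T: "heavy_block X = U_to_O \<and> k 0 m n \<in> scalar_set ComplexScalars \<or> heavy_block X = Sp_to_U" for m n
      using \<tau>(1) k0[of m n] by auto
    show "?g (Inr m) (Inl n) = - qconj (?g (Inl m) (Inr n))"
      "?g (Inr m) (Inr n) = qconj (?g (Inl m) (Inl n))" for m n
      using triv_entry_quaternionic[OF T] that
      by (simp_all add: heavy_embed_eq_block_mat block_mat_def heavy_label_def \<tau>(2))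
  qed
  have "classical_identities X ?g"
    using I J one bilin by (cases X) simp_all
  then show ?thesis
    using fin unitary finite_mats_adjoint[OF fin] by (auto simp: classical_group_def GL_mats_def)
qed

lemma heavy_embed_mult:
  assumes k: "\<And>i. i < length (max_heavy X) \<Longrightarrow> k i \<in> carrier (heavy_group (max_heavy X ! i))"
    and k': "\<And>i. i < length (max_heavy X) \<Longrightarrow> k' i \<in> carrier (heavy_group (max_heavy X ! i))"
    and k'': "\<And>i. i < length (max_heavy X) \<Longrightarrow> k'' i = mat_mult (k i) (k' i)"
  shows "heavy_embed X k'' = mat_mult (heavy_embed X k) (heavy_embed X k')"
proof -
  interpret block_structure "heavy_label X" "\<lambda>_. heavy_block X" "length (max_heavy X)"
    by (rule block_structure_heavy)
  show ?thesis
    unfolding heavy_embed_eq_block_mat using assms heavy_block_source(1)[of _ X]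
    by (intro block_mat_mult) (auto simp: matrix_family_def heavy_carrier_iff)
qed


section \<open>Finite permutations\<close>

lemma finite_perm_involution:
  assumes "\<And>x. \<sigma> (\<sigma> x) = x" "finite {x. \<sigma> x \<noteq> x}"
  shows "finite_perm \<sigma>" "inv_into UNIV \<sigma> = \<sigma>"
proof -
  have "\<sigma> \<circ> \<sigma> = id" using assms(1) by auto
  then show "finite_perm \<sigma>" "inv_into UNIV \<sigma> = \<sigma>"
    using assms(2) by (simp_all add: finite_perm_def o_bij inv_unique_comp)
qed

definition block_swap :: "nat \<Rightarrow> nat \<Rightarrow> nat \<Rightarrow> nat \<Rightarrow> nat" where
  "block_swap n a b i = (if a \<le> i \<and> i < a + n then i - a + b
     else if b \<le> i \<and> i < b + n then i - b + a else i)"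

lemma finite_perm_block_swap:
  assumes "a + n \<le> b"
  shows "block_swap n a b (block_swap n a b i) = i" "finite_perm (block_swap n a b)"
proof -
  show inv: "block_swap n a b (block_swap n a b i) = i" for i
    using assms by (auto simp: block_swap_def)
  have "{x. block_swap n a b x \<noteq> x} \<subseteq> {..<b + n}"
    using assms by (auto simp: block_swap_def split: if_splits)
  then show "finite_perm (block_swap n a b)"
    using inv by (intro finite_perm_involution) (auto intro: finite_subset)
qed

lemma half_swap_involution: "half_swap m (half_swap m i) = i"
  by (auto simp: half_swap_def)

lemma half_swap_eq_block_swap: "half_swap m = block_swap m 0 m"
  by (auto simp: half_swap_def block_swap_def fun_eq_iff)

lemma finite_perm_half_swap: "finite_perm (half_swap m)"
  unfolding half_swap_eq_block_swap by (rule finite_perm_block_swap) simp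

text \<open>The second chain of images is \<open>i \<mapsto> m'' + i \<mapsto> m + i \<mapsto> i\<close>; in the third, \<open>i\<close> goes to \<open>m' + i\<close>, which
lies between the two interchanged blocks, and back.\<close>

lemma swaps_fix_initial_segment:
  assumes "i < n" "n \<le> m"
  shows "m \<le> m'' \<Longrightarrow> block_swap n m m'' i = i"
    and "m + n \<le> m'' \<Longrightarrow> half_swap m (block_swap n m m'' (half_swap m'' i)) = i"
    and "m + n \<le> m' \<Longrightarrow> m' + n \<le> m'' \<Longrightarrow> half_swap m' (block_swap n m m'' (half_swap m' i)) = i"
  using assms by (simp_all add: block_swap_def half_swap_def)

text \<open>With \<open>A = {..<N}\<close>, the sets \<open>A\<close> and \<open>f ` A\<close> are equinumerous, hence so are the remainders
\<open>f ` A - A\<close> and \<open>A - f ` A\<close>; a bijection between the remainders completes \<open>f\<close> to a permutation of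
\<open>A \<union> f ` A\<close>.\<close>

lemma finite_perm_extends:
  fixes f :: "nat \<Rightarrow> nat"
  assumes "inj f"
  obtains \<sigma> where "finite_perm \<sigma>" "\<And>i. i < N \<Longrightarrow> \<sigma> i = f i"
proof -
  let ?A = "{..<N}" and ?B = "f ` {..<N}"
  have card: "card ?A = card ?B"
    using assms by (simp add: card_image inj_on_subset)
  have "card (?B - ?A) = card (?A - ?B)"
    using card_Diff_subset_Int[of ?A ?B] card_Diff_subset_Int[of ?B ?A] card by (simp add: Int_commute)
  then obtain h where h: "bij_betw h (?B - ?A) (?A - ?B)"
    using finite_same_card_bij[of "?B - ?A" "?A - ?B"] by blast
  define \<sigma> where "\<sigma> x = (if x \<in> ?A then f x else if x \<in> ?B then h x else x)" for x
  have 1: "bij_betw \<sigma> ?A ?B"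
    using assms by (auto simp: bij_betw_def \<sigma>_def inj_on_def inj_eq[OF assms])
  have 2: "bij_betw \<sigma> (?B - ?A) (?A - ?B)"
    by (rule bij_betw_cong[THEN iffD1, OF _ h]) (auto simp: \<sigma>_def)
  have 3: "bij_betw \<sigma> (- (?A \<union> ?B)) (- (?A \<union> ?B))"
    by (rule bij_betw_cong[THEN iffD1, OF _ bij_betw_id]) (auto simp: \<sigma>_def)
  have "bij_betw \<sigma> (?A \<union> (?B - ?A)) (?B \<union> (?A - ?B))"
    using 1 2 by (rule bij_betw_combine) auto
  then have "bij_betw \<sigma> ((?A \<union> (?B - ?A)) \<union> - (?A \<union> ?B)) ((?B \<union> (?A - ?B)) \<union> - (?A \<union> ?B))"
    using 3 by (rule bij_betw_combine) auto
  moreover have "(?A \<union> (?B - ?A)) \<union> - (?A \<union> ?B) = UNIV" "(?B \<union> (?A - ?B)) \<union> - (?A \<union> ?B) = UNIV"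
    by auto
  ultimately have "bij \<sigma>" by simp
  moreover have "{x. \<sigma> x \<noteq> x} \<subseteq> ?A \<union> ?B"
    by (auto simp: \<sigma>_def)
  ultimately have "finite_perm \<sigma>"
    unfolding finite_perm_def by (auto intro: finite_subset[of _ "?A \<union> ?B"])
  then show ?thesis
    by (rule that) (simp add: \<sigma>_def)
qed

text \<open>The permutation \<open>\<omega> \<sigma> \<omega>\<^sup>-\<^sup>1\<close> of the range of \<open>\<omega>\<close>, extended by the identity.\<close>

definition transport :: "(nat \<Rightarrow> nat) \<Rightarrow> (nat \<Rightarrow> nat) \<Rightarrow> nat \<Rightarrow> nat" where
  "transport \<omega> \<sigma> x = (if x \<in> range \<omega> then \<omega> (\<sigma> (inv_into UNIV \<omega> x)) else x)"

lemma transport_range: "inj \<omega> \<Longrightarrow> transport \<omega> \<sigma> (\<omega> i) = \<omega> (\<sigma> i)"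
  by (simp add: transport_def)

lemma transport_outside: "x \<notin> range \<omega> \<Longrightarrow> transport \<omega> \<sigma> x = x"
  by (simp add: transport_def)

lemma transport_comp:
  assumes "inj \<omega>"
  shows "transport \<omega> \<sigma> \<circ> transport \<omega> \<tau> = transport \<omega> (\<sigma> \<circ> \<tau>)"
proof
  fix x show "(transport \<omega> \<sigma> \<circ> transport \<omega> \<tau>) x = transport \<omega> (\<sigma> \<circ> \<tau>) x"
    by (cases "x \<in> range \<omega>") (auto simp: transport_range[OF assms] transport_outside)
qed

lemma transport_id: "transport \<omega> id = id"
  by (auto simp: transport_def f_inv_into_f fun_eq_iff)

lemma finite_perm_transport:
  assumes \<omega>: "inj \<omega>" and \<sigma>: "finite_perm \<sigma>"
  shows "finite_perm (transport \<omega> \<sigma>)"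
proof -
  have "inv_into UNIV \<sigma> \<circ> \<sigma> = id" "\<sigma> \<circ> inv_into UNIV \<sigma> = id"
    using \<sigma> by (simp_all add: finite_perm_def bij_is_inj bij_is_surj surj_iff[symmetric])
  then have "transport \<omega> (inv_into UNIV \<sigma>) \<circ> transport \<omega> \<sigma> = id"
    "transport \<omega> \<sigma> \<circ> transport \<omega> (inv_into UNIV \<sigma>) = id"
    by (simp_all add: transport_comp[OF \<omega>] transport_id)
  then have "bij (transport \<omega> \<sigma>)"
    by (rule o_bij)
  moreover have "{x. transport \<omega> \<sigma> x \<noteq> x} \<subseteq> \<omega> ` {i. \<sigma> i \<noteq> i}"
    using \<omega> by (auto simp: transport_def split: if_splits)
  ultimately show ?thesis
    using \<sigma> unfolding finite_perm_def by (meson finite_imageI finite_subset)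
qed

lemma transport_half_swap_involution:
  assumes "inj \<omega>"
  shows "transport \<omega> (half_swap m) \<circ> transport \<omega> (half_swap m) = id"
proof -
  have "half_swap m \<circ> half_swap m = id"
    by (auto simp: half_swap_involution)
  then show ?thesis
    by (simp add: transport_comp[OF assms] transport_id)
qed

lemma theta_mat_eq_perm_mat:
  assumes "inj \<omega>"
  shows "theta_mat \<omega> m = perm_mat (transport \<omega> (half_swap m))"
proof (intro ext)
  fix x y
  show "theta_mat \<omega> m x y = perm_mat (transport \<omega> (half_swap m)) x y"
    using assms by (cases "y \<in> range \<omega>") (auto simp: theta_mat_def perm_mat_def transport_def inj_eq)
qed

lemma perm_mat_inject: "perm_mat \<sigma> = perm_mat \<tau> \<longleftrightarrow> \<sigma> = \<tau>"
proof
  assume "perm_mat \<sigma> = perm_mat \<tau>"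
  then have eq: "perm_mat \<tau> (\<sigma> y) y = perm_mat \<sigma> (\<sigma> y) y" for y by simp
  have "\<sigma> y = \<tau> y" for y
    using eq[of y] by (simp add: perm_mat_def split: if_splits)
  then show "\<sigma> = \<tau>" by blast
qed simp

text \<open>The \<open>x\<close>-th row of \<open>g\<^sup>*\<close> is that of the identity, so the \<open>x\<close>-th row of \<open>g\<^sup>* g = 1\<close> is that of \<open>g\<close>.\<close>

lemma heavy_fixes_row:
  assumes "g \<in> carrier (heavy_group k)" "fixes_vec g x"
  shows "g x y = mat_one x y"
proof -
  have "mat_mult (mat_adjoint g) g x y = g x y"
    using assms(2) by (intro mat_mult_trivial_row) (auto simp: mat_adjoint_def fixes_vec_def mat_one_def)
  then show ?thesis
    using assms(1) by (simp add: heavy_carrier_iff)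
qed


section \<open>The embedding of the heavy group\<close>

lemma classical_product_carrier:
  "g \<in> carrier (classical_product Gs) \<longleftrightarrow>
    (\<forall>r<length Gs. g r \<in> carrier (classical_group (Gs ! r))) \<and> g \<in> extensional {..<length Gs}"
  by (auto simp: classical_product_def PiE_def)

lemma classical_product_mult:
  "r < length Gs \<Longrightarrow> (g \<otimes>\<^bsub>classical_product Gs\<^esub> h) r = mat_mult (g r) (h r)"
  by (simp add: classical_product_def classical_group_def)

lemma classical_product_eqI:
  assumes "g \<in> carrier (classical_product Gs)" "h \<in> carrier (classical_product Gs)"
    "\<And>r b b'. r < length Gs \<Longrightarrow> g r b b' = h r b b'"
  shows "g = h"
  using assms by (intro extensionalityI[of g "{..<length Gs}" h]) (auto simp: classical_product_carrier fun_eq_iff)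

lemma classical_product_finite:
  assumes "g \<in> carrier (classical_product Gs)" "r < length Gs"
  shows "g r \<in> finite_mats (classical_scalars (Gs ! r)) (basis (Gs ! r))"
  using assms by (auto simp: classical_product_carrier classical_group_def GL_mats_def)

lemma heavy_product_carrier:
  "l \<in> carrier (heavy_product Ls) \<longleftrightarrow>
    (\<forall>j<length Ls. l j \<in> carrier (heavy_group (Ls ! j))) \<and> l \<in> extensional {..<length Ls}"
  by (auto simp: heavy_product_def PiE_def)

lemma heavy_product_mult:
  "j < length Ls \<Longrightarrow> (l \<otimes>\<^bsub>heavy_product Ls\<^esub> l') j = mat_mult (l j) (l' j)"
  by (simp add: heavy_product_def)

locale straight_embedding =
  fixes Gs :: "classical list" and Ls :: "heavy list" and sd :: "nat \<Rightarrow> nat \<Rightarrow> straight_data"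
  assumes straight: "\<And>r i. r < length Gs \<Longrightarrow> i < length (max_heavy (Gs ! r)) \<Longrightarrow>
    straight Ls (max_heavy (Gs ! r) ! i) (sd r i)"
begin

abbreviation "G \<equiv> classical_product Gs"
abbreviation "L \<equiv> heavy_product Ls"
abbreviation "p \<equiv> length Ls"
abbreviation "E \<equiv> pair_embed Gs sd"
abbreviation mult_G (infixl "\<cdot>" 70) where "g \<cdot> h \<equiv> g \<otimes>\<^bsub>G\<^esub> h"
abbreviation mult_L (infixl "\<star>" 70) where "l \<star> l' \<equiv> l \<otimes>\<^bsub>L\<^esub> l'"

sublocale G: group G
  by (rule group_classical_product)

sublocale L: group L
  by (rule group_heavy_product)

lemma E_apply: "r < length Gs \<Longrightarrow> E l r = heavy_embed (Gs ! r) (\<lambda>i. straight_hom (sd r i) l)"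
  by (simp add: pair_embed_def)

lemma E_carrier: "l \<in> carrier L \<Longrightarrow> E l \<in> carrier G"
  using straight_hom_carrier[OF straight]
  by (auto simp: classical_product_carrier E_apply pair_embed_def intro!: heavy_embed_carrier)

lemma E_mult:
  assumes "l \<in> carrier L" "l' \<in> carrier L"
  shows "E (l \<star> l') = E l \<cdot> E l'"
proof (rule classical_product_eqI)
  fix r b b' assume r: "r < length Gs"
  have "E (l \<star> l') r = mat_mult (E l r) (E l' r)"
    using assms straight_hom_carrier[OF straight[OF r]] straight_hom_mult[OF straight[OF r]]
    by (simp only: E_apply[OF r]) (rule heavy_embed_mult)
  then show "E (l \<star> l') r b b' = (E l \<cdot> E l') r b b'"
    by (simp add: classical_product_mult[OF r])
qed (use assms E_carrier in auto)

sublocale E: group_hom L G E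
  by unfold_locales (auto simp: hom_def E_carrier E_mult)

text \<open>The label of a basis vector tells which basis vector of which factor of \<open>L\<close> it is a copy of;
  the vectors fixed by \<open>L\<close> have none.\<close>

definition label :: "nat \<Rightarrow> nat + nat \<Rightarrow> (nat \<times> nat) option" where
  "label r b = (case heavy_label (Gs ! r) b of None \<Rightarrow> None
     | Some (i, s, u) \<Rightarrow> (case straight_label (sd r i) u of None \<Rightarrow> None
       | Some (c, s', n) \<Rightarrow> Some (fst (blocks (sd r i) ! c), n)))"

lemma heavy_label_Some:
  assumes "heavy_label X b = Some (i, s, u)"
  shows "i = heavy_factor X b" "u = position b" "i < length (max_heavy X)"
proof -
  show "i = heavy_factor X b" "u = position b"
    using assms by (auto simp: heavy_label_def split: if_splits)
  interpret block_structure "heavy_label X" "\<lambda>_. heavy_block X" "length (max_heavy X)"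
    by (rule block_structure_heavy)
  show "i < length (max_heavy X)"
    using lab_bounds[OF assms] by blast
qed

lemma label_SomeE:
  assumes "label r b = Some (j, n)"
  obtains s c s' where "heavy_label (Gs ! r) b = Some (heavy_factor (Gs ! r) b, s, position b)"
    "straight_label (sd r (heavy_factor (Gs ! r) b)) (position b) = Some (c, s', n)"
    "j = fst (blocks (sd r (heavy_factor (Gs ! r) b)) ! c)"
proof -
  obtain i s u where h: "heavy_label (Gs ! r) b = Some (i, s, u)"
    using assms by (auto simp: label_def split: option.splits prod.splits)
  note iu = heavy_label_Some[OF h]
  show ?thesis
    using assms that h iu(1,2) by (auto simp: label_def split: option.splits prod.splits)
qed

lemma straight_at:
  assumes "r < length Gs" "heavy_label (Gs ! r) b \<noteq> None"
  shows "straight Ls (max_heavy (Gs ! r) ! heavy_factor (Gs ! r) b) (sd r (heavy_factor (Gs ! r) b))"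
  using assms straight heavy_label_Some by (metis not_None_eq prod_cases3)

lemma label_less: "r < length Gs \<Longrightarrow> label r b = Some (j, n) \<Longrightarrow> j < p"
  using straight_at[of r b] straight_block(1)
    block_structure.lab_bounds[OF block_structure_straight[OF straight_at[of r b]]]
  by (elim label_SomeE) (metis option.distinct(1))

lemma label_basis: "label r b \<noteq> None \<Longrightarrow> b \<in> basis (Gs ! r)"
  using heavy_label_basis[of "Gs ! r" b] by (auto simp: label_def split: option.splits)

text \<open>Both steps of the embedding, into the maximal heavy subgroup and from there into \<open>G\<close>, replace entries
by blocks. All statements about the supports of elements of \<open>L\<close> rest on this.\<close>

lemma E_local:
  assumes r: "r < length Gs"
    and l: "\<And>j n n'. label r b = Some (j, n) \<Longrightarrow> label r b' = Some (j, n') \<Longrightarrow> l j n n' = mat_one n n'"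
  shows "E l r b b' = mat_one b b'"
  unfolding E_apply[OF r] heavy_embed_eq_block_mat
proof (rule block_structure.block_mat_local[OF block_structure_heavy])
  fix i s u s' u'
  assume b: "heavy_label (Gs ! r) b = Some (i, s, u)" "heavy_label (Gs ! r) b' = Some (i, s', u')"
  have st: "straight Ls (max_heavy (Gs ! r) ! i) (sd r i)"
    using heavy_label_Some(3)[OF b(1)] by (rule straight[OF r])
  show "straight_hom (sd r i) l u u' = mat_one u u'"
    unfolding straight_hom_eq_block_mat[OF st]
    using b l by (intro block_structure.block_mat_local[OF block_structure_straight[OF st]])
      (auto simp: label_def)
qed


subsection \<open>Permutations\<close>

definition perms :: "(nat \<Rightarrow> nat \<Rightarrow> nat) \<Rightarrow> nat \<Rightarrow> nat mat" where
  "perms \<sigma> = (\<lambda>j\<in>{..<p}. perm_mat (\<sigma> j))"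

definition finite_perms :: "(nat \<Rightarrow> nat \<Rightarrow> nat) \<Rightarrow> bool" where
  "finite_perms \<sigma> \<longleftrightarrow> (\<forall>j<p. finite_perm (\<sigma> j))"

abbreviation inverses :: "(nat \<Rightarrow> nat \<Rightarrow> nat) \<Rightarrow> nat \<Rightarrow> nat \<Rightarrow> nat" where
  "inverses \<sigma> \<equiv> (\<lambda>j. inv_into UNIV (\<sigma> j))"

lemma perms_carrier: "finite_perms \<sigma> \<Longrightarrow> perms \<sigma> \<in> carrier L"
  by (auto simp: heavy_product_carrier perms_def finite_perms_def perm_mat_heavy)

lemma perms_mult: "perms \<sigma> \<star> perms \<tau> = perms (\<lambda>j. \<sigma> j \<circ> \<tau> j)"
  by (auto simp: heavy_product_def perms_def perm_mat_comp fun_eq_iff)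

lemma perms_cong: "(\<And>j. j < p \<Longrightarrow> \<sigma> j = \<tau> j) \<Longrightarrow> perms \<sigma> = perms \<tau>"
  unfolding perms_def by (rule restrict_ext) simp

lemma perms_one: "perms (\<lambda>_. id) = \<one>\<^bsub>L\<^esub>"
  by (auto simp: heavy_product_def perms_def perm_mat_id)

lemma finite_perms_inverses: "finite_perms \<sigma> \<Longrightarrow> finite_perms (inverses \<sigma>)"
  by (simp add: finite_perms_def finite_perm_inv)

lemma inverse_comp:
  "finite_perms \<sigma> \<Longrightarrow> j < p \<Longrightarrow> inv_into UNIV (\<sigma> j) \<circ> \<sigma> j = id"
  "finite_perms \<sigma> \<Longrightarrow> j < p \<Longrightarrow> \<sigma> j \<circ> inv_into UNIV (\<sigma> j) = id"
  by (simp_all add: finite_perms_def finite_perm_def bij_is_inj bij_is_surj surj_iff[symmetric])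

lemma perms_inverses:
  assumes "finite_perms \<sigma>"
  shows "perms \<sigma> \<star> perms (inverses \<sigma>) = \<one>\<^bsub>L\<^esub>" "perms (inverses \<sigma>) \<star> perms \<sigma> = \<one>\<^bsub>L\<^esub>"
  unfolding perms_mult perms_one[symmetric] using inverse_comp[OF assms] by (auto intro!: perms_cong)

text \<open>The permutation of the basis of \<open>G\<close> by which the permutation matrices \<open>\<sigma>\<close> of \<open>L\<close> act. It is the
relabelling along \<open>\<sigma>\<close>, except on the vectors outside the space of the maximal heavy subgroup, which
\<open>L\<close> fixes.\<close>

definition move :: "(nat \<Rightarrow> nat \<Rightarrow> nat) \<Rightarrow> nat \<Rightarrow> nat + nat \<Rightarrow> nat + nat" where
  "move \<sigma> r b = (if heavy_label (Gs ! r) b = None then b else relabel Gs sd \<sigma> r b)"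

lemma relabel_simps:
  "side (relabel Gs sd \<sigma> r b) = side b"
  "position (relabel Gs sd \<sigma> r b) = relabel_index \<sigma> (sd r (heavy_factor (Gs ! r) b)) (position b)"
  "heavy_factor X (relabel Gs sd \<sigma> r b) = heavy_factor X b"
  by (cases b; simp add: relabel_def heavy_factor_def)+

lemma heavy_label_relabel:
  "heavy_label X b = Some (i, s, u) \<Longrightarrow>
    heavy_label X (relabel Gs sd \<sigma> r b) = Some (i, s, position (relabel Gs sd \<sigma> r b))"
  by (auto simp: heavy_label_def relabel_simps split: if_splits)

lemma straight_label_relabel_index:
  assumes "straight Ls k d"
  shows "straight_label d u = Some (c, s, n) \<Longrightarrow>
      straight_label d (relabel_index \<omega> d u) = Some (c, s, \<omega> (fst (blocks d ! c)) n)"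
    and "straight_label d u = None \<Longrightarrow> relabel_index \<omega> d u = u"
proof -
  show "straight_label d u = Some (c, s, n) \<Longrightarrow>
      straight_label d (relabel_index \<omega> d u) = Some (c, s, \<omega> (fst (blocks d ! c)) n)"
    using slot_relabel_index[OF assms, of \<omega> u] by (simp add: straight_label_Some)
  assume "straight_label d u = None"
  then show "relabel_index \<omega> d u = u"
    using slot_relabel_index[OF assms, of \<omega> u]
    by (intro straight_inj[OF assms]) (auto simp: straight_label_def split: slot.splits)
qed

lemma label_relabel:
  assumes r: "r < length Gs" and b: "label r b = Some (j, n)"
  shows "label r (relabel Gs sd \<omega> r b) = Some (j, \<omega> j n)"
proof -
  obtain s c s' where h: "heavy_label (Gs ! r) b = Some (heavy_factor (Gs ! r) b, s, position b)"
    and l: "straight_label (sd r (heavy_factor (Gs ! r) b)) (position b) = Some (c, s', n)"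
    and j: "j = fst (blocks (sd r (heavy_factor (Gs ! r) b)) ! c)"
    using b by (rule label_SomeE)
  show ?thesis
    using straight_label_relabel_index(1)[OF straight_at[OF r, of b] l] h heavy_label_relabel[OF h]
    by (simp add: label_def relabel_simps j)
qed

text \<open>A vector is determined by its side and its slot, and relabelling keeps the side and the block while
it applies \<open>\<omega>\<^sub>j\<close> to the index in the block.\<close>

lemma relabel_inj:
  assumes r: "r < length Gs" and b: "label r b = Some (j, n)" and b': "label r b' = Some (j', n')"
    and \<omega>: "\<And>j. j < p \<Longrightarrow> inj (\<omega> j)"
    and eq: "relabel Gs sd \<omega> r b = relabel Gs sd \<omega> r b'"
  shows "b = b'"
proof -
  let ?i = "heavy_factor (Gs ! r) b" and ?i' = "heavy_factor (Gs ! r) b'"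
  have side: "side b = side b'" and i: "?i' = ?i"
    using arg_cong[OF eq, of side] arg_cong[OF eq, of "heavy_factor (Gs ! r)"] by (simp_all add: relabel_simps)
  obtain s c t where h: "heavy_label (Gs ! r) b = Some (?i, s, position b)"
    and l: "straight_label (sd r ?i) (position b) = Some (c, t, n)"
    and j: "j = fst (blocks (sd r ?i) ! c)"
    using b by (rule label_SomeE)
  obtain s' c' t' where l': "straight_label (sd r ?i) (position b') = Some (c', t', n')"
    using b' unfolding i[symmetric] by (rule label_SomeE)
  have st: "straight Ls (max_heavy (Gs ! r) ! ?i) (sd r ?i)"
    using straight_at[OF r] h by simp
  have "relabel_index \<omega> (sd r ?i) (position b) = relabel_index \<omega> (sd r ?i) (position b')"
    using arg_cong[OF eq, of position] by (simp add: relabel_simps i)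
  then have "c = c'" "t = t'" "\<omega> j n = \<omega> j n'"
    using straight_label_relabel_index(1)[OF st l, of \<omega>] straight_label_relabel_index(1)[OF st l', of \<omega>]
    by (auto simp: j)
  then have "straight_label (sd r ?i) (position b') = Some (c, t, n)"
    using l' inj_eq[OF \<omega>[OF label_less[OF r b]], of n n'] by simp
  then have "position b = position b'"
    using straight_inj[OF st] l by (metis straight_label_Some)
  with side show ?thesis
    by (rule side_position_inj)
qed

lemma relabel_cong:
  assumes "label r b = Some (j, n)" "\<sigma> j n = \<omega> j n"
  shows "relabel Gs sd \<sigma> r b = relabel Gs sd \<omega> r b"
proof (rule side_position_inj)
  obtain s c s' where
    "straight_label (sd r (heavy_factor (Gs ! r) b)) (position b) = Some (c, s', n)"
    "j = fst (blocks (sd r (heavy_factor (Gs ! r) b)) ! c)"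
    using assms(1) by (rule label_SomeE)
  then show "position (relabel Gs sd \<sigma> r b) = position (relabel Gs sd \<omega> r b)"
    using assms(2) by (simp add: relabel_simps relabel_index_def straight_label_Some)
qed (simp add: relabel_simps)

lemma label_move:
  assumes r: "r < length Gs"
  shows "label r (move \<sigma> r b) = map_option (\<lambda>(j, n). (j, \<sigma> j n)) (label r b)"
proof (cases "label r b")
  case (Some x)
  then obtain j n where b: "label r b = Some (j, n)" by (cases x) auto
  then have "heavy_label (Gs ! r) b \<noteq> None"
    by (auto simp: label_def split: option.splits)
  then show ?thesis
    using label_relabel[OF r b, of \<sigma>] b by (auto simp: move_def)
next
  case None
  have "move \<sigma> r b = b"
  proof (cases "heavy_label (Gs ! r) b")
    case (Some x)
    then obtain i s u where h: "heavy_label (Gs ! r) b = Some (i, s, u)" by (cases x) auto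
    note iu = heavy_label_Some[OF h]
    have "straight_label (sd r (heavy_factor (Gs ! r) b)) (position b) = None"
      using None h iu by (auto simp: label_def split: option.splits)
    then have "relabel Gs sd \<sigma> r b = b"
      using straight_label_relabel_index(2)[OF straight_at[OF r, of b]] h
      by (intro side_position_inj) (auto simp: relabel_simps)
    then show ?thesis by (simp add: move_def)
  qed (simp add: move_def)
  then show ?thesis using None by simp
qed

lemma E_perms:
  assumes r: "r < length Gs"
  shows "E (perms \<sigma>) r = perm_mat (move \<sigma> r)"
  unfolding E_apply[OF r] heavy_embed_eq_block_mat
proof (rule block_structure.block_mat_perm[OF block_structure_heavy,
      of _ _ "\<lambda>i. relabel_index \<sigma> (sd r i)"])
  fix i assume i: "i < length (max_heavy (Gs ! r))"
  show "straight_hom (sd r i) (perms \<sigma>) = perm_mat (relabel_index \<sigma> (sd r i))"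
    by (rule straight_hom_perm[OF straight[OF r i]]) (simp add: perms_def)
next
  fix b i s n assume "heavy_label (Gs ! r) b = Some (i, s, n)"
  then show "heavy_label (Gs ! r) (move \<sigma> r b) = Some (i, s, relabel_index \<sigma> (sd r i) n)"
    using heavy_label_relabel[of "Gs ! r" b i s n \<sigma> r] heavy_label_Some[of "Gs ! r" b i s n]
    by (simp add: move_def relabel_simps)
qed (simp add: move_def)

text \<open>Inherited from the group law: the two permutation matrices of \<open>L\<close> are inverse to each other, and a
permutation matrix determines its permutation.\<close>

lemma move_inverses:
  assumes "finite_perms \<sigma>" "r < length Gs"
  shows "move \<sigma> r (move (inverses \<sigma>) r b) = b" "move (inverses \<sigma>) r (move \<sigma> r b) = b"
proof -
  have one: "mat_mult (E (perms \<sigma>) r) (E (perms \<tau>) r) = mat_one"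
    if "finite_perms \<sigma>" "finite_perms \<tau>" "perms \<sigma> \<star> perms \<tau> = \<one>\<^bsub>L\<^esub>" for \<sigma> \<tau>
  proof -
    have "E (perms \<sigma>) \<cdot> E (perms \<tau>) = \<one>\<^bsub>G\<^esub>"
      using that by (simp add: E_mult[symmetric] perms_carrier)
    then have "(E (perms \<sigma>) \<cdot> E (perms \<tau>)) r = mat_one"
      using assms(2) by (simp add: classical_product_def classical_group_def)
    then show ?thesis
      by (simp add: classical_product_mult[OF assms(2)])
  qed
  have "move \<sigma> r \<circ> move (inverses \<sigma>) r = id" "move (inverses \<sigma>) r \<circ> move \<sigma> r = id"
    using one[OF _ _ perms_inverses(1)] one[OF _ _ perms_inverses(2)] assms finite_perms_inverses
    by (simp_all add: E_perms perm_mat_comp perm_mat_id(1)[symmetric] perm_mat_inject)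
  then show "move \<sigma> r (move (inverses \<sigma>) r b) = b" "move (inverses \<sigma>) r (move \<sigma> r b) = b"
    by (metis comp_apply id_apply)+
qed

definition conj_perms :: "(nat \<Rightarrow> nat \<Rightarrow> nat) \<Rightarrow> (nat \<Rightarrow> (nat + nat) mat) \<Rightarrow> nat \<Rightarrow> (nat + nat) mat" where
  "conj_perms \<sigma> g = E (perms \<sigma>) \<cdot> g \<cdot> E (perms (inverses \<sigma>))"

lemma conj_perms_carrier: "finite_perms \<sigma> \<Longrightarrow> g \<in> carrier G \<Longrightarrow> conj_perms \<sigma> g \<in> carrier G"
  by (simp add: conj_perms_def perms_carrier finite_perms_inverses)

lemma conj_perms_mult:
  assumes "finite_perms \<sigma>" "g \<in> carrier G" "h \<in> carrier G"
  shows "conj_perms \<sigma> (g \<cdot> h) = conj_perms \<sigma> g \<cdot> conj_perms \<sigma> h"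
proof -
  have c: "E (perms \<sigma>) \<in> carrier G" "E (perms (inverses \<sigma>)) \<in> carrier G"
    using assms by (simp_all add: perms_carrier finite_perms_inverses)
  have "E (perms (inverses \<sigma>)) \<cdot> E (perms \<sigma>) = \<one>\<^bsub>G\<^esub>"
    using assms by (simp add: E_mult[symmetric] perms_carrier finite_perms_inverses perms_inverses)
  then have "E (perms (inverses \<sigma>)) \<cdot> (E (perms \<sigma>) \<cdot> x) = x" if "x \<in> carrier G" for x
    using that c by (simp add: G.m_assoc[symmetric])
  then show ?thesis
    using assms c by (simp add: conj_perms_def G.m_assoc)
qed

lemma conj_perms_apply:
  assumes \<sigma>: "finite_perms \<sigma>" and r: "r < length Gs"
  shows "conj_perms \<sigma> g r (move \<sigma> r b) (move \<sigma> r b') = g r b b'"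
proof -
  have bij: "bij (move \<sigma> r)"
    using move_inverses[OF \<sigma> r] by (intro o_bij[of "move (inverses \<sigma>) r"]) auto
  have "conj_perms \<sigma> g r = mat_mult (mat_mult (perm_mat (move \<sigma> r)) (g r)) (perm_mat (move (inverses \<sigma>) r))"
    by (simp add: conj_perms_def classical_product_mult[OF r] E_perms[OF r])
  then show ?thesis
    using bij by (simp add: mult_perm_mat perm_mat_mult move_inverses[OF \<sigma> r] bij_is_inj)
qed

lemma conj_perms_inject:
  assumes "finite_perms \<sigma>" "g \<in> carrier G" "h \<in> carrier G" "conj_perms \<sigma> g = conj_perms \<sigma> h"
  shows "g = h"
proof (rule classical_product_eqI)
  fix r b b' assume "r < length Gs"
  then show "g r b b' = h r b b'"
    using conj_perms_apply[OF assms(1), of r g b b'] conj_perms_apply[OF assms(1), of r h b b'] assms(4)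
    by simp
qed fact+


subsection \<open>Supports in terms of labels\<close>

text \<open>Supports are recorded by labels instead of basis vectors. A set of labels describes the support in
all factors of \<open>G\<close> simultaneously and transforms under permutations of \<open>L\<close> in an obvious way.\<close>

definition label_support :: "(nat \<times> nat) option set \<Rightarrow> (nat \<Rightarrow> (nat + nat) mat) \<Rightarrow> bool" where
  "label_support S g \<longleftrightarrow> (\<forall>r<length Gs. supported_on {b. label r b \<in> S} (g r))"

lemma label_support_mono: "label_support S g \<Longrightarrow> S \<subseteq> S' \<Longrightarrow> label_support S' g"
  unfolding label_support_def by (auto elim!: supported_on_mono)

lemma label_support_Int: "label_support S g \<Longrightarrow> label_support S' g \<Longrightarrow> label_support (S \<inter> S') g"
  unfolding label_support_def supported_on_def by auto

lemma label_support_mult: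
  "label_support S g \<Longrightarrow> label_support S h \<Longrightarrow> label_support S (g \<cdot> h)"
  unfolding label_support_def by (simp add: classical_product_mult supported_on_mult)

lemma label_support_commute:
  assumes "label_support S g" "label_support S' h" "S \<inter> S' = {}" "g \<in> carrier G" "h \<in> carrier G"
  shows "g \<cdot> h = h \<cdot> g"
proof (rule classical_product_eqI)
  fix r b b' assume r: "r < length Gs"
  have "mat_mult (g r) (h r) = mat_mult (h r) (g r)"
    using assms(1-3) r unfolding label_support_def
    by (intro disjoint_supports_commute[of "{b. label r b \<in> S}" _ "{b. label r b \<in> S'}"]) auto
  then show "(g \<cdot> h) r b b' = (h \<cdot> g) r b b'"
    by (simp add: classical_product_mult[OF r])
qed (use assms in auto)

lemma label_support_finite:
  assumes "g \<in> carrier G"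
  obtains S where "finite S" "label_support S g"
proof -
  have "\<forall>r\<in>{..<length Gs}. \<exists>T. finite T \<and> supported_on T (g r)"
    using classical_product_finite[OF assms] unfolding finite_mats_iff by blast
  then obtain T where T: "\<And>r. r < length Gs \<Longrightarrow> finite (T r)" "\<And>r. r < length Gs \<Longrightarrow> supported_on (T r) (g r)"
    by (metis lessThan_iff)
  show ?thesis
  proof (rule that[of "\<Union>r<length Gs. label r ` T r"])
    show "label_support (\<Union>r<length Gs. label r ` T r) g"
      unfolding label_support_def using T(2) by (blast intro: supported_on_mono)
  qed (use T(1) in auto)
qed

lemma label_support_conj_perms:
  assumes \<sigma>: "finite_perms \<sigma>" and g: "label_support S g"
  shows "label_support (map_option (\<lambda>(j, n). (j, \<sigma> j n)) ` S) (conj_perms \<sigma> g)"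
  unfolding label_support_def supported_on_def
proof (intro allI impI)
  fix r b b' assume r: "r < length Gs"
    and b: "b \<notin> {b. label r b \<in> map_option (\<lambda>(j, n). (j, \<sigma> j n)) ` S} \<or>
      b' \<notin> {b. label r b \<in> map_option (\<lambda>(j, n). (j, \<sigma> j n)) ` S}"
  define a a' where "a = move (inverses \<sigma>) r b" and "a' = move (inverses \<sigma>) r b'"
  have a: "b = move \<sigma> r a" "b' = move \<sigma> r a'"
    by (simp_all add: a_def a'_def move_inverses[OF \<sigma> r])
  have "label r a \<notin> S \<or> label r a' \<notin> S"
    using b by (auto simp: a label_move[OF r])
  then have "g r a a' = mat_one a a'"
    using g r by (auto simp: label_support_def supported_on_def)
  moreover have "a = a' \<longleftrightarrow> b = b'"
    by (metis a(1,2) move_inverses(2)[OF \<sigma> r])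
  ultimately show "conj_perms \<sigma> g r b b' = mat_one b b'"
    by (simp add: a conj_perms_apply[OF \<sigma> r] mat_one_def)
qed

lemma label_support_E:
  assumes "\<And>j n n'. j < p \<Longrightarrow> (j, n) \<notin> T \<or> (j, n') \<notin> T \<Longrightarrow> l j n n' = mat_one n n'"
  shows "label_support (Some ` T) (E l)"
  unfolding label_support_def supported_on_def
proof (intro allI impI)
  fix r b b' assume r: "r < length Gs"
    and b: "b \<notin> {b. label r b \<in> Some ` T} \<or> b' \<notin> {b. label r b \<in> Some ` T}"
  show "E l r b b' = mat_one b b'"
  proof (rule E_local[OF r])
    fix j n n' assume l: "label r b = Some (j, n)" "label r b' = Some (j, n')"
    show "l j n n' = mat_one n n'"
      using b l by (intro assms label_less[OF r l(1)]) auto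
  qed
qed


subsection \<open>The groups of elements fixing given basis vectors\<close>

abbreviation "stab \<equiv> heavy_stabilizer Ls"
abbreviation "H \<equiv> L_Xi_image Gs Ls sd"

lemma stabI:
  assumes "l \<in> carrier L" "\<And>j x y. j < p \<Longrightarrow> x \<in> \<Xi> j \<Longrightarrow> l j y x = mat_one y x"
  shows "l \<in> stab \<Xi>"
  using assms by (auto simp: heavy_stabilizer_def fixes_vec_def)

lemma stab_entries:
  assumes "l \<in> stab \<Xi>" "j < p" "x \<in> \<Xi> j \<or> y \<in> \<Xi> j"
  shows "l j y x = mat_one y x"
  using assms heavy_fixes_row[OF heavy_product_component[of l Ls j]]
  by (auto simp: heavy_stabilizer_def fixes_vec_def)

lemma stab_carrier: "l \<in> stab \<Xi> \<Longrightarrow> l \<in> carrier L"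
  by (simp add: heavy_stabilizer_def)

lemma subgroup_stab: "subgroup (stab \<Xi>) L"
proof (rule L.subgroupI)
  show "stab \<Xi> \<subseteq> carrier L"
    by (auto simp: heavy_stabilizer_def)
  have "\<one>\<^bsub>L\<^esub> \<in> stab \<Xi>"
    using L.one_closed by (rule stabI) (simp add: heavy_product_def)
  then show "stab \<Xi> \<noteq> {}" by blast
next
  fix l assume l: "l \<in> stab \<Xi>"
  have inv: "(inv\<^bsub>L\<^esub> l) j = mat_adjoint (l j)" if "j < p" for j
    using that stab_carrier[OF l]
    by (simp add: heavy_product_def group_heavy_group inv_heavy_group PiE_iff)
  show "inv\<^bsub>L\<^esub> l \<in> stab \<Xi>"
  proof (rule stabI)
    fix j x y assume j: "j < p" and x: "x \<in> \<Xi> j"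
    then have "l j x y = mat_one x y"
      using stab_entries[OF l] by blast
    then show "(inv\<^bsub>L\<^esub> l) j y x = mat_one y x"
      by (simp add: inv[OF j] mat_adjoint_def mat_one_def eq_commute)
  qed (use stab_carrier[OF l] in simp)
next
  fix l l' assume l: "l \<in> stab \<Xi>" "l' \<in> stab \<Xi>"
  show "l \<star> l' \<in> stab \<Xi>"
  proof (rule stabI)
    fix j x y assume j: "j < p" and x: "x \<in> \<Xi> j"
    have "mat_mult (l j) (l' j) y x = l j y x"
      using stab_entries[OF l(2) j] x by (intro mat_mult_trivial_column) auto
    then show "(l \<star> l') j y x = mat_one y x"
      using stab_entries[OF l(1) j] x by (simp add: heavy_product_mult[OF j])
  qed (use stab_carrier l in simp)
qed

lemma subgroup_H: "subgroup (H \<Xi>) G"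
  unfolding L_Xi_image_def by (rule E.subgroup_img_is_subgroup[OF subgroup_stab])

lemma H_E: "x \<in> H \<Xi> \<longleftrightarrow> (\<exists>l\<in>stab \<Xi>. x = E l)"
  by (auto simp: L_Xi_image_def)

lemma H_antimono: "(\<And>j. j < p \<Longrightarrow> \<Xi>' j \<subseteq> \<Xi> j) \<Longrightarrow> H \<Xi> \<subseteq> H \<Xi>'"
  unfolding L_Xi_image_def heavy_stabilizer_def by blast

lemma label_support_stab:
  assumes "l \<in> stab \<Xi>"
  shows "label_support (Some ` {(j, n). j < p \<and> n \<notin> \<Xi> j}) (E l)"
  using stab_entries[OF assms] by (intro label_support_E) auto

lemma L_image_eq: "L_image Gs Ls sd = H (\<lambda>_. {})"
  by (simp add: L_image_def L_Xi_image_def heavy_stabilizer_def)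

lemma theta_image_eq:
  assumes "\<And>j. j < p \<Longrightarrow> inj (\<omega> j)"
  shows "theta_image Gs Ls sd \<omega> m = E (perms (\<lambda>j. transport (\<omega> j) (half_swap (m j))))"
proof -
  have "theta p \<omega> m = perms (\<lambda>j. transport (\<omega> j) (half_swap (m j)))"
    unfolding theta_def perms_def using assms by (intro restrict_ext) (simp add: theta_mat_eq_perm_mat)
  then show ?thesis
    by (simp add: theta_image_def)
qed

text \<open>Images of \<open>L\<close> are trivial at unlabelled vectors, while a labelled vector is moved by the transposition
of the index in its label with the next one.\<close>

lemma fixed_basis_L:
  assumes r: "r < length Gs"
  shows "fixed_basis Gs (L_image Gs Ls sd) r = {b \<in> basis (Gs ! r). label r b = None}"
proof -
  have "fixes_vec (E l r) b" if "label r b = None" for l b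
    using that by (auto simp: fixes_vec_def intro!: E_local[OF r])
  moreover have "\<exists>l\<in>carrier L. \<not> fixes_vec (E l r) b" if b: "label r b = Some (j, n)" for b j n
  proof -
    define \<sigma> where "\<sigma> i = block_swap 1 n (Suc n)" for i :: nat
    have \<sigma>: "finite_perms \<sigma>"
      unfolding finite_perms_def \<sigma>_def by (simp add: finite_perm_block_swap)
    have "label r (move \<sigma> r b) \<noteq> label r b"
      by (simp add: label_move[OF r] b \<sigma>_def block_swap_def)
    then have "move \<sigma> r b \<noteq> b" by metis
    then have "E (perms \<sigma>) r (move \<sigma> r b) b \<noteq> mat_one (move \<sigma> r b) b"
      by (simp add: E_perms[OF r] perm_mat_def mat_one_def)
    then show ?thesis
      using perms_carrier[OF \<sigma>] by (auto simp: fixes_vec_def)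
  qed
  ultimately have "(\<forall>l\<in>carrier L. fixes_vec (E l r) b) \<longleftrightarrow> label r b = None" for b
    by (cases "label r b") (blast, metis surj_pair)
  then show ?thesis
    unfolding fixed_basis_def L_image_def by simp
qed

lemma moved_basis_L:
  assumes r: "r < length Gs"
  shows "moved_basis Gs (L_image Gs Ls sd) r = {b. label r b \<noteq> None}"
proof (rule Set.set_eqI)
  show "b \<in> moved_basis Gs (L_image Gs Ls sd) r \<longleftrightarrow> b \<in> {b. label r b \<noteq> None}" for b
    unfolding moved_basis_def fixed_basis_L[OF r]
    using label_basis[of r b] by (cases "label r b = None") (simp_all del: not_None_eq)
qed

text \<open>Fixing the unlabelled vectors settles their columns; preserving the span of the labelled ones
settles the remaining entries of the unlabelled rows.\<close>

lemma G_min_iff: "g \<in> G_min Gs Ls sd \<longleftrightarrow> g \<in> carrier G \<and> label_support (- {None}) g"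
proof -
  have "(\<forall>b\<in>fixed_basis Gs (L_image Gs Ls sd) r. fixes_vec (g r) b) \<and>
      (\<forall>b\<in>moved_basis Gs (L_image Gs Ls sd) r. \<forall>b'\<in>fixed_basis Gs (L_image Gs Ls sd) r. g r b' b = 0)
    \<longleftrightarrow> supported_on {b. label r b \<noteq> None} (g r)" (is "?l \<longleftrightarrow> ?r")
    if g: "g \<in> carrier G" and r: "r < length Gs" for r
  proof
    assume l: ?l
    have out: "g r b b' = mat_one b b'" if "b \<notin> basis (Gs ! r) \<or> b' \<notin> basis (Gs ! r)" for b b'
      using classical_product_finite[OF g r] that by (auto simp: finite_mats_def)
    show ?r
      unfolding supported_on_def
    proof (intro allI impI)
      fix b b' assume bb': "b \<notin> {b. label r b \<noteq> None} \<or> b' \<notin> {b. label r b \<noteq> None}"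
      show "g r b b' = mat_one b b'"
      proof (cases "b \<in> basis (Gs ! r) \<and> b' \<in> basis (Gs ! r)")
        case True
        show ?thesis
        proof (cases "label r b' = None")
          case True
          then show ?thesis
            using l \<open>b \<in> _ \<and> b' \<in> _\<close> by (simp add: fixed_basis_L[OF r] fixes_vec_def)
        next
          case False
          then have "label r b = None" using bb' by blast
          then have "label r b = None" "b \<noteq> b'" using False by metis+
          then show ?thesis
            using l False \<open>b \<in> _ \<and> b' \<in> _\<close>
            by (simp add: fixed_basis_L[OF r] moved_basis_L[OF r] mat_one_def)
        qed
      qed (use out in blast)
    qed
  next
    assume ?r
    then show ?l
      by (auto simp: fixed_basis_L[OF r] moved_basis_L[OF r] supported_on_def fixes_vec_def mat_one_def)
  qed
  then show ?thesis
    by (auto simp: G_min_def min_subgroup_def label_support_def Compl_eq)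
qed

lemma G_min_mult: "g \<in> G_min Gs Ls sd \<Longrightarrow> h \<in> G_min Gs Ls sd \<Longrightarrow> g \<cdot> h \<in> G_min Gs Ls sd"
  by (simp add: G_min_iff label_support_mult)

lemma H_sub_G_min: "H \<Xi> \<subseteq> G_min Gs Ls sd"
proof
  fix x assume "x \<in> H \<Xi>"
  then obtain l where l: "l \<in> stab \<Xi>" "x = E l"
    by (auto simp: H_E)
  have "label_support (- {None}) x"
    unfolding l(2) by (rule label_support_mono[OF label_support_stab[OF l(1)]]) auto
  then show "x \<in> G_min Gs Ls sd"
    using stab_carrier[OF l(1)] by (simp add: G_min_iff l(2))
qed

text \<open>The finite sets of indices of the factors are collected as labels, to match the supports in \<open>G\<close>.\<close>

lemma heavy_product_support:
  assumes "l \<in> carrier L"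
  obtains S where "finite S"
    "\<And>j x y. j < p \<Longrightarrow> Some (j, x) \<notin> S \<or> Some (j, y) \<notin> S \<Longrightarrow> l j x y = mat_one x y"
proof -
  have "\<forall>j\<in>{..<p}. \<exists>T. finite T \<and> supported_on T (l j)"
    using heavy_product_component[OF assms] unfolding heavy_carrier_iff finite_mats_iff by blast
  then obtain T where T: "\<And>j. j < p \<Longrightarrow> finite (T j)" "\<And>j. j < p \<Longrightarrow> supported_on (T j) (l j)"
    by (metis lessThan_iff)
  show ?thesis
  proof (rule that[of "\<Union>j<p. (\<lambda>x. Some (j, x)) ` T j"])
    show "l j x y = mat_one x y"
      if "j < p" "Some (j, x) \<notin> (\<Union>j<p. (\<lambda>x. Some (j, x)) ` T j) \<or> Some (j, y) \<notin> (\<Union>j<p. (\<lambda>x. Some (j, x)) ` T j)"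
      for j x y
      using that T(2)[OF that(1)] by (auto simp: supported_on_def)
  qed (use T(1) in auto)
qed

lemma finite_indices_bound:
  fixes \<omega> :: "nat \<Rightarrow> nat \<Rightarrow> nat"
  assumes "finite S" and \<omega>: "\<And>j. j < p \<Longrightarrow> inj (\<omega> j)"
  shows "\<exists>N. \<forall>j<p. \<forall>i. Some (j, \<omega> j i) \<in> S \<longrightarrow> i < N"
proof -
  let ?I = "\<Union>j<p. (\<lambda>i. Some (j, \<omega> j i)) -` S"
  have "inj (\<lambda>i. Some (j, \<omega> j i))" if "j < p" for j
    using \<omega>[OF that] by (auto simp: inj_def)
  then have "finite ?I"
    using assms(1) by (auto intro: finite_vimageI)
  from iffD1[OF finite_nat_iff_bounded this] obtain N where "?I \<subseteq> {..<N}" ..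
  then show ?thesis
    by (intro exI[of _ N]) blast
qed

lemma indices_bounded: "\<exists>M::nat. \<forall>j<p. m j \<le> M"
  by (rule exI[of _ "sum m {..<p}"]) (auto intro: member_le_sum)

end


section \<open>The semigroups of double cosets\<close>

text \<open>For \<open>\<Xi>\<^sub>j\<close> empty and \<open>\<omega>\<^sub>j\<close> the identity this is the setting of \<open>L \ G\<^sub>m\<^sub>i\<^sub>n / L\<close>; in general it is that of the
mantle.\<close>

locale enumerated_embedding = straight_embedding +
  fixes \<Xi> :: "nat \<Rightarrow> nat set" and \<omega> :: "nat \<Rightarrow> nat \<Rightarrow> nat"
  assumes \<omega>_inj: "\<And>j. j < length Ls \<Longrightarrow> inj (\<omega> j)"
    and \<Xi>_eq: "\<And>j. j < length Ls \<Longrightarrow> \<Xi> j = - range (\<omega> j)"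
begin

abbreviation "\<theta> \<equiv> theta_image Gs Ls sd \<omega>"
abbreviation "K n \<equiv> H (\<lambda>j. \<Xi> j \<union> \<omega> j ` {..<n})"

definition \<omega>_perms :: "(nat \<Rightarrow> nat \<Rightarrow> nat) \<Rightarrow> nat \<Rightarrow> nat mat" where
  "\<omega>_perms \<sigma> = perms (\<lambda>j. transport (\<omega> j) (\<sigma> j))"

lemma finite_perms_transport: "finite_perms \<sigma> \<Longrightarrow> finite_perms (\<lambda>j. transport (\<omega> j) (\<sigma> j))"
  by (simp add: finite_perms_def finite_perm_transport \<omega>_inj)

lemma \<omega>_perms_carrier: "finite_perms \<sigma> \<Longrightarrow> \<omega>_perms \<sigma> \<in> carrier L"
  unfolding \<omega>_perms_def by (intro perms_carrier finite_perms_transport)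

lemma \<omega>_perms_mult: "\<omega>_perms \<sigma> \<star> \<omega>_perms \<tau> = \<omega>_perms (\<lambda>j. \<sigma> j \<circ> \<tau> j)"
  unfolding \<omega>_perms_def perms_mult by (rule perms_cong) (simp add: transport_comp \<omega>_inj)

lemma \<theta>_eq: "\<theta> m = E (\<omega>_perms (\<lambda>j. half_swap (m j)))"
  unfolding \<omega>_perms_def by (rule theta_image_eq) (rule \<omega>_inj)

lemma finite_perms_half_swap: "finite_perms (\<lambda>j. half_swap (m j))"
  by (simp add: finite_perms_def finite_perm_half_swap)

lemma \<omega>_perms_stab:
  assumes "finite_perms \<sigma>" "\<And>j i. j < p \<Longrightarrow> i < n \<Longrightarrow> \<sigma> j i = i"
  shows "\<omega>_perms \<sigma> \<in> stab (\<lambda>j. \<Xi> j \<union> \<omega> j ` {..<n})"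
proof (rule stabI)
  show "\<omega>_perms \<sigma> \<in> carrier L"
    by (rule \<omega>_perms_carrier) fact
  fix j x y assume j: "j < p" and x: "x \<in> \<Xi> j \<union> \<omega> j ` {..<n}"
  have "transport (\<omega> j) (\<sigma> j) x = x"
    using x assms(2)[OF j] by (auto simp: \<Xi>_eq[OF j] transport_range[OF \<omega>_inj[OF j]] transport_outside)
  then show "\<omega>_perms \<sigma> j y x = mat_one y x"
    using j by (simp add: \<omega>_perms_def perms_def perm_mat_def mat_one_def)
qed

lemma \<theta>_in_H: "\<theta> m \<in> H \<Xi>"
  using \<omega>_perms_stab[of "\<lambda>j. half_swap (m j)" 0] finite_perms_half_swap by (auto simp: \<theta>_eq H_E)

lemma \<theta>_square: "\<theta> m \<cdot> \<theta> m = \<one>\<^bsub>G\<^esub>"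
proof -
  have "\<omega>_perms (\<lambda>j. half_swap (m j)) \<star> \<omega>_perms (\<lambda>j. half_swap (m j)) = \<one>\<^bsub>L\<^esub>"
    unfolding \<omega>_perms_def perms_mult perms_one[symmetric]
    by (rule perms_cong) (simp add: transport_half_swap_involution \<omega>_inj)
  then show ?thesis
    by (simp add: \<theta>_eq E_mult[symmetric] \<omega>_perms_carrier finite_perms_half_swap)
qed

text \<open>Elements of \<open>K n\<close> act only at vectors labelled by \<open>\<omega>\<^sub>j(i)\<close> with \<open>i \<ge> n\<close>, and only finitely many labels
occur in the support of \<open>g\<close>.\<close>

lemma K_commutes:
  assumes g: "g \<in> carrier G"
  shows "\<exists>n. \<forall>k\<in>K n. g \<cdot> k = k \<cdot> g"
proof -
  obtain S where S: "finite S" "label_support S g"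
    using g by (rule label_support_finite)
  obtain n where n: "\<And>j i. j < p \<Longrightarrow> Some (j, \<omega> j i) \<in> S \<Longrightarrow> i < n"
    using finite_indices_bound[of S \<omega>, OF S(1) \<omega>_inj] by blast
  have "g \<cdot> k = k \<cdot> g" if k: "k \<in> K n" for k
  proof -
    obtain l where l: "l \<in> stab (\<lambda>j. \<Xi> j \<union> \<omega> j ` {..<n})" "k = E l"
      using k by (auto simp: H_E)
    have "S \<inter> Some ` {(j, x). j < p \<and> x \<notin> \<Xi> j \<union> \<omega> j ` {..<n}} = {}"
      using n by (auto simp: \<Xi>_eq)
    then show ?thesis
      using label_support_commute[OF S(2) label_support_stab[OF l(1)]] g stab_carrier[OF l(1)]
      by (simp add: l(2))
  qed
  then show ?thesis by blast
qed

text \<open>For \<open>i < n \<le> m\<^sub>j\<close>, the involution takes \<open>\<omega>\<^sub>j(i)\<close> to \<open>\<omega>\<^sub>j(m\<^sub>j + i)\<close>, which \<open>k\<close> fixes once \<open>m\<^sub>j\<close> exceeds all the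
indices at which \<open>k\<close> is nontrivial.\<close>

lemma \<theta>_conj:
  assumes k: "k \<in> H \<Xi>"
  shows "\<forall>\<^sub>F m in indices_at_top p. \<theta> m \<cdot> k \<cdot> \<theta> m \<in> K n"
proof -
  obtain l where l: "l \<in> stab \<Xi>" "k = E l"
    using k by (auto simp: H_E)
  note lc = stab_carrier[OF l(1)]
  obtain S where S: "finite S"
    "\<And>j x y. j < p \<Longrightarrow> Some (j, x) \<notin> S \<or> Some (j, y) \<notin> S \<Longrightarrow> l j x y = mat_one x y"
    using heavy_product_support[OF lc] by blast
  from S(1) have "\<exists>N. \<forall>j<p. \<forall>i. Some (j, \<omega> j i) \<in> S \<longrightarrow> i < N"
    using \<omega>_inj by (rule finite_indices_bound)
  then obtain N where N: "\<forall>j<p. \<forall>i. Some (j, \<omega> j i) \<in> S \<longrightarrow> i < N" ..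
  show ?thesis
  proof (rule eventually_mono[OF eventually_indices_ge[of p "max n N"]])
    fix m assume m: "\<forall>j<p. max n N \<le> m j"
    let ?s = "\<lambda>j. half_swap (m j)"
    have \<theta>c: "\<omega>_perms ?s \<in> carrier L"
      by (rule \<omega>_perms_carrier) (rule finite_perms_half_swap)
    have "\<omega>_perms ?s \<star> l \<star> \<omega>_perms ?s \<in> stab (\<lambda>j. \<Xi> j \<union> \<omega> j ` {..<n})"
    proof (rule stabI)
      fix j x y assume j: "j < p" and x: "x \<in> \<Xi> j \<union> \<omega> j ` {..<n}"
      define \<tau> where "\<tau> = transport (\<omega> j) (half_swap (m j))"
      have bij: "bij \<tau>"
        using finite_perm_transport[OF \<omega>_inj[OF j] finite_perm_half_swap]
        by (simp add: \<tau>_def finite_perm_def)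
      have "\<tau> \<circ> \<tau> = id"
        unfolding \<tau>_def by (rule transport_half_swap_involution[OF \<omega>_inj[OF j]])
      then have \<tau>\<tau>: "\<tau> (\<tau> z) = z" and inv: "inv_into UNIV \<tau> = \<tau>" for z
        by (simp_all add: pointfree_idE inv_unique_comp)
      have col: "l j z (\<tau> x) = mat_one z (\<tau> x)" for z
        using x
      proof
        assume "x \<in> \<Xi> j"
        then show ?thesis
          using stab_entries[OF l(1) j] by (simp add: \<tau>_def transport_outside \<Xi>_eq[OF j])
      next
        assume "x \<in> \<omega> j ` {..<n}"
        then obtain i where i: "i < n" "x = \<omega> j i" by blast
        have "half_swap (m j) i = m j + i"
          using i(1) m j by (auto simp: half_swap_def)
        then have "\<tau> x = \<omega> j (m j + i)"
          by (simp add: \<tau>_def i transport_range[OF \<omega>_inj[OF j]])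
        moreover have "Some (j, \<omega> j (m j + i)) \<notin> S"
          using N m j by (metis add_leE le_add1 max.bounded_iff not_less order.trans)
        ultimately show ?thesis
          using S(2)[OF j] by simp
      qed
      have "(\<omega>_perms ?s \<star> l \<star> \<omega>_perms ?s) j y x = l j (inv_into UNIV \<tau> y) (\<tau> x)"
        using j bij by (simp add: heavy_product_mult \<omega>_perms_def perms_def mult_perm_mat perm_mat_mult \<tau>_def)
      also have "\<dots> = mat_one y x"
      proof -
        have "\<tau> y = \<tau> x \<longleftrightarrow> y = x"
          by (rule inj_eq[OF bij_is_inj[OF bij]])
        then show ?thesis
          by (simp add: col inv mat_one_def)
      qed
      finally show "(\<omega>_perms ?s \<star> l \<star> \<omega>_perms ?s) j y x = mat_one y x" .
    qed (use lc \<theta>c in simp)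
    moreover have "\<theta> m \<cdot> k \<cdot> \<theta> m = E (\<omega>_perms ?s \<star> l \<star> \<omega>_perms ?s)"
      using lc \<theta>c by (simp add: E_mult \<theta>_eq l(2))
    ultimately show "\<theta> m \<cdot> k \<cdot> \<theta> m \<in> K n"
      by (auto simp: H_E)
  qed
qed

text \<open>Let \<open>v\<close> interchange the blocks of length \<open>n\<close> that start at \<open>m\<^sub>j\<close> and at \<open>m''\<^sub>j\<close>, and let
\<open>u = \<theta>\<^sub>m v \<theta>\<^bsub>m''\<^esub>\<close>. For \<open>i < n\<close> the three factors of \<open>u\<close> send \<open>i \<mapsto> m''\<^sub>j + i \<mapsto> m\<^sub>j + i \<mapsto> i\<close>.
When \<open>m'\<close> lies far enough from both, \<open>\<theta>\<^bsub>m'\<^esub>\<close> carries the first \<open>n\<close> indices between the two blocks, so that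
its conjugate of \<open>v\<close> fixes them, too.\<close>

lemma \<theta>_factor:
  assumes nm: "\<forall>j<p. n \<le> m j"
  shows "\<forall>\<^sub>F m' in indices_at_top p. \<forall>\<^sub>F m'' in indices_at_top p.
    \<exists>u\<in>K n. \<exists>v\<in>K n. \<theta> m = u \<cdot> \<theta> m'' \<cdot> v \<and> \<theta> m' \<cdot> v \<cdot> \<theta> m' \<in> K n"
proof -
  obtain M where M: "\<And>j. j < p \<Longrightarrow> m j \<le> M"
    using indices_bounded by blast
  show ?thesis
  proof (rule eventually_mono[OF eventually_indices_ge[of p "M + n"]])
    fix m' assume m': "\<forall>j<p. M + n \<le> m' j"
    obtain M' where M': "\<And>j. j < p \<Longrightarrow> m' j \<le> M'"
      using indices_bounded by blast
    show "\<forall>\<^sub>F m'' in indices_at_top p.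
      \<exists>u\<in>K n. \<exists>v\<in>K n. \<theta> m = u \<cdot> \<theta> m'' \<cdot> v \<and> \<theta> m' \<cdot> v \<cdot> \<theta> m' \<in> K n"
    proof (rule eventually_mono[OF eventually_indices_ge[of p "M' + n"]])
      fix m'' assume m'': "\<forall>j<p. M' + n \<le> m'' j"
      have le: "n \<le> m j" "m j + n \<le> m' j" "m' j + n \<le> m'' j" if "j < p" for j
        using nm M[OF that] M'[OF that] m' m'' that by force+
      define h h' h'' s where "h j = half_swap (m j)" and "h' j = half_swap (m' j)"
        and "h'' j = half_swap (m'' j)" and "s j = block_swap n (m j) (m'' j)" for j
      define u where "u j = h j \<circ> s j \<circ> h'' j" for j
      have ss: "s j (s j i) = i" "finite_perm (s j)" if "j < p" for i j
        using finite_perm_block_swap[of "m j" n "m'' j"] le[OF that] by (auto simp: s_def)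
      have hh: "h j (h j i) = i" "h' j (h' j i) = i" "h'' j (h'' j i) = i" for i j
        by (simp_all add: h_def h'_def h''_def half_swap_involution)
      have fin: "finite_perms h" "finite_perms h'" "finite_perms h''" "finite_perms s"
        unfolding finite_perms_def h_def h'_def h''_def using ss(2) finite_perm_half_swap by blast+
      have fu: "finite_perms u" "finite_perms (\<lambda>j. h' j \<circ> s j \<circ> h' j)"
        using fin by (auto simp: finite_perms_def u_def intro!: finite_perm_comp)
      have carr: "\<omega>_perms h \<in> carrier L" "\<omega>_perms h' \<in> carrier L" "\<omega>_perms h'' \<in> carrier L"
        "\<omega>_perms s \<in> carrier L" "\<omega>_perms u \<in> carrier L"
        using fin fu by (simp_all add: \<omega>_perms_carrier)
      have u: "\<omega>_perms u \<in> stab (\<lambda>j. \<Xi> j \<union> \<omega> j ` {..<n})"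
      proof (rule \<omega>_perms_stab[OF fu(1)])
        fix j i assume "j < p" "i < n"
        with le[of j] swaps_fix_initial_segment(2)[of i n "m j" "m'' j"] show "u j i = i"
          by (simp add: u_def h_def h''_def s_def)
      qed
      have s: "\<omega>_perms s \<in> stab (\<lambda>j. \<Xi> j \<union> \<omega> j ` {..<n})"
      proof (rule \<omega>_perms_stab[OF fin(4)])
        fix j i assume "j < p" "i < n"
        with le[of j] swaps_fix_initial_segment(1)[of i n "m j" "m'' j"] show "s j i = i"
          by (simp add: s_def)
      qed
      have hsh: "\<omega>_perms (\<lambda>j. h' j \<circ> s j \<circ> h' j) \<in> stab (\<lambda>j. \<Xi> j \<union> \<omega> j ` {..<n})"
      proof (rule \<omega>_perms_stab[OF fu(2)])
        fix j i assume "j < p" "i < n"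
        with le[of j] swaps_fix_initial_segment(3)[of i n "m j" "m' j" "m'' j"] show "(h' j \<circ> s j \<circ> h' j) i = i"
          by (simp add: h'_def s_def)
      qed
      have "\<omega>_perms u \<star> \<omega>_perms h'' \<star> \<omega>_perms s = \<omega>_perms h"
        unfolding \<omega>_perms_mult unfolding \<omega>_perms_def
      proof (rule perms_cong)
        fix j assume j: "j < p"
        have "u j \<circ> h'' j \<circ> s j = h j"
          using ss(1)[OF j] by (auto simp: u_def hh)
        then show "transport (\<omega> j) (u j \<circ> h'' j \<circ> s j) = transport (\<omega> j) (h j)" by simp
      qed
      moreover have "E (\<omega>_perms u \<star> \<omega>_perms h'' \<star> \<omega>_perms s) =
          E (\<omega>_perms u) \<cdot> E (\<omega>_perms h'') \<cdot> E (\<omega>_perms s)"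
        using carr by (simp add: E_mult)
      moreover have "E (\<omega>_perms h' \<star> \<omega>_perms s \<star> \<omega>_perms h') =
          E (\<omega>_perms h') \<cdot> E (\<omega>_perms s) \<cdot> E (\<omega>_perms h')"
        using carr by (simp add: E_mult)
      moreover have "\<omega>_perms h' \<star> \<omega>_perms s \<star> \<omega>_perms h' = \<omega>_perms (\<lambda>j. h' j \<circ> s j \<circ> h' j)"
        unfolding \<omega>_perms_mult ..
      moreover have "\<theta> m = E (\<omega>_perms h)" "\<theta> m' = E (\<omega>_perms h')" "\<theta> m'' = E (\<omega>_perms h'')"
        by (simp_all add: \<theta>_eq h_def[abs_def] h'_def[abs_def] h''_def[abs_def])
      ultimately have "\<theta> m = E (\<omega>_perms u) \<cdot> \<theta> m'' \<cdot> E (\<omega>_perms s)"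
        and "\<theta> m' \<cdot> E (\<omega>_perms s) \<cdot> \<theta> m' = E (\<omega>_perms (\<lambda>j. h' j \<circ> s j \<circ> h' j))"
        by metis+
      moreover have "E (\<omega>_perms u) \<in> K n" "E (\<omega>_perms s) \<in> K n" "E (\<omega>_perms (\<lambda>j. h' j \<circ> s j \<circ> h' j)) \<in> K n"
        using u s hsh by (auto simp: L_Xi_image_def)
      ultimately show "\<exists>u\<in>K n. \<exists>v\<in>K n. \<theta> m = u \<cdot> \<theta> m'' \<cdot> v \<and> \<theta> m' \<cdot> v \<cdot> \<theta> m' \<in> K n"
        by (intro bexI[of _ "E (\<omega>_perms u)"] bexI[of _ "E (\<omega>_perms s)"] conjI) simp_all
    qed
  qed
qed

lemma spreading_pairI:
  assumes "H \<Xi> \<subseteq> A" "A \<subseteq> carrier G" "\<And>g h. g \<in> A \<Longrightarrow> h \<in> A \<Longrightarrow> g \<cdot> h \<in> A"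
  shows "spreading_pair G A (H \<Xi>) p \<theta> K"
proof -
  have 1: "K n' \<subseteq> K n" if "n \<le> n'" for n n'
    by (rule H_antimono) (use that in auto)
  have 2: "K n \<subseteq> H \<Xi>" for n
    by (rule H_antimono) auto
  have 3: "\<exists>n. \<forall>k\<in>K n. g \<cdot> k = k \<cdot> g" if "g \<in> A" for g
    using that assms(2) K_commutes by blast
  show ?thesis
    by (rule spreading_pair.intro[OF G.is_group], rule spreading_pair_axioms.intro,
      rule subgroup_H, rule assms, rule assms, rule assms, assumption, assumption,
      rule \<theta>_in_H, rule \<theta>_square, rule 2, rule 1, assumption, rule 3, assumption,
      rule \<theta>_conj, assumption, rule \<theta>_factor)
qed

end


section \<open>Relabelling\<close>

context enumerated_embedding
begin

abbreviation "R \<equiv> relabel_element Gs Ls sd \<omega>"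

text \<open>A finite permutation can agree with \<open>\<omega>\<^sub>j\<close> on all indices only if \<open>\<omega>\<^sub>j\<close> is one itself, but for
elements that act at indices below \<open>N\<close> only the first \<open>N\<close> values matter.\<close>

definition extends :: "nat \<Rightarrow> (nat \<Rightarrow> nat \<Rightarrow> nat) \<Rightarrow> bool" where
  "extends N \<sigma> \<longleftrightarrow> finite_perms \<sigma> \<and> (\<forall>j<p. \<forall>i<N. \<sigma> j i = \<omega> j i)"

text \<open>The labels of the vectors on which a permutation that \<open>extends N\<close> acts as the relabelling does.\<close>

definition initial :: "nat \<Rightarrow> (nat \<times> nat) option set" where
  "initial N = Some ` {(j, n). j < p \<and> n < N}"

lemma extension_exists: "\<exists>\<sigma>. extends N \<sigma>"
proof -
  have "\<forall>j\<in>{..<p}. \<exists>\<sigma>. finite_perm \<sigma> \<and> (\<forall>i<N. \<sigma> i = \<omega> j i)"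
    using finite_perm_extends[OF \<omega>_inj] by (metis lessThan_iff)
  then obtain \<sigma> where "\<forall>j\<in>{..<p}. finite_perm (\<sigma> j) \<and> (\<forall>i<N. \<sigma> j i = \<omega> j i)"
    by (rule bchoice[THEN exE])
  then show ?thesis
    by (auto simp: extends_def finite_perms_def)
qed

lemma extends_bij: "extends N \<sigma> \<Longrightarrow> j < p \<Longrightarrow> bij (\<sigma> j)"
  by (simp add: extends_def finite_perms_def finite_perm_def)

lemma extends_inverse:
  assumes "extends N \<sigma>" "j < p" "x \<notin> \<omega> j ` {..<N}"
  shows "N \<le> inv_into UNIV (\<sigma> j) x"
proof (rule ccontr)
  assume "\<not> N \<le> inv_into UNIV (\<sigma> j) x"
  then have "\<sigma> j (inv_into UNIV (\<sigma> j) x) = \<omega> j (inv_into UNIV (\<sigma> j) x)" "inv_into UNIV (\<sigma> j) x < N"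
    using assms(1,2) by (auto simp: extends_def)
  moreover have "\<sigma> j (inv_into UNIV (\<sigma> j) x) = x"
    using extends_bij[OF assms(1,2)] by (simp add: bij_is_surj surj_f_inv_f)
  ultimately show False
    using assms(3) by (metis imageI lessThan_iff)
qed

lemma initial_mono: "N \<le> N' \<Longrightarrow> initial N \<subseteq> initial N'"
  by (auto simp: initial_def)

lemma G_min_initial:
  assumes "g \<in> G_min Gs Ls sd"
  shows "\<exists>N. \<forall>N'\<ge>N. label_support (initial N') g"
proof -
  have g: "g \<in> carrier G" "label_support (- {None}) g"
    using assms by (auto simp: G_min_iff)
  obtain S where S: "finite S" "label_support S g"
    using g(1) by (rule label_support_finite)
  obtain N where N: "\<forall>j<p. \<forall>i. Some (j, i) \<in> S \<longrightarrow> i < N"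
    using finite_indices_bound[of S "\<lambda>j i. i", OF S(1)] by auto
  have "label_support (initial N) g"
    unfolding label_support_def
  proof (intro allI impI)
    fix r assume r: "r < length Gs"
    have "supported_on {b. label r b \<in> S \<inter> - {None}} (g r)"
      using label_support_Int[OF S(2) g(2)] r by (simp add: label_support_def)
    moreover have "{b. label r b \<in> S \<inter> - {None}} \<subseteq> {b. label r b \<in> initial N}"
    proof
      fix b assume "b \<in> {b. label r b \<in> S \<inter> - {None}}"
      then obtain j n where b: "label r b = Some (j, n)" "Some (j, n) \<in> S"
        by (cases "label r b") auto
      then have "j < p" "n < N"
        using label_less[OF r b(1)] N by auto
      then show "b \<in> {b. label r b \<in> initial N}"
        using b by (simp add: initial_def)
    qed
    ultimately show "supported_on {b. label r b \<in> initial N} (g r)"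
      by (rule supported_on_mono)
  qed
  then show ?thesis
    using label_support_mono initial_mono by blast
qed

text \<open>On the finitely many basis vectors where \<open>g\<close> acts, the relabelling agrees with a finite
  permutation of the basis vectors of \<open>L\<close>.\<close>

lemma relabel_element_eq_conj_perms:
  assumes \<sigma>: "extends N \<sigma>" and g: "g \<in> G_min Gs Ls sd" and supp: "label_support (initial N) g"
  shows "R g = conj_perms \<sigma> g"
proof
  fix r
  have \<sigma>f: "finite_perms \<sigma>" using \<sigma> by (simp add: extends_def)
  have gc: "g \<in> carrier G" using g by (simp add: G_min_iff)
  show "R g r = conj_perms \<sigma> g r"
  proof (cases "r < length Gs")
    case False
    then show ?thesis
      using conj_perms_carrier[OF \<sigma>f gc]
      by (auto simp: classical_product_carrier relabel_element_def extensional_def)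
  next
    case r: True
    let ?\<rho> = "relabel Gs sd \<omega> r" and ?\<pi> = "move \<sigma> r"
    let ?M = "{b. label r b \<noteq> None}" and ?F = "{b. label r b \<in> initial N}"
    have inj: "inj_on ?\<rho> ?M"
    proof (rule inj_onI)
      fix b b' assume "b \<in> ?M" "b' \<in> ?M" and eq: "?\<rho> b = ?\<rho> b'"
      then obtain j n j' n' where "label r b = Some (j, n)" "label r b' = Some (j', n')" by auto
      then show "b = b'"
        using \<omega>_inj eq by (rule relabel_inj[OF r])
    qed
    have \<pi>\<rho>: "?\<pi> b = ?\<rho> b" "b \<in> ?M" if "b \<in> ?F" for b
    proof -
      obtain j n where b: "label r b = Some (j, n)" "j < p" "n < N"
        using \<open>b \<in> ?F\<close> by (auto simp: initial_def)
      then have "\<sigma> j n = \<omega> j n"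
        using \<sigma> by (simp add: extends_def)
      from relabel_cong[of r b j n \<sigma> \<omega>, OF b(1) this]
      have "relabel Gs sd \<sigma> r b = ?\<rho> b" .
      moreover have "heavy_label (Gs ! r) b \<noteq> None"
        using b(1) by (auto simp: label_def split: option.splits)
      ultimately show "?\<pi> b = ?\<rho> b"
        by (auto simp: move_def)
      show "b \<in> ?M" using b by simp
    qed
    have \<pi>_inj: "?\<pi> a = ?\<pi> a' \<longleftrightarrow> a = a'" for a a'
      by (metis move_inverses(2)[OF \<sigma>f r])
    have R: "R g r b b' = (if b \<in> ?\<rho> ` ?M \<and> b' \<in> ?\<rho> ` ?M
        then g r (inv_into ?M ?\<rho> b) (inv_into ?M ?\<rho> b') else mat_one b b')" for b b'
      using r by (simp add: relabel_element_def moved_basis_L[OF r] Let_def del: not_None_eq)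
    have g_one: "g r a a' = mat_one a a'" if "a \<notin> ?F \<or> a' \<notin> ?F" for a a'
      using supp r that by (simp add: label_support_def supported_on_def)
    have "R g r (?\<pi> a) (?\<pi> a') = g r a a'" for a a'
    proof (cases "a \<in> ?F \<and> a' \<in> ?F")
      case True
      have "?\<pi> a \<in> ?\<rho> ` ?M" "?\<pi> a' \<in> ?\<rho> ` ?M" "inv_into ?M ?\<rho> (?\<pi> a) = a" "inv_into ?M ?\<rho> (?\<pi> a') = a'"
        using \<pi>\<rho> True inj by (auto simp del: not_None_eq)
      then show ?thesis
        unfolding R by (simp del: not_None_eq)
    next
      case False
      \<comment> \<open>Outside \<open>?F\<close> relabelling and permutation may differ, but the \<open>?\<rho>\<close>-preimage of \<open>?\<pi> b\<close> is
        in \<open>?F\<close> only if it is \<open>b\<close>; so \<open>g\<close> has trivial entries at the preimages as well.\<close>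
      have F: "x \<notin> ?F \<or> x = b" if "?\<rho> x = ?\<pi> b" for x b
        using that \<pi>\<rho>(1)[of x] \<pi>_inj by metis
      have "R g r (?\<pi> a) (?\<pi> a') = mat_one (?\<pi> a) (?\<pi> a')"
      proof (cases "?\<pi> a \<in> ?\<rho> ` ?M \<and> ?\<pi> a' \<in> ?\<rho> ` ?M")
        case True
        then have im: "?\<pi> a \<in> ?\<rho> ` ?M" "?\<pi> a' \<in> ?\<rho> ` ?M" by blast+
        define x x' where "x = inv_into ?M ?\<rho> (?\<pi> a)" and "x' = inv_into ?M ?\<rho> (?\<pi> a')"
        have x: "x \<in> ?M" "?\<rho> x = ?\<pi> a" and x': "x' \<in> ?M" "?\<rho> x' = ?\<pi> a'"
          unfolding x_def x'_def by (intro inv_into_into f_inv_into_f im)+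
        have "R g r (?\<pi> a) (?\<pi> a') = g r x x'"
          unfolding R x_def x'_def using im by (simp del: not_None_eq)
        also have "\<dots> = mat_one x x'"
          using F[OF x(2)] F[OF x'(2)] False by (intro g_one) blast
        also have "\<dots> = mat_one (?\<pi> a) (?\<pi> a')"
          using x x' inj_on_eq_iff[OF inj, of x x'] by (simp add: mat_one_def del: not_None_eq)
        finally show ?thesis .
      next
        case False
        then show ?thesis
          unfolding R by (simp only: if_False)
      qed
      then show ?thesis
        using g_one[of a a'] False \<pi>_inj by (auto simp: mat_one_def)
    qed
    then have "R g r b b' = conj_perms \<sigma> g r b b'" for b b'
      by (metis conj_perms_apply[OF \<sigma>f r] move_inverses(1)[OF \<sigma>f r])
    then show ?thesis by (intro ext)
  qed
qed

text \<open>A common \<open>\<sigma>\<close> for finitely many elements is what turns properties of conjugation into properties of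
relabelling.\<close>

lemma relabel_elements_as_conj_perms:
  assumes "finite B" "B \<subseteq> G_min Gs Ls sd"
  shows "\<exists>N \<sigma>. extends N \<sigma> \<and> (\<forall>g\<in>B. label_support (initial N) g \<and> R g = conj_perms \<sigma> g)"
proof -
  obtain n where n: "\<And>g N. g \<in> B \<Longrightarrow> n g \<le> N \<Longrightarrow> label_support (initial N) g"
    using G_min_initial assms(2) by (metis subsetD)
  define N where "N = Max (n ` B)"
  obtain \<sigma> where \<sigma>: "extends N \<sigma>"
    using extension_exists by blast
  have "label_support (initial N) g" if "g \<in> B" for g
    using that assms(1) by (intro n) (auto simp: N_def)
  then show ?thesis
    using relabel_element_eq_conj_perms[OF \<sigma>] assms(2) \<sigma> by blast
qed

lemma relabel_element_carrier:
  assumes "g \<in> G_min Gs Ls sd"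
  shows "R g \<in> carrier G"
proof -
  obtain N \<sigma> where "extends N \<sigma>" "R g = conj_perms \<sigma> g"
    using relabel_elements_as_conj_perms[of "{g}"] assms by auto
  then show ?thesis
    using assms by (simp add: conj_perms_carrier extends_def G_min_iff)
qed

lemma relabel_element_mult:
  assumes "g \<in> G_min Gs Ls sd" "h \<in> G_min Gs Ls sd"
  shows "R (g \<cdot> h) = R g \<cdot> R h"
proof -
  obtain N \<sigma> where "extends N \<sigma>" "R g = conj_perms \<sigma> g" "R h = conj_perms \<sigma> h"
    "R (g \<cdot> h) = conj_perms \<sigma> (g \<cdot> h)"
    using relabel_elements_as_conj_perms[of "{g, h, g \<cdot> h}"] assms G_min_mult by auto
  then show ?thesis
    using assms by (simp add: conj_perms_mult extends_def G_min_iff)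
qed

lemma inj_on_relabel_element: "inj_on R (G_min Gs Ls sd)"
proof (rule inj_onI)
  fix g h assume gh: "g \<in> G_min Gs Ls sd" "h \<in> G_min Gs Ls sd" "R g = R h"
  obtain N \<sigma> where "extends N \<sigma>" "R g = conj_perms \<sigma> g" "R h = conj_perms \<sigma> h"
    using relabel_elements_as_conj_perms[of "{g, h}"] gh by auto
  then show "g = h"
    using gh conj_perms_inject[of \<sigma> g h] by (simp add: extends_def G_min_iff)
qed

lemma E_in_G_min: "l \<in> carrier L \<Longrightarrow> E l \<in> G_min Gs Ls sd"
  using H_sub_G_min[of "\<lambda>_. {}"] by (auto simp: L_Xi_image_def heavy_stabilizer_def)

lemma conj_perms_E:
  assumes "finite_perms \<sigma>" "l \<in> carrier L"
  shows "conj_perms \<sigma> (E l) = E (perms \<sigma> \<star> l \<star> perms (inverses \<sigma>))"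
  using assms by (simp add: conj_perms_def E_mult perms_carrier finite_perms_inverses)

lemma conj_perms_entry:
  assumes "finite_perms \<sigma>" "j < p"
  shows "(perms \<sigma> \<star> l \<star> perms \<tau>) j x y = l j (inv_into UNIV (\<sigma> j) x) (\<tau> j y)"
proof -
  have "bij (\<sigma> j)"
    using assms by (simp add: finite_perms_def finite_perm_def)
  then show ?thesis
    using assms(2) by (simp add: heavy_product_mult perms_def mult_perm_mat perm_mat_mult)
qed

lemma label_support_initial_E:
  assumes "\<And>j x y. j < p \<Longrightarrow> N \<le> x \<or> N \<le> y \<Longrightarrow> l j x y = mat_one x y"
  shows "label_support (initial N) (E l)"
  unfolding initial_def using assms by (intro label_support_E) force

text \<open>If \<open>l\<close> acts at indices below \<open>N\<close>, then \<open>\<sigma> l \<sigma>\<^sup>-\<^sup>1\<close> acts at the \<open>\<omega>\<^sub>j(i)\<close> with \<open>i < N\<close>, none of which is in \<open>\<Xi>\<^sub>j\<close>.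
Conversely an element of \<open>L\<^sup>\<Xi>\<close> acts at finitely many such indices, and \<open>\<sigma>\<^sup>-\<^sup>1\<close> takes it back.\<close>

lemma relabel_element_L: "R ` H (\<lambda>_. {}) = H \<Xi>"
proof
  show "R ` H (\<lambda>_. {}) \<subseteq> H \<Xi>"
  proof
    fix x assume "x \<in> R ` H (\<lambda>_. {})"
    then obtain l where l: "l \<in> carrier L" "x = R (E l)"
      by (auto simp: L_Xi_image_def heavy_stabilizer_def)
    obtain S where S: "finite S"
      "\<And>j x y. j < p \<Longrightarrow> Some (j, x) \<notin> S \<or> Some (j, y) \<notin> S \<Longrightarrow> l j x y = mat_one x y"
      using heavy_product_support[OF l(1)] by blast
    obtain N where N: "\<forall>j<p. \<forall>i. Some (j, i) \<in> S \<longrightarrow> i < N"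
      using finite_indices_bound[of S "\<lambda>j i. i", OF S(1)] by auto
    have out: "l j x y = mat_one x y" if "j < p" "N \<le> x \<or> N \<le> y" for j x y
      using N that by (intro S(2)) (auto simp: not_le[symmetric])
    obtain \<sigma> where \<sigma>: "extends N \<sigma>"
      using extension_exists by blast
    have \<sigma>f: "finite_perms \<sigma>"
      using \<sigma> by (simp add: extends_def)
    have x: "x = E (perms \<sigma> \<star> l \<star> perms (inverses \<sigma>))"
      unfolding l(2) conj_perms_E[OF \<sigma>f l(1), symmetric]
      using out by (intro relabel_element_eq_conj_perms[OF \<sigma> E_in_G_min[OF l(1)]] label_support_initial_E)
    have "perms \<sigma> \<star> l \<star> perms (inverses \<sigma>) \<in> stab \<Xi>"
    proof (rule stabI)
      fix j x y assume j: "j < p" and x: "x \<in> \<Xi> j"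
      have "N \<le> inv_into UNIV (\<sigma> j) x"
        using x by (intro extends_inverse[OF \<sigma> j]) (auto simp: \<Xi>_eq[OF j])
      moreover have "inj (inv_into UNIV (\<sigma> j))"
        using extends_bij[OF \<sigma> j] by (simp add: bij_imp_bij_inv bij_is_inj)
      ultimately show "(perms \<sigma> \<star> l \<star> perms (inverses \<sigma>)) j y x = mat_one y x"
        by (simp add: conj_perms_entry[OF \<sigma>f j] out[OF j] mat_one_def inj_eq)
    qed (use \<sigma>f l(1) in \<open>simp add: perms_carrier finite_perms_inverses\<close>)
    then show "x \<in> H \<Xi>"
      by (auto simp: x L_Xi_image_def)
  qed
next
  show "H \<Xi> \<subseteq> R ` H (\<lambda>_. {})"
  proof
    fix x assume "x \<in> H \<Xi>"
    then obtain l where l: "l \<in> stab \<Xi>" "x = E l"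
      by (auto simp: L_Xi_image_def)
    note lc = stab_carrier[OF l(1)]
    obtain S where S: "finite S"
      "\<And>j x y. j < p \<Longrightarrow> Some (j, x) \<notin> S \<or> Some (j, y) \<notin> S \<Longrightarrow> l j x y = mat_one x y"
      using heavy_product_support[OF lc] by blast
    obtain N where N: "\<forall>j<p. \<forall>i. Some (j, \<omega> j i) \<in> S \<longrightarrow> i < N"
      using finite_indices_bound[of S \<omega>, OF S(1) \<omega>_inj] by blast
    have out: "l j x y = mat_one x y" if j: "j < p" and xy: "x \<notin> \<omega> j ` {..<N} \<or> y \<notin> \<omega> j ` {..<N}" for j x y
    proof -
      have "z \<in> \<Xi> j \<or> Some (j, z) \<notin> S" if "z \<notin> \<omega> j ` {..<N}" for z
        using that N j by (auto simp: \<Xi>_eq[OF j])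
      with xy have "x \<in> \<Xi> j \<or> y \<in> \<Xi> j \<or> Some (j, x) \<notin> S \<or> Some (j, y) \<notin> S"
        by blast
      then show ?thesis
        using stab_entries[OF l(1) j] S(2)[OF j] by blast
    qed
    obtain \<sigma> where \<sigma>: "extends N \<sigma>"
      using extension_exists by blast
    have \<sigma>f: "finite_perms \<sigma>" "finite_perms (inverses \<sigma>)"
      using \<sigma> finite_perms_inverses by (simp_all add: extends_def)
    note pc = perms_carrier[OF \<sigma>f(1)] perms_carrier[OF \<sigma>f(2)]
    define l' where "l' = perms (inverses \<sigma>) \<star> l \<star> perms \<sigma>"
    have l': "l' \<in> carrier L"
      using lc pc by (simp add: l'_def)
    have "l' j x y = mat_one x y" if j: "j < p" and xy: "N \<le> x \<or> N \<le> y" for j x y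
    proof -
      have bij: "bij (\<sigma> j)" by (rule extends_bij[OF \<sigma> j])
      have notin: "\<sigma> j z \<notin> \<omega> j ` {..<N}" if "N \<le> z" for z
      proof
        assume "\<sigma> j z \<in> \<omega> j ` {..<N}"
        then obtain i where "i < N" "\<sigma> j z = \<sigma> j i"
          using \<sigma> j by (auto simp: extends_def)
        then show False
          using bij_is_inj[OF bij] that by (simp add: inj_eq)
      qed
      have "l' j x y = l j (\<sigma> j x) (\<sigma> j y)"
        unfolding l'_def by (simp add: conj_perms_entry[OF \<sigma>f(2) j] inv_inv_eq bij)
      also have "\<dots> = mat_one (\<sigma> j x) (\<sigma> j y)"
        using notin xy by (intro out[OF j]) blast
      finally show ?thesis
        using bij_is_inj[OF bij] by (simp add: mat_one_def inj_eq)
    qed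
    then have "R (E l') = E (perms \<sigma> \<star> l' \<star> perms (inverses \<sigma>))"
      unfolding conj_perms_E[OF \<sigma>f(1) l', symmetric]
      by (intro relabel_element_eq_conj_perms[OF \<sigma> E_in_G_min[OF l']] label_support_initial_E)
    also have "perms \<sigma> \<star> l' \<star> perms (inverses \<sigma>) =
        (perms \<sigma> \<star> perms (inverses \<sigma>)) \<star> l \<star> (perms \<sigma> \<star> perms (inverses \<sigma>))"
      using lc pc by (simp add: l'_def L.m_assoc)
    also have "\<dots> = l"
      using lc by (simp add: perms_inverses[OF \<sigma>f(1)])
    finally have "x = R (E l')" using l(2) by simp
    then show "x \<in> R ` H (\<lambda>_. {})"
      using l' by (auto simp: L_Xi_image_def heavy_stabilizer_def)
  qed
qed

lemma theta_min_eq: "theta_image Gs Ls sd (\<lambda>j i. i) m = E (perms (\<lambda>j. half_swap (m j)))"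
proof -
  have "transport (\<lambda>i. i) \<sigma> = \<sigma>" for \<sigma>
    using transport_range[of "\<lambda>i. i" \<sigma>] by (auto simp: inj_on_def)
  then show ?thesis
    by (subst theta_image_eq) (simp_all add: inj_on_def)
qed

lemma relabel_element_theta: "R (theta_image Gs Ls sd (\<lambda>j i. i) m) = \<theta> m"
proof -
  obtain M where M: "\<forall>j<p. m j \<le> M"
    using indices_bounded by blast
  \<comment> \<open>\<open>half_swap m\<close> moves only indices below \<open>2 * m\<close>.\<close>
  define N where "N = 2 * M"
  obtain \<sigma> where \<sigma>: "extends N \<sigma>"
    using extension_exists by blast
  have \<sigma>f: "finite_perms \<sigma>"
    using \<sigma> by (simp add: extends_def)
  have hc: "perms (\<lambda>j. half_swap (m j)) \<in> carrier L"
    by (intro perms_carrier finite_perms_half_swap)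
  have big: "half_swap (m j) i = i" if "j < p" "N \<le> i" for j i
    using that M by (auto simp: half_swap_def N_def)
  have small: "half_swap (m j) i < N" if "j < p" "i < N" for j i
    using that M by (auto simp: half_swap_def N_def)
  have "perms (\<lambda>j. half_swap (m j)) j x y = mat_one x y" if "j < p" "N \<le> x \<or> N \<le> y" for j x y
    using that big[OF that(1)] half_swap_involution[of "m j"]
    by (auto simp: perms_def perm_mat_def mat_one_def) metis+
  then have "R (E (perms (\<lambda>j. half_swap (m j)))) = conj_perms \<sigma> (E (perms (\<lambda>j. half_swap (m j))))"
    by (intro relabel_element_eq_conj_perms[OF \<sigma> E_in_G_min[OF hc]] label_support_initial_E)
  also have "\<dots> = E (perms (\<lambda>j. \<sigma> j \<circ> half_swap (m j) \<circ> inv_into UNIV (\<sigma> j)))"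
    by (simp add: conj_perms_E[OF \<sigma>f hc] perms_mult)
  also have "perms (\<lambda>j. \<sigma> j \<circ> half_swap (m j) \<circ> inv_into UNIV (\<sigma> j)) =
      perms (\<lambda>j. transport (\<omega> j) (half_swap (m j)))"
  proof (intro perms_cong ext)
    fix j x assume j: "j < p"
    have bij: "bij (\<sigma> j)" by (rule extends_bij[OF \<sigma> j])
    have \<sigma>\<omega>: "\<sigma> j i = \<omega> j i" if "i < N" for i
      using \<sigma> j that by (simp add: extends_def)
    show "(\<sigma> j \<circ> half_swap (m j) \<circ> inv_into UNIV (\<sigma> j)) x = transport (\<omega> j) (half_swap (m j)) x"
    proof (cases "x \<in> \<omega> j ` {..<N}")
      case True
      then obtain i where i: "i < N" "x = \<omega> j i" by blast
      then have "x = \<sigma> j i" by (simp add: \<sigma>\<omega>)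
      then have "inv_into UNIV (\<sigma> j) x = i"
        using bij_is_inj[OF bij] by simp
      then show ?thesis
        using i small[OF j i(1)] by (simp add: \<sigma>\<omega> transport_range[OF \<omega>_inj[OF j]])
    next
      case False
      have "(\<sigma> j \<circ> half_swap (m j) \<circ> inv_into UNIV (\<sigma> j)) x = x"
        using bij big[OF j extends_inverse[OF \<sigma> j False]] by (simp add: bij_is_surj surj_f_inv_f)
      moreover have "transport (\<omega> j) (half_swap (m j)) x = x"
      proof (cases "x \<in> range (\<omega> j)")
        case True
        then obtain i where i: "x = \<omega> j i" by blast
        then have "N \<le> i" using False by force
        then show ?thesis
          by (simp add: i transport_range[OF \<omega>_inj[OF j]] big[OF j])
      qed (rule transport_outside)
      ultimately show ?thesis by simp
    qed
  qed
  finally show ?thesis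
    by (simp add: theta_min_eq \<theta>_eq \<omega>_perms_def)
qed

text \<open>The support of a relabelled element lies over a finite initial segment of the enumerations
  \<open>\<omega>\<close>; conjugation by \<open>\<theta> m\<close> shifts it by \<open>m\<close>, out of the support of any given \<open>g\<close>.\<close>

lemma relabelled_element_escapes:
  assumes z: "z \<in> G_min Gs Ls sd" and g: "g \<in> carrier G"
  shows "\<forall>\<^sub>F m in indices_at_top p.
    (\<theta> m \<cdot> R z \<cdot> \<theta> m) \<cdot> g = g \<cdot> (\<theta> m \<cdot> R z \<cdot> \<theta> m)"
proof -
  obtain N \<sigma> where \<sigma>: "extends N \<sigma>" and supp: "label_support (initial N) z" and Rz: "R z = conj_perms \<sigma> z"
    using relabel_elements_as_conj_perms[of "{z}"] z by auto
  have \<sigma>f: "finite_perms \<sigma>"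
    using \<sigma> by (simp add: extends_def)
  obtain S where S: "finite S" "label_support S g"
    using g by (rule label_support_finite)
  obtain N' where N': "\<forall>j<p. \<forall>i. Some (j, \<omega> j i) \<in> S \<longrightarrow> i < N'"
    using finite_indices_bound[of S \<omega>, OF S(1) \<omega>_inj] by blast
  show ?thesis
  proof (rule eventually_mono[OF eventually_indices_ge[of p "max N N'"]])
    fix m assume m: "\<forall>j<p. max N N' \<le> m j"
    define \<tau> where "\<tau> j = transport (\<omega> j) (half_swap (m j))" for j
    have \<tau>f: "finite_perms \<tau>"
      using finite_perms_transport[OF finite_perms_half_swap] by (simp add: \<tau>_def[abs_def])
    have \<theta>: "\<theta> m = E (perms \<tau>)"
      by (simp add: \<theta>_eq \<omega>_perms_def \<tau>_def[abs_def])
    have "inv_into UNIV (\<tau> j) = \<tau> j" if "j < p" for j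
    proof (rule inv_unique_comp)
      show "\<tau> j \<circ> \<tau> j = id" "\<tau> j \<circ> \<tau> j = id"
        unfolding \<tau>_def by (rule transport_half_swap_involution[OF \<omega>_inj[OF that]])+
    qed
    then have "perms (inverses \<tau>) = perms \<tau>"
      by (rule perms_cong)
    then have conj: "\<theta> m \<cdot> R z \<cdot> \<theta> m = conj_perms \<tau> (R z)"
      by (simp add: \<theta> conj_perms_def)
    let ?S' = "map_option (\<lambda>(j, n). (j, \<tau> j n)) ` map_option (\<lambda>(j, n). (j, \<sigma> j n)) ` initial N"
    have "label_support ?S' (conj_perms \<tau> (R z))"
      unfolding Rz by (intro label_support_conj_perms \<tau>f \<sigma>f supp)
    moreover have "S \<inter> ?S' = {}"
    proof -
      have "Some (j, \<tau> j (\<sigma> j n)) \<notin> S" if j: "j < p" and n: "n < N" for j n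
      proof -
        have mj: "N \<le> m j" "N' \<le> m j" using m j by simp_all
        have "\<sigma> j n = \<omega> j n"
          using \<sigma> j n by (simp add: extends_def)
        then have "\<tau> j (\<sigma> j n) = \<omega> j (m j + n)"
          using mj n by (simp add: \<tau>_def transport_range[OF \<omega>_inj[OF j]] half_swap_def)
        moreover have "\<not> m j + n < N'" using mj by simp
        ultimately show ?thesis
          using N' j by metis
      qed
      then show ?thesis
        by (auto simp: initial_def)
    qed
    moreover have "conj_perms \<tau> (R z) \<in> carrier G"
      using conj_perms_carrier[OF \<tau>f relabel_element_carrier[OF z]] .
    ultimately show "(\<theta> m \<cdot> R z \<cdot> \<theta> m) \<cdot> g = g \<cdot> (\<theta> m \<cdot> R z \<cdot> \<theta> m)"
      unfolding conj using S(2) g by (intro label_support_commute[of ?S' _ S]) auto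
  qed
qed

end

theorem proposition3p8:
  fixes Gs :: "classical list" and Ls :: "heavy list"
    and sd :: "nat \<Rightarrow> nat \<Rightarrow> straight_data"
    and \<Xi> \<Omega> :: "nat \<Rightarrow> nat set" and \<omega> :: "nat \<Rightarrow> nat \<Rightarrow> nat"
  assumes "GL_pair Gs Ls sd"
    and "\<And>j. j < length Ls \<Longrightarrow> \<Xi> j \<union> \<Omega> j = UNIV \<and> \<Xi> j \<inter> \<Omega> j = {}"
    and "\<And>j. j < length Ls \<Longrightarrow> infinite (\<Xi> j) \<and> infinite (\<Omega> j)"
    and "\<And>j. j < length Ls \<Longrightarrow> bij_betw (\<omega> j) UNIV (\<Omega> j)"
  shows "min_product_well_defined Gs Ls sd \<and> is_semigroup (min_semigroup Gs Ls sd)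
    \<and> mantle_product_well_defined Gs Ls sd \<Xi> \<omega> \<and> is_semigroup (mantle Gs Ls sd \<Xi> \<omega>)
    \<and> (\<exists>S. central_subsemigroup S (mantle Gs Ls sd \<Xi> \<omega>)
          \<and> canonical_map Gs Ls sd \<omega>
              \<in> iso (min_semigroup Gs Ls sd) ((mantle Gs Ls sd \<Xi> \<omega>)\<lparr>carrier := S\<rparr>))"
proof -
  interpret straight_embedding Gs Ls sd
    using assms(1) by unfold_locales (simp add: GL_pair_def)
  interpret mantle: enumerated_embedding Gs Ls sd \<Xi> \<omega>
  proof
    fix j assume j: "j < length Ls"
    show "inj (\<omega> j)" "\<Xi> j = - range (\<omega> j)"
      using assms(2,4)[OF j] by (auto simp: bij_betw_def)
  qed
  interpret min: enumerated_embedding Gs Ls sd "\<lambda>_. {}" "\<lambda>j i. i"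
    by unfold_locales auto
  have P1: "spreading_pair G (G_min Gs Ls sd) (L_image Gs Ls sd) p (theta_image Gs Ls sd (\<lambda>j i. i)) min.K"
    unfolding L_image_eq using H_sub_G_min G_min_iff G_min_mult by (intro min.spreading_pairI) auto
  have P2: "spreading_pair G (carrier G) (H \<Xi>) p (theta_image Gs Ls sd \<omega>) mantle.K"
    using H_sub_G_min G_min_iff by (intro mantle.spreading_pairI) auto
  have "\<exists>S. central_subsemigroup S (mantle Gs Ls sd \<Xi> \<omega>)
      \<and> (\<lambda>a. relabel_element Gs Ls sd \<omega> ` a)
        \<in> iso (min_semigroup Gs Ls sd) ((mantle Gs Ls sd \<Xi> \<omega>)\<lparr>carrier := S\<rparr>)"
    unfolding mantle_def min_semigroup_def
    using P1 P2 mantle.relabel_element_carrier mantle.relabel_element_mult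
      mantle.inj_on_relabel_element mantle.relabel_element_L[folded L_image_eq]
      mantle.relabel_element_theta mantle.relabelled_element_escapes
    by (rule central_subsemigroup_by_transport)
  moreover have "canonical_map Gs Ls sd \<omega> = (\<lambda>a. relabel_element Gs Ls sd \<omega> ` a)"
    by (intro ext) (simp add: canonical_map_def)
  ultimately show ?thesis
    using spreading_pair.product_well_defined[OF P1] spreading_pair.semigroup_S[OF P1]
      spreading_pair.product_well_defined[OF P2] spreading_pair.semigroup_S[OF P2]
    by (simp add: min_product_well_defined_def min_semigroup_def mantle_product_well_defined_def mantle_def)
qed

end
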